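(* In the spectral sequence determined by the weight filtration on the cobar complex $C(\mathcal A_* )$, the differentials $d_3$ on the elements $h_{S,T}\in\mathcal H\subset HX=E_3$ are given by $$d_3h_{S,T}=\sum_{s\in S,\ s+1\in T}h_{s+1,s+2}\,h_{S-\{s\}+\{s+1\},\ T-\{s+1\}+\{s\}}.$$
   Context: $\mathcal A_*=\mathbb F_2[\xi_1,\xi_2,\dots]$ is the mod 2 dual Steenrod algebra, with coproduct $\psi(\xi_n)=\sum_{k=0}^n\xi_{n-k}^{2^k}\otimes\xi_k$ ($\xi_0=1$) and augmentation ideal $I$. The cobar complex $C(\mathcal A_* )$ is the tensor algebra on $I$ with $d(\alpha_1\otimes\cdots\otimes\alpha_n)=\sum_i\sum\alpha_1\otimes\cdots\otimes\alpha_i'\otimes\alpha_i''\otimes\cdots\otimes\alpha_n$, where $\psi(\alpha_i)=\alpha_i\otimes1+1\otimes\alpha_i+\sum\alpha_i'\otimes\alpha_i''$. Its homology is $\mathrm{Ext}_{\mathcal A}(\mathbb F_2,\mathbb F_2)$. Weight: $w(\xi_1^{r_1}\cdots\xi_n^{r_n})=\sum_k(2k-1)\sum_ia_{k,i}$ where $r_k=\sum_ia_{k,i}2^i$ is the 2-adic expansion, and $w(\alpha_1\otimes\cdots\otimes\alpha_n)=\sum_iw(\alpha_i)$ for monomials $\alpha_i$. $F_pC(\mathcal A_* )$ is the span of tensors of monomials of weight $\le p$; this is an increasing filtration, giving a spectral sequence $(E_r,d_r)$ with $E_0=\bigoplus_pF_p/F_{p-1}$ and $d_r$ lowering filtration by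 $r$. Its $E_1$ page is $X=\mathbb F_2[R_{ij}:0\le i<j]$, where $R_{ij}$ is the class of $\xi_{j-i}^{2^i}$, with $d_1R_{ij}=\sum_{i<k<j}R_{ik}R_{kj}$; differentials $d_r$ with $r$ even vanish for $r\ge 2$, so $E_2=E_3=HX$, the homology of $(X,d_1)$. (This $d_3$ is the $d_2$ of the May spectral sequence in May's grading.) Put $R_{ij}=0$ if $i\ge j$. For $S=\{s_1<\dots<s_n\}$, $T=\{t_1<\dots<t_n\}$ with $S\cup T$ a set of $2n$ consecutive nonnegative integers, $R_{S,T}=\det(R_{s_it_j})$ is a $d_1$-cycle and $h_{S,T}=[R_{S,T}]\in HX$ (it is zero unless $s_k<t_k$ for all $k$); $h_{s+1,s+2}=[R_{s+1,s+2}]$. $\mathcal H$ is the set of all such $h_{S,T}$ with $s_k<t_k$ for $1\le k\le n$ and $s_k<t_{k-1}$ for $2\le k\le n$. $+$ and $-$ on sets denote disjoint union and set difference. *)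

theory Defs
  imports
    "HOL-Library.Poly_Mapping"
    "HOL-Library.Product_Plus"
    "HOL-Library.Z2"
    "Jordan_Normal_Form.Determinant"
begin

section \<open>The dual Steenrod algebra\<close>

text \<open>
  Polynomials over the two-element field \<^typ>\<open>bit\<close> are finitely supported functions from
  exponent vectors to \<^typ>\<open>bit\<close>.  In the type \<open>steenrod\<close> the variable with index
  \<open>n\<close> is \<open>\<xi>\<^sub>n\<^sub>+\<^sub>1\<close>, so that no variable is wasted on \<open>\<xi>\<^sub>0 = 1\<close>.
  The tensor square is the polynomial algebra on pairs of exponent vectors.
\<close>

type_synonym mono = "nat \<Rightarrow>\<^sub>0 nat"
type_synonym steenrod = "mono \<Rightarrow>\<^sub>0 bit"
type_synonym steenrod2 = "(mono \<times> mono) \<Rightarrow>\<^sub>0 bit"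

definition xi :: "nat \<Rightarrow> steenrod" where
  "xi n = (if n = 0 then 1
           else Poly_Mapping.single (Poly_Mapping.single (n - 1) 1) 1)"

definition tensor :: "steenrod \<Rightarrow> steenrod \<Rightarrow> steenrod2" where
  "tensor p q = (\<Sum>a\<in>Poly_Mapping.keys p. \<Sum>b\<in>Poly_Mapping.keys q.
     Poly_Mapping.single (a, b) (Poly_Mapping.lookup p a * Poly_Mapping.lookup q b))"

definition psi_xi :: "nat \<Rightarrow> steenrod2" where
  "psi_xi n = (\<Sum>k\<le>n. tensor (xi (n - k) ^ (2 ^ k)) (xi k))"

definition psi :: "steenrod \<Rightarrow> steenrod2" where
  "psi p = (\<Sum>m\<in>Poly_Mapping.keys p.
     Poly_Mapping.single 0 (Poly_Mapping.lookup p m) *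
     (\<Prod>n\<in>Poly_Mapping.keys m. psi_xi (Suc n) ^ Poly_Mapping.lookup m n))"

definition psi_red :: "steenrod \<Rightarrow> steenrod2" where
  "psi_red p = psi p - tensor p 1 - tensor 1 p"


section \<open>The cobar complex and its weight filtration\<close>

text \<open>
  A word \<open>[\<alpha>\<^sub>1,\<dots>,\<alpha>\<^sub>n]\<close> of monomials stands for
  \<open>\<alpha>\<^sub>1 \<otimes> \<dots> \<otimes> \<alpha>\<^sub>n\<close>.
  The monomials different from \<open>1\<close> (exponent vector \<open>0\<close>) are a basis of the augmentation
  ideal, so the cobar complex is the span of the words not containing \<open>0\<close>; this
  condition is part of \<open>cobar_F\<close> below.
\<close>

type_synonym cobar = "mono list \<Rightarrow>\<^sub>0 bit"

definition cobar_d_word :: "mono list \<Rightarrow> cobar" where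
  "cobar_d_word l = (\<Sum>i<length l.
     let c = psi_red (Poly_Mapping.single (l ! i) 1) in
     \<Sum>(a, b)\<in>Poly_Mapping.keys c.
       Poly_Mapping.single (take i l @ [a, b] @ drop (Suc i) l) (Poly_Mapping.lookup c (a, b)))"

text \<open>Every key has coefficient \<open>1\<close>, so this is the linear extension.\<close>

definition cobar_d :: "cobar \<Rightarrow> cobar" where
  "cobar_d x = (\<Sum>l\<in>Poly_Mapping.keys x. cobar_d_word l)"

text \<open>
  \<open>card {i. bit r i}\<close> is the sum of the binary digits of \<open>r\<close>; the factor
  \<open>2 * n + 1\<close> is \<open>2k - 1\<close> for the variable \<open>\<xi>\<^sub>k\<close>, \<open>k = n + 1\<close>.
\<close>

definition weight :: "mono \<Rightarrow> nat" where
  "weight m = (\<Sum>n\<in>Poly_Mapping.keys m. (2 * n + 1) * card {i. bit (Poly_Mapping.lookup m n) i})"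

definition word_weight :: "mono list \<Rightarrow> nat" where
  "word_weight l = (\<Sum>m\<leftarrow>l. weight m)"

definition cobar_F :: "int \<Rightarrow> cobar set" where
  "cobar_F p = {x. \<forall>l\<in>Poly_Mapping.keys x. 0 \<notin> set l \<and> int (word_weight l) \<le> p}"


section \<open>The spectral sequence of an increasing filtration\<close>

text \<open>
  \<open>E\<^sub>r\<^sup>p = Z\<^sub>r\<^sup>p / B\<^sub>r\<^sup>p\<close> with
  \<open>Z\<^sub>r\<^sup>p = {x \<in> F\<^sub>p. d x \<in> F\<^sub>p\<^sub>-\<^sub>r}\<close> and
  \<open>B\<^sub>r\<^sup>p = Z\<^sub>r\<^sub>-\<^sub>1\<^sup>p\<^sup>-\<^sup>1 + d Z\<^sub>r\<^sub>-\<^sub>1\<^sup>p\<^sup>+\<^sup>r\<^sup>-\<^sup>1\<close>;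
  for \<open>r = 0\<close> this is \<open>F\<^sub>p / F\<^sub>p\<^sub>-\<^sub>1\<close>.
  Elements of \<open>E\<^sub>r\<^sup>p\<close> are cosets.  An element \<open>e\<close> of the page
  \<open>E\<^sub>r\<close>, the direct sum over \<open>p\<close>, is given by its components \<open>e p\<close>.
\<close>

definition ss_Z :: "('a::ab_group_add \<Rightarrow> 'a) \<Rightarrow> (int \<Rightarrow> 'a set) \<Rightarrow> int \<Rightarrow> int \<Rightarrow> 'a set" where
  "ss_Z d F r p = {x \<in> F p. d x \<in> F (p - r)}"

definition ss_B :: "('a::ab_group_add \<Rightarrow> 'a) \<Rightarrow> (int \<Rightarrow> 'a set) \<Rightarrow> int \<Rightarrow> int \<Rightarrow> 'a set" where
  "ss_B d F r p = {u + d v | u v. u \<in> ss_Z d F (r - 1) (p - 1) \<and> v \<in> ss_Z d F (r - 1) (p + r - 1)}"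

definition ss_class ::
  "('a::ab_group_add \<Rightarrow> 'a) \<Rightarrow> (int \<Rightarrow> 'a set) \<Rightarrow> int \<Rightarrow> int \<Rightarrow> 'a \<Rightarrow> 'a set" where
  "ss_class d F r p x = {x + b | b. b \<in> ss_B d F r p}"

definition ss_E :: "('a::ab_group_add \<Rightarrow> 'a) \<Rightarrow> (int \<Rightarrow> 'a set) \<Rightarrow> int \<Rightarrow> int \<Rightarrow> 'a set set" where
  "ss_E d F r p = ss_class d F r p ` ss_Z d F r p"

text \<open>
  \<open>d\<^sub>r : E\<^sub>r\<^sup>p \<rightarrow> E\<^sub>r\<^sup>p\<^sup>-\<^sup>r\<close> sends the class of \<open>x\<close> to the class of \<open>d x\<close>;
  all \<open>x\<close> in a coset give the same class, so the union is that class.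
\<close>

definition ss_d ::
  "('a::ab_group_add \<Rightarrow> 'a) \<Rightarrow> (int \<Rightarrow> 'a set) \<Rightarrow> int \<Rightarrow> (int \<Rightarrow> 'a set) \<Rightarrow> (int \<Rightarrow> 'a set)" where
  "ss_d d F r e = (\<lambda>p. \<Union>x\<in>e (p + r). ss_class d F r p (d x))"


section \<open>The differential algebra \<open>X\<close> and its homology\<close>

text \<open>
  The variable with index \<open>(i, n)\<close> is \<open>R\<^sub>i\<^sub>j\<close> for \<open>j = i + n + 1\<close>,
  that is, the class of \<open>\<xi>\<^sub>n\<^sub>+\<^sub>1\<close> to the power \<open>2\<^sup>i\<close>.
  Thus every index is a pair \<open>0 \<le> i < j\<close>.
\<close>

type_synonym xmono = "(nat \<times> nat) \<Rightarrow>\<^sub>0 nat"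
type_synonym X = "xmono \<Rightarrow>\<^sub>0 bit"

definition R :: "nat \<Rightarrow> nat \<Rightarrow> X" where
  "R i j = (if i < j then Poly_Mapping.single (Poly_Mapping.single (i, j - i - 1) 1) 1 else 0)"

definition dX_var :: "nat \<times> nat \<Rightarrow> X" where
  "dX_var v = (case v of (i, n) \<Rightarrow> let j = i + n + 1 in \<Sum>k\<in>{i<..<j}. R i k * R k j)"

text \<open>The derivation extending \<open>dX_var\<close>.\<close>

definition dX_mono :: "xmono \<Rightarrow> X" where
  "dX_mono m = (\<Sum>v\<in>Poly_Mapping.keys m.
     of_nat (Poly_Mapping.lookup m v) *
     Poly_Mapping.single (m - Poly_Mapping.single v 1) 1 * dX_var v)"

definition dX :: "X \<Rightarrow> X" where
  "dX x = (\<Sum>m\<in>Poly_Mapping.keys x. Poly_Mapping.single 0 (Poly_Mapping.lookup x m) * dX_mono m)"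

lemma dX_0 [simp]: "dX 0 = 0"
  by (simp add: dX_def)

lemma dX_add: "dX (x + y) = dX x + dX y"
  unfolding dX_def
  by (rule setsum_keys_plus_distrib[where f = "\<lambda>m c. Poly_Mapping.single 0 c * dX_mono m"])
    (simp_all only: single_zero mult_zero_left single_add distrib_right)

lemma dX_minus: "dX (- x) = - dX x"
  using dX_add[of x "- x"] by (simp add: add_eq_0_iff)

lemma dX_diff: "dX (x - y) = dX x - dX y"
  using dX_add[of x "- y"] by (simp add: dX_minus)

lemma dX_single: "dX (Poly_Mapping.single m c) = Poly_Mapping.single 0 c * dX_mono m"
  by (cases "c = 0") (simp_all add: dX_def)

lemma dX_mono_superset:
  assumes "finite K" "Poly_Mapping.keys m \<subseteq> K"
  shows "dX_mono m = (\<Sum>v\<in>K. of_nat (Poly_Mapping.lookup m v) *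
     Poly_Mapping.single (m - Poly_Mapping.single v 1) 1 * dX_var v)"
  unfolding dX_mono_def using assms
  by (intro sum.mono_neutral_left) (auto simp: in_keys_iff)

lemma single_diff_add:
  fixes m n :: xmono
  assumes "Poly_Mapping.lookup m v \<noteq> 0"
  shows "m + n - Poly_Mapping.single v 1 = (m - Poly_Mapping.single v 1) + n"
  using assms by (intro poly_mapping_eqI) (auto simp: lookup_add lookup_minus lookup_single when_def)

lemma dX_mono_add:
  "dX_mono (m + n) = dX_mono m * Poly_Mapping.single n 1 + Poly_Mapping.single m 1 * dX_mono n"
proof -
  let ?K = "Poly_Mapping.keys m \<union> Poly_Mapping.keys n"
  let ?t = "\<lambda>m v. of_nat (Poly_Mapping.lookup m v) *
     Poly_Mapping.single (m - Poly_Mapping.single v 1) (1::bit) * dX_var v"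
  have K: "finite ?K" by simp
  have "?t (m + n) v = ?t m v * Poly_Mapping.single n 1 + Poly_Mapping.single m 1 * ?t n v" for v
  proof -
    have 1: "of_nat (Poly_Mapping.lookup m v) * Poly_Mapping.single (m + n - Poly_Mapping.single v 1) (1::bit)
        = of_nat (Poly_Mapping.lookup m v) * Poly_Mapping.single (m - Poly_Mapping.single v 1) 1
          * Poly_Mapping.single n 1"
      by (cases "Poly_Mapping.lookup m v = 0")
        (simp_all add: mult_single mult.assoc single_diff_add[simplified])
    have 2: "of_nat (Poly_Mapping.lookup n v) * Poly_Mapping.single (m + n - Poly_Mapping.single v 1) (1::bit)
        = Poly_Mapping.single m 1 *
          (of_nat (Poly_Mapping.lookup n v) * Poly_Mapping.single (n - Poly_Mapping.single v 1) 1)"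
    proof (cases "Poly_Mapping.lookup n v = 0")
      case False
      then show ?thesis
        using single_diff_add[of n v m]
        by (simp add: mult_single add.commute mult.left_commute[of "Poly_Mapping.single m 1"])
    qed simp
    show ?thesis
      unfolding lookup_add of_nat_add distrib_right 1 2
      by (simp add: mult_ac)
  qed
  then show ?thesis
    using dX_mono_superset[OF K, of m] dX_mono_superset[OF K, of n]
      dX_mono_superset[OF K keys_add]
    by (simp add: sum.distrib sum_distrib_left sum_distrib_right)
qed

lemma X_induct:
  fixes x :: X
  assumes "P 0" "\<And>m c y. P y \<Longrightarrow> P (y + Poly_Mapping.single m c)"
  shows "P x"
proof (induction x rule: update_induct)
  case const
  then show ?case using assms(1) by simp
next
  case (update f a b)
  have "Poly_Mapping.update a b f = f + Poly_Mapping.single a b"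
    using update(1)
    by (intro poly_mapping_eqI) (auto simp: lookup_update lookup_add lookup_single when_def in_keys_iff)
  then show ?case using assms(2)[OF update(3)] by simp
qed

lemma dX_mult: "dX (x * y) = dX x * y + x * dX y"
proof (induction x rule: X_induct)
  case (2 m c x)
  have "dX (Poly_Mapping.single m c * y) =
      dX (Poly_Mapping.single m c) * y + Poly_Mapping.single m c * dX y"
  proof (induction y rule: X_induct)
    case (2 n e y)
    let ?m = "Poly_Mapping.single m (1::bit)" and ?n = "Poly_Mapping.single n (1::bit)"
    let ?c = "Poly_Mapping.single (0::xmono) c" and ?e = "Poly_Mapping.single (0::xmono) e"
    have c: "Poly_Mapping.single m c = ?c * ?m" and e: "Poly_Mapping.single n e = ?e * ?n"
      by (simp_all only: mult_single add_0_left mult_1_right)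
    have "dX (Poly_Mapping.single m c * Poly_Mapping.single n e)
      = Poly_Mapping.single 0 (c * e) * dX_mono (m + n)"
      by (simp only: mult_single dX_single)
    also have "\<dots> = ?c * ?e * (dX_mono m * ?n + ?m * dX_mono n)"
      by (simp only: mult_single add_0_left dX_mono_add)
    also have "\<dots> = (?c * dX_mono m) * (?e * ?n) + (?c * ?m) * (?e * dX_mono n)"
      by (simp only: distrib_left mult_ac)
    also have "\<dots> = dX (Poly_Mapping.single m c) * Poly_Mapping.single n e
        + Poly_Mapping.single m c * dX (Poly_Mapping.single n e)"
      by (simp only: dX_single c[symmetric] e[symmetric])
    finally show ?case using 2 by (simp only: distrib_left dX_add add_ac)
  qed simp
  then show ?case using 2 by (simp only: distrib_right dX_add add_ac)
qed simp

text \<open>\<open>HX\<close> is the quotient of the cycles by the boundaries.\<close>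

definition homologous :: "X \<Rightarrow> X \<Rightarrow> bool" where
  "homologous x y \<longleftrightarrow> dX x = 0 \<and> dX y = 0 \<and> (\<exists>u. x - y = dX u)"

lemma homologousE:
  assumes "homologous x y"
  obtains u where "dX x = 0" "dX y = 0" "x = y + dX u"
  using assms unfolding homologous_def by (metis add.commute diff_add_cancel)

lemma homologousI: "dX x = 0 \<Longrightarrow> dX y = 0 \<Longrightarrow> x = y + dX u \<Longrightarrow> homologous x y"
  unfolding homologous_def by auto

quotient_type HX = X / partial: homologous
  morphisms rep_HX HX_class
proof (rule part_equivpI)
  show "\<exists>x. homologous x x"
    by (rule exI[of _ 0]) (auto simp: homologous_def intro: exI[of _ 0])
  show "symp homologous"
  proof (rule sympI)
    fix x y assume "homologous x y"
    then obtain u where "dX x = 0" "dX y = 0" "x = y + dX u" by (rule homologousE)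
    then show "homologous y x" by (intro homologousI[of _ _ "- u"]) (simp_all add: dX_minus)
  qed
  show "transp homologous"
  proof (rule transpI)
    fix x y z assume "homologous x y" "homologous y z"
    then obtain u v where "dX x = 0" "dX z = 0" "x = y + dX u" "y = z + dX v"
      by (metis homologousE)
    then show "homologous x z" by (intro homologousI[of _ _ "v + u"]) (simp_all add: dX_add)
  qed
qed

instantiation HX :: comm_ring
begin

lift_definition zero_HX :: HX is 0
  by (intro homologousI[of _ _ 0]) simp_all

lift_definition plus_HX :: "HX \<Rightarrow> HX \<Rightarrow> HX" is "(+)"
proof (elim homologousE)
  fix a b c e u v assume "dX b = 0" "dX e = 0" "a = b + dX u" "c = e + dX v" "dX a = 0" "dX c = 0"
  then show "homologous (a + c) (b + e)"
    by (intro homologousI[of _ _ "u + v"]) (simp_all add: dX_add)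
qed

lift_definition uminus_HX :: "HX \<Rightarrow> HX" is uminus
proof (elim homologousE)
  fix a b u assume *: "dX b = 0" "a = b + dX u" "dX a = 0"
  have "- a = - b + dX (- u)" by (simp add: *(2) dX_minus)
  moreover have "dX (- a) = 0" "dX (- b) = 0" by (simp_all only: dX_minus *(1,3) neg_0_equal_iff_equal minus_zero)
  ultimately show "homologous (- a) (- b)" by (blast intro: homologousI)
qed

lift_definition minus_HX :: "HX \<Rightarrow> HX \<Rightarrow> HX" is "(-)"
proof (elim homologousE)
  fix a b c e u v assume "dX b = 0" "dX e = 0" "a = b + dX u" "c = e + dX v" "dX a = 0" "dX c = 0"
  then show "homologous (a - c) (b - e)"
    by (intro homologousI[of _ _ "u - v"]) (simp_all add: dX_diff)
qed

lift_definition times_HX :: "HX \<Rightarrow> HX \<Rightarrow> HX" is "(*)"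
proof (elim homologousE)
  fix a b c e u v
  assume *: "dX b = 0" "dX e = 0" "a = b + dX u" "c = e + dX v" "dX a = 0" "dX c = 0"
  have "a * c = b * e + (dX u * c + b * dX v)" by (simp add: * algebra_simps)
  also have "dX u * c + b * dX v = dX (u * c + b * v)" using * by (simp add: dX_add dX_mult)
  finally have "a * c = b * e + dX (u * c + b * v)" .
  moreover have "dX (a * c) = 0" "dX (b * e) = 0"
    by (simp_all only: dX_mult *(1,2,5,6) mult_zero_left mult_zero_right add_0_left)
  ultimately show "homologous (a * c) (b * e)" by (blast intro: homologousI)
qed

instance
proof
  have r: "homologous x x" if "dX x = 0" for x
    using that by (intro homologousI[of _ _ 0]) simp_all
  fix a b c :: HX
  show "a + b + c = a + (b + c)" by transfer (auto simp: homologous_def dX_add add.assoc intro: exI[of _ 0])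
  show "a + b = b + a" by transfer (auto simp: homologous_def dX_add add.commute intro: exI[of _ 0])
  show "0 + a = a" by transfer (auto simp: homologous_def intro: exI[of _ 0])
  show "- a + a = 0" by transfer (auto simp: homologous_def dX_add intro: exI[of _ 0])
  show "a - b = a + - b" by transfer (auto simp: homologous_def dX_diff dX_minus dX_add intro: exI[of _ 0])
  show "a * b * c = a * (b * c)"
    by transfer (auto simp: homologous_def dX_mult mult.assoc intro: exI[of _ 0])
  show "a * b = b * a"
    by transfer (auto simp: homologous_def dX_mult mult.commute intro: exI[of _ 0])
  show "(a + b) * c = a * c + b * c"
    by transfer (auto simp: homologous_def dX_mult dX_add distrib_right intro: exI[of _ 0])
qed

end

text \<open>Indexing from \<open>0\<close>: \<open>elt S k\<close> is \<open>s\<^sub>k\<^sub>+\<^sub>1\<close>.\<close>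

definition elt :: "nat set \<Rightarrow> nat \<Rightarrow> nat" where
  "elt S k = sorted_list_of_set S ! k"

definition R_det :: "nat set \<Rightarrow> nat set \<Rightarrow> X" where
  "R_det S T = det (mat (card S) (card S) (\<lambda>(i, j). R (elt S i) (elt T j)))"

definition h :: "nat set \<Rightarrow> nat set \<Rightarrow> HX" where
  "h S T = HX_class (R_det S T)"

text \<open>The pairs \<open>(S, T)\<close> for which \<open>h S T\<close> belongs to the family \<open>\<H>\<close>.\<close>

definition H_index :: "nat set \<Rightarrow> nat set \<Rightarrow> bool" where
  "H_index S T \<longleftrightarrow> (\<exists>a n. card S = n \<and> card T = n \<and> S \<union> T = {a..<a + 2 * n} \<and>
     (\<forall>k<n. elt S k < elt T k) \<and>
     (\<forall>k. 1 \<le> k \<and> k < n \<longrightarrow> elt S k < elt T (k - 1)))"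


section \<open>The identification of \<open>HX\<close> with \<open>E\<^sub>3\<close>\<close>

text \<open>
  The algebra isomorphism from \<open>X\<close> to \<open>E\<^sub>1\<close> sends \<open>R\<^sub>i\<^sub>j\<close> to the class of the
  one-letter word \<open>\<xi>\<^sub>j\<^sub>-\<^sub>i\<close> to the power \<open>2\<^sup>i\<close>, and the product on
  \<open>E\<^sub>1\<close> is induced by concatenation.  Hence a monomial in the \<open>R\<^sub>i\<^sub>j\<close> goes to the class of the
  word formed by its factors, written in any order since \<open>E\<^sub>1\<close> is commutative.
  \<open>X_to_cobar p\<close> lifts the weight \<open>p\<close> component of an element of \<open>X\<close> in this way.
\<close>

definition letter :: "nat \<times> nat \<Rightarrow> mono" where
  "letter v = (case v of (i, n) \<Rightarrow> Poly_Mapping.single n (2 ^ i))"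

definition factors :: "xmono \<Rightarrow> (nat \<times> nat) list" where
  "factors m = (SOME vs. \<forall>v. count_list vs v = Poly_Mapping.lookup m v)"

definition word :: "xmono \<Rightarrow> mono list" where
  "word m = map letter (factors m)"

definition X_to_cobar :: "int \<Rightarrow> X \<Rightarrow> cobar" where
  "X_to_cobar p z = (\<Sum>m\<in>{m \<in> Poly_Mapping.keys z. int (word_weight (word m)) = p}.
     Poly_Mapping.single (word m) (Poly_Mapping.lookup z m))"

definition X_to_E1 :: "X \<Rightarrow> int \<Rightarrow> cobar set" where
  "X_to_E1 z p = ss_class cobar_d cobar_F 1 p (X_to_cobar p z)"

text \<open>
  Through \<open>E\<^sub>2 = H(E\<^sub>1)\<close> and \<open>E\<^sub>3 = E\<^sub>2\<close> the class of a cycle \<open>z\<close> of \<open>X\<close> corresponds to the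
  unique element of \<open>E\<^sub>3\<close> which has a representative \<open>x\<close> whose class in \<open>E\<^sub>1\<close> is
  that of \<open>z\<close>.
\<close>

definition HX_to_E3 :: "HX \<Rightarrow> int \<Rightarrow> cobar set" where
  "HX_to_E3 a p = (THE e. e \<in> ss_E cobar_d cobar_F 3 p \<and>
     (\<exists>z. dX z = 0 \<and> HX_class z = a \<and>
       (\<exists>x\<in>e. ss_class cobar_d cobar_F 1 p x = X_to_E1 z p)))"

definition d3 :: "(int \<Rightarrow> cobar set) \<Rightarrow> (int \<Rightarrow> cobar set)" where
  "d3 = ss_d cobar_d cobar_F 3"

end

theory Submission
  imports Defs
begin

text \<open>
  The matrix \<open>x\<^sub>i\<^sub>j = \<xi>\<^sub>j\<^sub>-\<^sub>i\<close> to the power \<open>2\<^sup>i\<close> satisfies \<open>\<psi>(x\<^sub>i\<^sub>j) = \<Sum>\<^sub>m x\<^sub>m\<^sub>j \<otimes> x\<^sub>i\<^sub>m\<close> and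
  \<open>x\<^sub>i\<^sub>j\<^sup>2 = x\<^sub>i\<^sub>+\<^sub>1\<^sub>,\<^sub>j\<^sub>+\<^sub>1\<close>.  It coacts on polynomials in variables \<open>e\<^sub>i\<close> by
  \<open>e\<^sub>j \<mapsto> \<Sum>\<^sub>i x\<^sub>j\<^sub>i e\<^sub>i\<close>.  Going through the indices of \<open>S \<union> T\<close> in increasing order one
  builds cochains \<open>f\<^sub>K\<close>, for square-free monomials \<open>e\<^sub>K\<close>: an index \<open>s \<in> S\<close> multiplies the monomials by
  \<open>e\<^sub>s\<close>, and an index \<open>t \<in> T\<close> replaces \<open>f\<^sub>K\<close> by \<open>\<Sum>\<^sub>J [c\<^sub>J\<^sub>K | f\<^sub>J]\<close>, where \<open>c\<^sub>J\<^sub>K\<close> is the coefficient of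
  \<open>e\<^sub>t e\<^sub>K\<close> in the image of \<open>e\<^sub>J\<close>.  After the last index this is a cochain whose leading term is
  \<open>R\<^sub>S\<^sub>,\<^sub>T\<close>.  Since the coaction is coassociative, everything in its coboundary cancels except the
  terms passing through monomials with a square.  These involve \<open>e\<^sub>i\<^sup>2 \<mapsto> \<Sum>\<^sub>j x\<^sub>i\<^sub>j\<^sup>2 e\<^sub>j\<^sup>2\<close>; the ones of
  highest weight have \<open>i = t - 1\<close>, and they contribute \<open>x\<^sub>t\<^sub>-\<^sub>1\<^sub>,\<^sub>t\<^sup>2 = x\<^sub>t\<^sub>,\<^sub>t\<^sub>+\<^sub>1\<close> times the same
  construction with \<open>t - 1 \<in> S\<close> and \<open>t \<in> T\<close> exchanged.

  The passage to \<open>E\<^sub>3\<close> does not need that \<open>X\<close> is all of \<open>E\<^sub>1\<close>: it suffices that letters commute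
  up to \<open>d F\<^sub>p + F\<^sub>p\<^sub>-\<^sub>1\<close>, which makes \<open>X \<rightarrow> E\<^sub>1\<close> a chain map.
\<close>

section \<open>Linear extension over the field with two elements\<close>

text \<open>In characteristic two the squares \<open>e_i^2\<close> span a subcomodule, so they
  generate a stable ideal of the polynomial algebra. The quotient is the exterior algebra, whose
  matrix coefficients are the minors of \<open>xij\<close>. Hence square-free monomials suit a
  determinant, and only squares obstruct a cocycle. Squares enter because \<open>K\<close> may
  contain \<open>t\<close>, in which case \<open>e_t e_K\<close> contains \<open>e_t^2\<close>. The
  number three is a weight count. A letter moving an index from j to i has weight 2(i - j) - 1. If
  \<open>e_i^2\<close> occurs on the way to \<open>e_t^2\<close>, the top weight provides 4(t - i)
  for this passage, but one letter of weight 2(t - i) - 1 does the work. The loss 2(t - i) + 1 is at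
  least three, with equality only for i = t - 1. The final cochain is the one for
  \<open>K = {}\<close>. No other monomial has a nonzero coefficient there, so its coboundary equals
  the accumulated failure exactly. It therefore gives an element of \<open>ss_Z\<close> for r = 3 at
  once, without successive corrections on the earlier pages.\<close>

lemma pm_bit_add_self [simp]: "(x :: 'a \<Rightarrow>\<^sub>0 bit) + x = 0"
  by (intro poly_mapping_eqI) (simp add: lookup_add)

lemma pm_bit_add_cancel [simp]: "(x :: 'a \<Rightarrow>\<^sub>0 bit) + (x + y) = y"
  by (simp flip: add.assoc)

lemma pm_bit_minus [simp]: "- (x :: 'a \<Rightarrow>\<^sub>0 bit) = x"
  by (simp add: minus_unique)

lemma pm_bit_diff [simp]: "(x :: 'a \<Rightarrow>\<^sub>0 bit) - y = x + y"
  by (metis diff_conv_add_uminus pm_bit_minus)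

abbreviation basis :: "'a \<Rightarrow> 'a \<Rightarrow>\<^sub>0 bit" where
  "basis k \<equiv> Poly_Mapping.single k 1"

lemma pm_bit_induct [case_names zero add]:
  fixes x :: "'a \<Rightarrow>\<^sub>0 bit"
  assumes "P 0" "\<And>m x. m \<notin> Poly_Mapping.keys x \<Longrightarrow> P x \<Longrightarrow> P (basis m + x)"
  shows "P x"
proof (induction x rule: update_induct)
  case const
  then show ?case using assms(1) by simp
next
  case (update f a b)
  then have "Poly_Mapping.update a b f = basis a + f"
    by (intro poly_mapping_eqI) (auto simp: lookup_update lookup_add lookup_single when_def in_keys_iff)
  then show ?case using assms(2)[OF update(1,3)] by simp
qed

lemma lookup_bit_keys: "Poly_Mapping.lookup (x :: 'a \<Rightarrow>\<^sub>0 bit) k = (if k \<in> Poly_Mapping.keys x then 1 else 0)"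
  by (auto simp: in_keys_iff)

lemma keys_basis_add: "m \<notin> Poly_Mapping.keys x \<Longrightarrow> Poly_Mapping.keys (basis m + x) = insert m (Poly_Mapping.keys x)"
  by (auto simp: in_keys_iff lookup_add lookup_single when_def split: if_splits)

lemma pm_bit_sum: "(x :: 'a \<Rightarrow>\<^sub>0 bit) = (\<Sum>k\<in>Poly_Mapping.keys x. basis k)"
proof (induction x rule: pm_bit_induct)
  case (add m x)
  then show ?case by (simp add: keys_basis_add)
qed simp

definition lin :: "('a \<Rightarrow> ('b \<Rightarrow>\<^sub>0 bit)) \<Rightarrow> ('a \<Rightarrow>\<^sub>0 bit) \<Rightarrow> 'b \<Rightarrow>\<^sub>0 bit" where
  "lin f x = (\<Sum>k\<in>Poly_Mapping.keys x. f k)"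

lemma lin_0 [simp]: "lin f 0 = 0"
  by (simp add: lin_def)

lemma lin_basis [simp]: "lin f (basis k) = f k"
  by (simp add: lin_def)

text \<open>Keys common to both arguments cancel, so the key sets do not add up. A summand that
  tests the coefficient is additive in that coefficient, and sums of such summands do split.\<close>

lemma lin_add: "lin f (x + y) = lin f x + lin f y"
proof -
  have *: "(if c + d = 0 then 0 else f m) = (if c = 0 then 0 else f m) + (if d = 0 then 0 else f m)"
    for c d :: bit and m
    by (cases c; cases d) simp_all
  have "lin f x = (\<Sum>k\<in>Poly_Mapping.keys x. if Poly_Mapping.lookup x k = 0 then 0 else f k)" for x
    unfolding lin_def by (rule sum.cong) (auto simp: in_keys_iff)
  then show ?thesis
    using setsum_keys_plus_distrib[where f = "\<lambda>m c. if c = 0 then 0 else f m" and p = x and q = y] *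
    by simp
qed

lemma lin_sum: "lin f (sum g A) = (\<Sum>a\<in>A. lin f (g a))"
  by (induction A rule: infinite_finite_induct) (simp_all add: lin_add)

lemma lin_fun_add: "lin (\<lambda>k. f k + g k) x = lin f x + lin g x"
  by (simp add: lin_def sum.distrib)

lemma lin_fun_0 [simp]: "lin (\<lambda>k. 0) x = 0"
  by (simp add: lin_def)

lemma lin_id [simp]: "lin basis x = x"
  using pm_bit_sum[of x] by (simp add: lin_def)

lemma lin_lin: "lin f (lin g x) = lin (\<lambda>k. lin f (g k)) x"
  by (simp add: lin_def[of g] lin_def[of "\<lambda>k. lin f (g k)"] lin_sum)

lemma basis_add: "basis (a + b) = (basis a * basis b :: _ \<Rightarrow>\<^sub>0 bit)"
  by (simp add: mult_single)

lemma basis_0 [simp]: "basis 0 = 1"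
  by simp

text \<open>Universal property of a monoid algebra. The algebra maps below are all
  \<open>lin\<close> of a multiplicative map on exponents and get their multiplicativity from
  here.\<close>

lemma lin_mult:
  fixes g :: "'a::comm_monoid_add \<Rightarrow> ('b::comm_monoid_add \<Rightarrow>\<^sub>0 bit)"
  assumes "\<And>a b. g (a + b) = g a * g b"
  shows "lin g (x * y) = lin g x * lin g y"
proof (induction x rule: pm_bit_induct)
  case (add m x)
  have "lin g (basis m * y) = g m * lin g y"
    by (induction y rule: pm_bit_induct) (simp_all add: distrib_left lin_add assms flip: basis_add)
  then show ?case using add by (simp add: distrib_right lin_add)
qed simp

lemma lin_1: "lin g 1 = g 0"
  using lin_basis[of g 0] by simp

lemma pm_bit_power2_add: "((x :: 'a::comm_monoid_add \<Rightarrow>\<^sub>0 bit) + y) ^ 2 ^ n = x ^ 2 ^ n + y ^ 2 ^ n"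
proof (induction n)
  case (Suc n)
  have sq: "(a + b) * (a + b) = a * a + b * (b :: 'a \<Rightarrow>\<^sub>0 bit)" for a b
    by (simp add: algebra_simps)
  show ?case using Suc by (simp add: power_mult[of _ _ "2"] power_mult_distrib power2_eq_square sq
    mult.commute[of 2] power_mult)
qed simp

lemma pm_bit_power2_sum: "(sum f A :: 'a::comm_monoid_add \<Rightarrow>\<^sub>0 bit) ^ 2 ^ n = (\<Sum>a\<in>A. f a ^ 2 ^ n)"
  by (induction A rule: infinite_finite_induct) (simp_all add: pm_bit_power2_add zero_power)

text \<open>Exponent vectors form a free commutative monoid, so multiplicative maps are determined
  by the variables. Coassociativity and the counit laws thus need checking on generators
  only.\<close>

lemma multiplicative_eqI:
  fixes f g :: "('i \<Rightarrow>\<^sub>0 nat) \<Rightarrow> 'r::comm_monoid_mult"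
  assumes "\<And>a b. f (a + b) = f a * f b" "\<And>a b. g (a + b) = g a * g b" "f 0 = 1" "g 0 = 1"
    and "\<And>n. f (Poly_Mapping.single n 1) = g (Poly_Mapping.single n 1)"
  shows "f = g"
proof
  fix m
  have s: "f (Poly_Mapping.single n k) = g (Poly_Mapping.single n k)" for n k
  proof (induction k)
    case (Suc k)
    have "Poly_Mapping.single n (Suc k) = Poly_Mapping.single n 1 + Poly_Mapping.single n k"
      by (simp flip: single_add)
    then show ?case using Suc assms by metis
  qed (simp add: assms)
  show "f m = g m"
  proof (induction m rule: update_induct)
    case (update m a b)
    then have "Poly_Mapping.update a b m = Poly_Mapping.single a b + m"
      by (intro poly_mapping_eqI) (auto simp: lookup_update lookup_add lookup_single when_def in_keys_iff)
    then show ?case using update s assms by simp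
  qed (simp add: assms)
qed

section \<open>The coproduct\<close>

lemma tensor_eq_lin: "tensor p q = lin (\<lambda>a. lin (\<lambda>b. basis (a, b)) q) p"
  unfolding tensor_def lin_def by (intro sum.cong refl) (simp add: lookup_bit_keys)

lemma tensor_add_left: "tensor (p + p') q = tensor p q + tensor p' q"
  by (simp add: tensor_eq_lin lin_add)

lemma tensor_add_right: "tensor p (q + q') = tensor p q + tensor p q'"
  by (simp add: tensor_eq_lin lin_add lin_fun_add)

lemma tensor_0_left [simp]: "tensor 0 q = 0"
  and tensor_0_right [simp]: "tensor p 0 = 0"
  by (simp_all add: tensor_eq_lin)

lemma tensor_sum_left: "tensor (sum f A) q = (\<Sum>a\<in>A. tensor (f a) q)"
  by (induction A rule: infinite_finite_induct) (simp_all add: tensor_add_left)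

lemma tensor_sum_right: "tensor p (sum f A) = (\<Sum>a\<in>A. tensor p (f a))"
  by (induction A rule: infinite_finite_induct) (simp_all add: tensor_add_right)

lemma tensor_basis: "tensor (basis a) (basis b) = basis (a, b)"
  by (simp add: tensor_eq_lin)

lemma tensor_1_right: "tensor p 1 = lin (\<lambda>a. basis (a, 0)) p"
  by (simp add: tensor_eq_lin lin_1)

lemma tensor_1_left: "tensor 1 q = lin (\<lambda>b. basis (0, b)) q"
  by (simp add: tensor_eq_lin lin_1)

lemma tensor_1_right_mult: "tensor (p * p') 1 = tensor p 1 * tensor p' 1"
  unfolding tensor_1_right by (rule lin_mult) (simp add: mult_single)

lemma tensor_1_left_mult: "tensor 1 (q * q') = tensor 1 q * tensor 1 q'"
  unfolding tensor_1_left by (rule lin_mult) (simp add: mult_single)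

text \<open>The two tensor factors are images of algebra embeddings. Each embedding is
  multiplicative by \<open>lin_mult\<close>, and products of general tensors follow by
  regrouping.\<close>

lemma tensor_factor: "tensor p q = tensor p 1 * tensor 1 q"
proof (induction p rule: pm_bit_induct)
  case (add m p)
  have "tensor (basis m) q = tensor (basis m) 1 * tensor 1 q"
    by (induction q rule: pm_bit_induct)
      (simp_all add: tensor_add_right distrib_left tensor_basis mult_single
        tensor_1_right tensor_1_left lin_add)
  then show ?case using add by (simp add: tensor_add_left distrib_right)
qed simp

lemma tensor_mult: "tensor p q * tensor p' q' = tensor (p * p') (q * q')"
proof -
  have "tensor p q * tensor p' q' = (tensor p 1 * tensor 1 q) * (tensor p' 1 * tensor 1 q')"
    by (simp only: tensor_factor[symmetric])
  also have "\<dots> = tensor (p * p') 1 * tensor 1 (q * q')"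
    by (simp only: tensor_1_right_mult tensor_1_left_mult mult_ac)
  finally show ?thesis by (simp only: tensor_factor[symmetric])
qed

lemma tensor_1_1 [simp]: "tensor 1 1 = 1"
  by (simp add: tensor_1_left lin_1 flip: zero_prod_def)

lemma tensor_power: "tensor p q ^ n = tensor (p ^ n) (q ^ n)"
  by (induction n) (simp_all add: tensor_mult)

definition psi_mono :: "mono \<Rightarrow> steenrod2" where
  "psi_mono m = (\<Prod>n\<in>Poly_Mapping.keys m. psi_xi (Suc n) ^ Poly_Mapping.lookup m n)"

lemma psi_eq_lin: "psi p = lin psi_mono p"
  unfolding psi_def lin_def psi_mono_def by (intro sum.cong refl) (simp add: lookup_bit_keys)

lemma psi_mono_superset:
  assumes "finite K" "Poly_Mapping.keys m \<subseteq> K"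
  shows "psi_mono m = (\<Prod>n\<in>K. psi_xi (Suc n) ^ Poly_Mapping.lookup m n)"
  unfolding psi_mono_def using assms
  by (intro prod.mono_neutral_left) (auto simp: in_keys_iff)

lemma psi_mono_add: "psi_mono (a + b) = psi_mono a * psi_mono b"
proof -
  let ?K = "Poly_Mapping.keys a \<union> Poly_Mapping.keys b"
  have "finite ?K" by simp
  then show ?thesis
    using psi_mono_superset[of ?K a] psi_mono_superset[of ?K b]
      psi_mono_superset[of ?K "a + b", OF _ keys_add]
    by (simp add: lookup_add power_add prod.distrib)
qed

lemma psi_mono_0 [simp]: "psi_mono 0 = 1"
  by (simp add: psi_mono_def)

lemma psi_add: "psi (p + q) = psi p + psi q"
  by (simp add: psi_eq_lin lin_add)

lemma psi_0 [simp]: "psi 0 = 0"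
  by (simp add: psi_eq_lin)

lemma psi_sum: "psi (sum f A) = (\<Sum>a\<in>A. psi (f a))"
  by (simp add: psi_eq_lin lin_sum)

lemma psi_basis [simp]: "psi (basis m) = psi_mono m"
  by (simp add: psi_eq_lin)

lemma psi_mult: "psi (p * q) = psi p * psi q"
  unfolding psi_eq_lin by (rule lin_mult) (rule psi_mono_add)

lemma psi_1 [simp]: "psi 1 = 1"
  by (simp add: psi_eq_lin lin_1)

lemma psi_power: "psi (p ^ n) = psi p ^ n"
  by (induction n) (simp_all add: psi_mult)

lemma psi_xi_eq: "psi (xi n) = psi_xi n"
  by (cases n) (simp_all add: xi_def psi_mono_def psi_xi_def[of 0])

text \<open>
  The matrix \<open>x\<^sub>i\<^sub>j = \<xi>\<^sub>j\<^sub>-\<^sub>i\<close> to the power \<open>2\<^sup>i\<close> is unitriangular and group-like.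
\<close>

definition xij :: "nat \<Rightarrow> nat \<Rightarrow> steenrod" where
  "xij i j = (if i \<le> j then xi (j - i) ^ (2 ^ i) else 0)"

lemma xij_refl [simp]: "xij i i = 1"
  by (simp add: xij_def xi_def)

lemma xij_eq_0 [simp]: "j < i \<Longrightarrow> xij i j = 0"
  by (simp add: xij_def)

lemma xij_square: "xij i j * xij i j = xij (Suc i) (Suc j)"
  by (simp add: xij_def mult_2 power_add flip: power_add)

text \<open>Frobenius is additive, so the \<open>2 ^ i\<close>-th power of
  \<open>psi_xi (j - i)\<close> is taken termwise; with \<open>m = i + k\<close> the summands become
  matrix entries.\<close>

lemma psi_xij: "psi (xij i j) = (\<Sum>m\<in>{i..j}. tensor (xij m j) (xij i m))"
proof (cases "i \<le> j")
  case True
  have "psi (xij i j) = (\<Sum>k\<le>j-i. tensor (xi (j - i - k) ^ (2 ^ (i + k))) (xi k ^ (2 ^ i)))"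
    using True by (simp add: xij_def psi_power psi_xi_eq psi_xi_def pm_bit_power2_sum tensor_power
        power_add mult.commute flip: power_mult)
  also have "\<dots> = (\<Sum>m\<in>{i..j}. tensor (xij m j) (xij i m))"
    by (rule sum.reindex_bij_witness[of _ "\<lambda>m. m - i" "\<lambda>k. i + k"])
      (use True in \<open>auto simp: xij_def\<close>)
  finally show ?thesis .
qed (simp add: xij_def)

lemma basis_var_power: "basis (Poly_Mapping.single k (1::nat)) ^ n = basis (Poly_Mapping.single k n)"
  by (induction n) (simp_all add: mult_single flip: single_add)

lemma xij_less: "i < j \<Longrightarrow> xij i j = basis (letter (i, j - i - 1))"
  unfolding xij_def xi_def letter_def using basis_var_power[of "j - i - 1" "2 ^ i"] by simp

text \<open>The variables form the first row of the matrix, so a property shown for all entries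
  \<open>xij i j\<close> holds on generators.\<close>

lemma basis_var_eq_xij: "basis (Poly_Mapping.single n (1::nat)) = xij 0 (Suc n)"
  by (simp add: xij_def xi_def)

section \<open>Coassociativity in the triple tensor product\<close>

definition in1 :: "steenrod \<Rightarrow> (mono \<times> mono \<times> mono) \<Rightarrow>\<^sub>0 bit" where
  "in1 = lin (\<lambda>a. basis (a, 0, 0))"
definition in2 :: "steenrod \<Rightarrow> (mono \<times> mono \<times> mono) \<Rightarrow>\<^sub>0 bit" where
  "in2 = lin (\<lambda>a. basis (0, a, 0))"
definition in3 :: "steenrod \<Rightarrow> (mono \<times> mono \<times> mono) \<Rightarrow>\<^sub>0 bit" where
  "in3 = lin (\<lambda>a. basis (0, 0, a))"
definition in12 :: "steenrod2 \<Rightarrow> (mono \<times> mono \<times> mono) \<Rightarrow>\<^sub>0 bit" where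
  "in12 = lin (\<lambda>(a, b). basis (a, b, 0))"
definition in23 :: "steenrod2 \<Rightarrow> (mono \<times> mono \<times> mono) \<Rightarrow>\<^sub>0 bit" where
  "in23 = lin (\<lambda>(a, b). basis (0, a, b))"
definition psi_left :: "steenrod2 \<Rightarrow> (mono \<times> mono \<times> mono) \<Rightarrow>\<^sub>0 bit" where
  "psi_left = lin (\<lambda>(a, b). in12 (psi_mono a) * basis (0, 0, b))"
definition psi_right :: "steenrod2 \<Rightarrow> (mono \<times> mono \<times> mono) \<Rightarrow>\<^sub>0 bit" where
  "psi_right = lin (\<lambda>(a, b). basis (a, 0, 0) * in23 (psi_mono b))"
text \<open>Together with \<open>psi_red_right\<close>: the two ways of splitting one letter of a
  pair. Their sum, applied to \<open>psi_red\<close>, is the part of the squared cobar differential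
  that stems from a single letter.\<close>

definition psi_red_left :: "steenrod2 \<Rightarrow> (mono \<times> mono \<times> mono) \<Rightarrow>\<^sub>0 bit" where
  "psi_red_left = lin (\<lambda>(a, b). in12 (psi_red (basis a)) * basis (0, 0, b))"
definition psi_red_right :: "steenrod2 \<Rightarrow> (mono \<times> mono \<times> mono) \<Rightarrow>\<^sub>0 bit" where
  "psi_red_right = lin (\<lambda>(a, b). basis (a, 0, 0) * in23 (psi_red (basis b)))"

lemmas in_defs = in1_def in2_def in3_def in12_def in23_def

lemma in_add: "in12 (y + z) = in12 y + in12 z" "in23 (y + z) = in23 y + in23 z"
  "in1 (p + q) = in1 p + in1 q" "in2 (p + q) = in2 p + in2 q" "in3 (p + q) = in3 p + in3 q"
  by (simp_all add: in_defs lin_add)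

lemma in_mult: "in12 (y * z) = in12 y * in12 z" "in23 (y * z) = in23 y * in23 z"
  "in1 (p * q) = in1 p * in1 q" "in2 (p * q) = in2 p * in2 q" "in3 (p * q) = in3 p * in3 q"
  unfolding in_defs by (rule lin_mult; auto simp: mult_single)+

lemma in_sum: "in12 (sum f A) = (\<Sum>a\<in>A. in12 (f a))" "in23 (sum f A) = (\<Sum>a\<in>A. in23 (f a))"
  by (simp_all add: in_defs lin_sum)

lemma in_1: "in12 1 = 1" "in23 1 = 1" "in1 1 = 1" "in2 1 = 1" "in3 1 = 1"
  by (simp_all add: in_defs lin_1 zero_prod_def) (simp_all flip: zero_prod_def)

lemma in_basis: "in1 (basis a) = basis (a, 0, 0)" "in2 (basis a) = basis (0, a, 0)"
  "in3 (basis a) = basis (0, 0, a)"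
  by (simp_all add: in_defs)

lemma in12_tensor: "in12 (tensor p q) = in1 p * in2 q"
proof -
  have "in12 (tensor p 1) = in1 p" "in12 (tensor 1 q) = in2 q"
    by (simp_all add: tensor_1_right tensor_1_left in_defs lin_lin)
  then show ?thesis by (simp add: tensor_factor[of p q] in_mult)
qed

lemma in23_tensor: "in23 (tensor p q) = in2 p * in3 q"
proof -
  have "in23 (tensor p 1) = in2 p" "in23 (tensor 1 q) = in3 q"
    by (simp_all add: tensor_1_right tensor_1_left in_defs lin_lin)
  then show ?thesis by (simp add: tensor_factor[of p q] in_mult)
qed

lemma psi_left_right_add: "psi_left (y + z) = psi_left y + psi_left z"
    "psi_right (y + z) = psi_right y + psi_right z"
  by (simp_all add: psi_left_def psi_right_def lin_add)

lemma psi_left_right_sum: "psi_left (sum f A) = (\<Sum>a\<in>A. psi_left (f a))"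
    "psi_right (sum f A) = (\<Sum>a\<in>A. psi_right (f a))"
  by (simp_all add: psi_left_def psi_right_def lin_sum)

lemma psi_left_mult: "psi_left (y * z) = psi_left y * psi_left z"
  unfolding psi_left_def
  by (rule lin_mult) (auto simp: psi_mono_add in_mult mult_ac mult_single simp flip: basis_add)

lemma psi_right_mult: "psi_right (y * z) = psi_right y * psi_right z"
  unfolding psi_right_def
  by (rule lin_mult) (auto simp: psi_mono_add in_mult mult_ac mult_single simp flip: basis_add)

lemma psi_left_tensor: "psi_left (tensor p q) = in12 (psi p) * in3 q"
proof -
  have "psi_left (tensor p 1) = in12 (psi p)" "psi_left (tensor 1 q) = in3 q"
    by (simp_all add: psi_left_def tensor_1_right tensor_1_left in_defs lin_lin psi_eq_lin in_1[unfolded in_defs])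
      (simp_all flip: zero_prod_def)
  then show ?thesis by (simp add: tensor_factor[of p q] psi_left_mult)
qed

lemma psi_right_tensor: "psi_right (tensor p q) = in1 p * in23 (psi q)"
proof -
  have "psi_right (tensor p 1) = in1 p" "psi_right (tensor 1 q) = in23 (psi q)"
    by (simp_all add: psi_right_def tensor_1_right tensor_1_left in_defs lin_lin psi_eq_lin in_1[unfolded in_defs])
      (simp_all flip: zero_prod_def)
  then show ?thesis by (simp add: tensor_factor[of p q] psi_right_mult)
qed

text \<open>On a matrix entry both sides are the sum over chains
  \<open>i \<le> m \<le> n \<le> j\<close> of \<open>xij n j\<close>, \<open>xij m n\<close>,
  \<open>xij i m\<close> in the three factors; only the order of summation differs.\<close>

lemma coassoc: "psi_left (psi p) = psi_right (psi p)"
proof -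
  have x: "psi_left (psi (xij i j)) = psi_right (psi (xij i j))" for i j
  proof -
    have "psi_left (psi (xij i j)) = (\<Sum>m\<in>{i..j}. \<Sum>n\<in>{m..j}. in1 (xij n j) * in2 (xij m n) * in3 (xij i m))"
      by (simp add: psi_xij psi_left_right_sum psi_left_tensor in_sum in12_tensor sum_distrib_right)
    also have "\<dots> = (\<Sum>n\<in>{i..j}. \<Sum>m\<in>{i..n}. in1 (xij n j) * in2 (xij m n) * in3 (xij i m))"
      unfolding sum.Sigma[OF finite_atLeastAtMost ballI[OF finite_atLeastAtMost]]
      by (rule sum.reindex_bij_witness[of _ "\<lambda>(a, b). (b, a)" "\<lambda>(a, b). (b, a)"]) auto
    also have "\<dots> = psi_right (psi (xij i j))"
      by (simp add: psi_xij psi_left_right_sum psi_right_tensor in_sum in23_tensor sum_distrib_left mult.assoc)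
    finally show ?thesis .
  qed
  have "(\<lambda>m. psi_left (psi_mono m)) = (\<lambda>m. psi_right (psi_mono m))"
  proof (rule multiplicative_eqI)
    fix n
    show "psi_left (psi_mono (Poly_Mapping.single n 1)) = psi_right (psi_mono (Poly_Mapping.single n 1))"
      using x[of 0 "Suc n"] by (simp flip: basis_var_eq_xij)
    have "psi_left 1 = 1" "psi_right 1 = 1"
      using psi_left_tensor[of 1 1] psi_right_tensor[of 1 1] by (simp_all add: in_1)
    then show "psi_left (psi_mono 0) = 1" "psi_right (psi_mono 0) = 1" by simp_all
  qed (simp_all add: psi_mono_add psi_left_mult psi_right_mult)
  then show ?thesis
    by (simp add: psi_eq_lin psi_left_def psi_right_def lin_lin fun_eq_iff)
qed

lemma psi_red_eq: "psi_red p = psi p + tensor p 1 + tensor 1 p"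
  by (simp add: psi_red_def)

lemma psi_red_add: "psi_red (p + q) = psi_red p + psi_red q"
  by (simp add: psi_red_eq psi_add tensor_add_left tensor_add_right add_ac)

lemma psi_red_0 [simp]: "psi_red 0 = 0"
  by (simp add: psi_red_eq)

lemma psi_red_eq_lin: "psi_red p = lin (\<lambda>m. psi_red (basis m)) p"
  by (induction p rule: pm_bit_induct) (simp_all add: psi_red_add lin_add)

text \<open>Dropping the primitive terms changes the two sides of coassociativity by terms with 1 in
  one of the three factors; all of these occur in pairs.\<close>

lemma coassoc_red: "psi_red_left (psi_red p) + psi_red_right (psi_red p) = 0"
proof -
  have l: "psi_red_left y = psi_left y + lin (\<lambda>(a, b). basis (a, 0, b)) y + in23 y" for y
  proof -
    have "in12 (psi_red (basis a)) * basis (0, 0, b) =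
        in12 (psi_mono a) * basis (0, 0, b) + basis (a, 0, b) + basis (0, a, b)" for a b
      by (simp add: psi_red_eq in_add in12_tensor in_1 distrib_right in_basis mult_single)
    then show ?thesis
      by (simp add: psi_red_left_def psi_left_def in23_def case_prod_unfold flip: lin_fun_add)
  qed
  have r: "psi_red_right y = psi_right y + lin (\<lambda>(a, b). basis (a, 0, b)) y + in12 y" for y
  proof -
    have "basis (a, 0, 0) * in23 (psi_red (basis b)) =
        basis (a, 0, 0) * in23 (psi_mono b) + basis (a, 0, b) + basis (a, b, 0)" for a b
      by (simp add: psi_red_eq in_add in23_tensor in_1 distrib_left in_basis mult_single add_ac)
    then show ?thesis
      by (simp add: psi_red_right_def psi_right_def in12_def case_prod_unfold flip: lin_fun_add)
  qed
  show ?thesis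
    by (simp add: l r psi_red_eq psi_left_right_add in_add psi_left_tensor psi_right_tensor
        in12_tensor in23_tensor in_1 coassoc lin_add add_ac)
qed

section \<open>Weights\<close>

definition bit_count :: "nat \<Rightarrow> nat" where
  "bit_count n = card {i. bit n i}"

lemma finite_bits: "finite {i. bit (n::nat) i}"
proof (rule finite_subset)
  show "{i. bit n i} \<subseteq> {..n}"
  proof safe
    fix i assume "bit n i"
    then have "2 ^ i \<le> n" by (metis bit_iff_odd div_less even_zero not_le)
    moreover have "i < 2 ^ i" by (rule less_exp)
    ultimately show "i \<le> n" by linarith
  qed
qed simp

lemma bit_count_rec: "bit_count n = of_bool (odd n) + bit_count (n div 2)"
proof -
  have "{i. bit n i} = (if odd n then {0} else {}) \<union> Suc ` {i. bit (n div 2) i}"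
    by (auto simp: image_iff bit_0 bit_Suc gr0_conv_Suc) (metis bit_0 bit_Suc not0_implies_Suc)+
  then show ?thesis
    using finite_bits[of "n div 2"]
    by (auto simp: bit_count_def card_image card_insert_if)
qed

lemma bit_count_0 [simp]: "bit_count 0 = 0"
  by (simp add: bit_count_def)

lemma bit_count_double: "bit_count (2 * n) = bit_count n"
  by (simp add: bit_count_rec[of "2 * n"])

lemma bit_count_Suc_double: "bit_count (Suc (2 * n)) = Suc (bit_count n)"
  by (simp add: bit_count_rec[of "Suc (2 * n)"])

lemma bit_count_power2: "bit_count (2 ^ i) = 1"
  by (induction i) (use bit_count_Suc_double[of 0] in \<open>simp_all add: bit_count_double\<close>)

text \<open>A carry replaces two digits by one. The induction halves both numbers; if both are odd,
  the carry joins the second half and costs at most one digit there.\<close>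

lemma bit_count_add: "bit_count (a + b) \<le> bit_count a + bit_count b"
proof (induction "a + b" arbitrary: a b rule: less_induct)
  case less
  have sp: "(\<exists>q. n = 2 * q) \<or> (\<exists>q. n = Suc (2 * q))" for n :: nat by presburger
  show ?case
  proof (cases "a + b = 0")
    case False
    consider q r where "a = 2 * q" "b = 2 * r" | q r where "a = Suc (2 * q)" "b = 2 * r"
      | q r where "a = 2 * q" "b = Suc (2 * r)" | q r where "a = Suc (2 * q)" "b = Suc (2 * r)"
      using sp[of a] sp[of b] by blast
    then show ?thesis
    proof cases
      case 1
      then have *: "a + b = 2 * (q + r)" and "q + r < a + b" using False by auto
      then have "bit_count (q + r) \<le> bit_count q + bit_count r" using less by blast
      then show ?thesis using * by (simp only: 1 bit_count_double)
    next
      case 2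
      then have "a + b = Suc (2 * (q + r))" by simp
      then show ?thesis using less[of q r] 2 bit_count_Suc_double[of "q + r"] by (simp add: bit_count_double bit_count_Suc_double)
    next
      case 3
      then have "a + b = Suc (2 * (q + r))" by simp
      then show ?thesis using less[of q r] 3 bit_count_Suc_double[of "q + r"] by (simp add: bit_count_double bit_count_Suc_double)
    next
      case 4
      then have "a + b = 2 * (q + (r + 1))" by simp
      moreover have "bit_count (q + (r + 1)) \<le> bit_count q + bit_count (r + 1)" "bit_count (r + 1) \<le> bit_count r + bit_count 1"
        using 4 by (intro less; simp)+
      moreover have "bit_count 1 = 1" using bit_count_power2[of 0] by simp
      ultimately show ?thesis using 4 by (simp only: bit_count_double bit_count_Suc_double)
    qed
  qed simp
qed

lemma weight_superset:
  assumes "finite K" "Poly_Mapping.keys m \<subseteq> K"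
  shows "weight m = (\<Sum>n\<in>K. (2 * n + 1) * bit_count (Poly_Mapping.lookup m n))"
  unfolding weight_def bit_count_def[symmetric] using assms
  by (intro sum.mono_neutral_left) (auto simp: in_keys_iff)

lemma weight_add: "weight (a + b) \<le> weight a + weight b"
proof -
  let ?K = "Poly_Mapping.keys a \<union> Poly_Mapping.keys b"
  have "finite ?K" by simp
  then have "weight (a + b) = (\<Sum>n\<in>?K. (2 * n + 1) * bit_count (Poly_Mapping.lookup a n + Poly_Mapping.lookup b n))"
    using weight_superset[OF _ keys_add] by (simp add: lookup_add)
  also have "\<dots> \<le> (\<Sum>n\<in>?K. (2 * n + 1) * (bit_count (Poly_Mapping.lookup a n) + bit_count (Poly_Mapping.lookup b n)))"
    by (intro sum_mono mult_le_mono order_refl bit_count_add)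
  also have "\<dots> = weight a + weight b"
    using weight_superset[of ?K a] weight_superset[of ?K b]
    by (simp only: distrib_left sum.distrib) simp
  finally show ?thesis .
qed

lemma weight_0 [simp]: "weight 0 = 0"
  by (simp add: weight_def)

lemma weight_letter: "weight (letter (i, n)) = 2 * n + 1"
  using weight_superset[of "{n}" "letter (i, n)"] by (simp add: letter_def bit_count_power2)

lemma letter_nonzero: "letter v \<noteq> 0"
proof -
  obtain i n where "v = (i, n)" by (cases v)
  then have "weight (letter v) \<noteq> 0" by (simp add: weight_letter)
  then show ?thesis by auto
qed

text \<open>One weight filtration serves the algebra and its tensor square. The cobar filtration is
  kept apart because it also excludes words containing the unit.\<close>

definition wfilt :: "('a \<Rightarrow> nat) \<Rightarrow> int \<Rightarrow> ('a \<Rightarrow>\<^sub>0 bit) set" where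
  "wfilt w p = {x. \<forall>k\<in>Poly_Mapping.keys x. int (w k) \<le> p}"

lemma wfilt_0 [simp]: "0 \<in> wfilt w p"
  by (simp add: wfilt_def)

lemma wfilt_basis: "basis k \<in> wfilt w p \<longleftrightarrow> int (w k) \<le> p"
  by (simp add: wfilt_def)

lemma wfilt_add: "y \<in> wfilt w p \<Longrightarrow> z \<in> wfilt w p \<Longrightarrow> y + z \<in> wfilt w p"
  using keys_add[of y z] by (auto simp: wfilt_def)

lemma wfilt_sum: "(\<And>a. a \<in> A \<Longrightarrow> f a \<in> wfilt w p) \<Longrightarrow> sum f A \<in> wfilt w p"
  by (induction A rule: infinite_finite_induct) (simp_all add: wfilt_add)

lemma wfilt_mono: "y \<in> wfilt w p \<Longrightarrow> p \<le> q \<Longrightarrow> y \<in> wfilt w q"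
  by (force simp: wfilt_def)

lemma wfilt_mult:
  assumes "\<And>a b. w (a + b) \<le> w a + w b" "y \<in> wfilt w p" "z \<in> wfilt w q"
  shows "y * z \<in> wfilt w (p + q)"
  unfolding wfilt_def
proof safe
  fix k assume "k \<in> Poly_Mapping.keys (y * z)"
  then obtain a b where "k = a + b" "a \<in> Poly_Mapping.keys y" "b \<in> Poly_Mapping.keys z"
    using keys_mult by blast
  then show "int (w k) \<le> p + q" using assms(1)[of a b] assms(2,3) by (force simp: wfilt_def)
qed

definition weight2 :: "mono \<times> mono \<Rightarrow> nat" where
  "weight2 ab = weight (fst ab) + weight (snd ab)"

lemma weight2_add: "weight2 (a + b) \<le> weight2 a + weight2 b"
  using weight_add[of "fst a" "fst b"] weight_add[of "snd a" "snd b"] by (simp add: weight2_def)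

lemma weight2_0 [simp]: "weight2 0 = 0"
  by (simp add: weight2_def)

abbreviation "FA \<equiv> wfilt weight"
abbreviation "FT \<equiv> wfilt weight2"

lemmas FA_mult = wfilt_mult[OF weight_add]
lemmas FT_mult = wfilt_mult[OF weight2_add]

lemma one_FA: "0 \<le> p \<Longrightarrow> 1 \<in> FA p"
  and one_FT: "0 \<le> p \<Longrightarrow> 1 \<in> FT p"
  using wfilt_basis[of 0 weight p] wfilt_basis[of 0 weight2 p] by simp_all

lemma FT_tensor:
  assumes "a \<in> FA p" "b \<in> FA q"
  shows "tensor a b \<in> FT (p + q)"
  unfolding tensor_eq_lin lin_def using assms
  by (intro wfilt_sum) (force simp: wfilt_basis weight2_def wfilt_def)

lemma FT_prod:
  assumes "\<And>n. n \<in> A \<Longrightarrow> f n \<in> FT (int (g n))"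
  shows "prod f A \<in> FT (int (sum g A))"
  using assms
proof (induction A rule: infinite_finite_induct)
  case (insert a A)
  then show ?case using FT_mult[of "f a" "int (g a)" "prod f A" "int (sum g A)"] by simp
qed (simp_all add: one_FT)

lemma xij_FA: "i < j \<Longrightarrow> xij i j \<in> FA (2 * (int j - int i) - 1)"
  by (simp add: xij_less wfilt_basis weight_letter)

lemma psi_xij_FT: "i < j \<Longrightarrow> psi (xij i j) \<in> FT (2 * (int j - int i) - 1)"
  unfolding psi_xij
proof (rule wfilt_sum)
  fix m assume *: "i < j" "m \<in> {i..j}"
  then consider "m = i" | "m = j" | "i < m" "m < j" by force
  then show "tensor (xij m j) (xij i m) \<in> FT (2 * (int j - int i) - 1)"
  proof cases
    case 1
    then show ?thesis using FT_tensor[OF xij_FA[of i j] one_FA[of 0]] *(1) by simp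
  next
    case 2
    then show ?thesis using FT_tensor[OF one_FA[of 0] xij_FA[of i j]] *(1) by simp
  next
    case 3
    then show ?thesis using wfilt_mono[OF FT_tensor[OF xij_FA[of m j] xij_FA[of i m]]] by simp
  qed
qed

text \<open>Each binary digit of \<open>r\<close> contributes one Frobenius power of
  \<open>psi_xi (Suc n)\<close>, and all these have weight at most \<open>2 * n + 1\<close>,
  whatever the position of the digit. Halving \<open>r\<close> shifts the position, hence the
  generalization over \<open>i\<close>.\<close>

lemma psi_xi_power_FT: "psi_xi (Suc n) ^ r \<in> FT (int ((2 * n + 1) * bit_count r))"
proof -
  have "(psi_xi (Suc n) ^ 2 ^ i) ^ r \<in> FT (int ((2 * n + 1) * bit_count r))" for i
  proof (induction r arbitrary: i rule: less_induct)
    case (less r)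
    have b: "psi_xi (Suc n) ^ 2 ^ i \<in> FT (int (2 * n + 1))"
      using psi_xij_FT[of i "i + n + 1"] by (simp add: xij_def psi_power psi_xi_eq)
    consider "r = 0" | q where "r = 2 * q" "q < r" | q where "r = Suc (2 * q)" "q < r"
      by (cases "r = 0"; cases "even r") (auto elim!: evenE oddE)
    then show ?case
    proof cases
      case 1
      then show ?thesis by (simp add: one_FT)
    next
      case 2
      have *: "(psi_xi (Suc n) ^ 2 ^ i) ^ r = (psi_xi (Suc n) ^ 2 ^ Suc i) ^ q"
        by (simp add: 2(1) mult_ac flip: power_mult)
      show ?thesis using less(1)[OF 2(2), of "Suc i"] unfolding * by (simp only: 2(1) bit_count_double)
    next
      case 3
      have *: "(psi_xi (Suc n) ^ 2 ^ i) ^ r = psi_xi (Suc n) ^ 2 ^ i * (psi_xi (Suc n) ^ 2 ^ Suc i) ^ q"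
        by (simp add: 3(1) algebra_simps flip: power_mult power_add)
      have "bit_count r = Suc (bit_count q)" by (simp only: 3(1) bit_count_Suc_double)
      then show ?thesis using FT_mult[OF b less(1)[OF 3(2), of "Suc i"]] unfolding *
        by (simp add: algebra_simps)
    qed
  qed
  from this[of 0] show ?thesis by simp
qed

lemma psi_mono_FT: "psi_mono m \<in> FT (int (weight m))"
  unfolding psi_mono_def weight_def bit_count_def[symmetric]
  by (rule FT_prod) (rule psi_xi_power_FT)

text \<open>The left counit law: \<open>e\<close> applies the augmentation to the left factor and is
  an algebra map. On a matrix entry only the summand with left factor 1 survives.\<close>

lemma lookup_psi_mono_left: "Poly_Mapping.lookup (psi_mono m) (0, b) = of_bool (b = m)"
proof -
  define e where "e = lin (\<lambda>(a, b). if a = (0::mono) then basis b else (0 :: steenrod))"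
  have z: "a + b = 0 \<longleftrightarrow> a = 0 \<and> b = 0" for a b :: mono
    by (auto simp: poly_mapping_eq_iff fun_eq_iff lookup_add)
  have e_mult: "e (y * z) = e y * e z" for y z
    unfolding e_def by (rule lin_mult) (auto simp: z mult_single)
  have e_tensor: "e (tensor p q) = (if 0 \<in> Poly_Mapping.keys p then q else 0)" for p q
  proof (induction p rule: pm_bit_induct)
    case (add k p)
    have "e (tensor (basis k) q) = (if k = 0 then q else 0)"
      by (simp add: e_def tensor_eq_lin lin_lin)
    then show ?case using add by (auto simp: tensor_add_left keys_basis_add e_def lin_add)
  qed (simp add: e_def)
  have "(\<lambda>m. e (psi_mono m)) = basis"
  proof (rule multiplicative_eqI)
    fix n
    have "e (psi (xij 0 (Suc n))) = (\<Sum>m\<in>{0..Suc n}. if m = Suc n then xij 0 m else 0)"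
      unfolding psi_xij e_def lin_sum unfolding e_def[symmetric] e_tensor
    proof (rule sum.cong)
      fix m assume "m \<in> {0..Suc n}"
      then consider "m = Suc n" | "m < Suc n" by force
      then show "(if 0 \<in> Poly_Mapping.keys (xij m (Suc n)) then xij 0 m else 0) = (if m = Suc n then xij 0 m else 0)"
        using letter_nonzero by cases (auto simp: xij_less)
    qed simp
    then show "e (psi_mono (Poly_Mapping.single n 1)) = basis (Poly_Mapping.single n 1)"
      by (simp only: basis_var_eq_xij psi_basis[symmetric]) simp
    show "e (psi_mono 0) = 1" using e_tensor[of 1 1] by simp
  qed (simp_all add: psi_mono_add e_mult mult_single)
  then have "e (psi_mono m) = basis m" by meson
  moreover have "Poly_Mapping.lookup (e y) b = Poly_Mapping.lookup y (0, b)" for y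
  proof (induction y rule: pm_bit_induct)
    case (add k y)
    then show ?case by (cases k) (simp add: e_def lin_add lookup_add lookup_single when_def)
  qed (simp add: e_def)
  ultimately show ?thesis by (metis lookup_single when_def of_bool_def)
qed

text \<open>The right counit law, with the augmentation applied to the right factor.\<close>

lemma lookup_psi_mono_right: "Poly_Mapping.lookup (psi_mono m) (a, 0) = of_bool (a = m)"
proof -
  define e where "e = lin (\<lambda>(a, b). if b = (0::mono) then basis a else (0 :: steenrod))"
  have z: "a + b = 0 \<longleftrightarrow> a = 0 \<and> b = 0" for a b :: mono
    by (auto simp: poly_mapping_eq_iff fun_eq_iff lookup_add)
  have e_mult: "e (y * z) = e y * e z" for y z
    unfolding e_def by (rule lin_mult) (auto simp: z mult_single)
  have e_tensor: "e (tensor p q) = (if 0 \<in> Poly_Mapping.keys q then p else 0)" for p q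
  proof (induction q rule: pm_bit_induct)
    case (add k q)
    have "e (tensor p (basis k)) = (if k = 0 then p else 0)"
      by (simp add: e_def tensor_eq_lin lin_lin)
    then show ?case using add by (auto simp: tensor_add_right keys_basis_add e_def lin_add)
  qed (simp add: e_def)
  have "(\<lambda>m. e (psi_mono m)) = basis"
  proof (rule multiplicative_eqI)
    fix n
    have "e (psi (xij 0 (Suc n))) = (\<Sum>m\<in>{0..Suc n}. if m = 0 then xij m (Suc n) else 0)"
      unfolding psi_xij e_def lin_sum unfolding e_def[symmetric] e_tensor
    proof (rule sum.cong)
      fix m assume "m \<in> {0..Suc n}"
      then consider "m = 0" | "0 < m" by force
      then show "(if 0 \<in> Poly_Mapping.keys (xij 0 m) then xij m (Suc n) else 0) = (if m = 0 then xij m (Suc n) else 0)"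
        using letter_nonzero by cases (auto simp: xij_less)
    qed simp
    then show "e (psi_mono (Poly_Mapping.single n 1)) = basis (Poly_Mapping.single n 1)"
      by (simp only: basis_var_eq_xij psi_basis[symmetric]) simp
    show "e (psi_mono 0) = 1" using e_tensor[of 1 1] by simp
  qed (simp_all add: psi_mono_add e_mult mult_single)
  then have "e (psi_mono m) = basis m" by meson
  moreover have "Poly_Mapping.lookup (e y) a = Poly_Mapping.lookup y (a, 0)" for y
  proof (induction y rule: pm_bit_induct)
    case (add k y)
    then show ?case by (cases k) (simp add: e_def lin_add lookup_add lookup_single when_def)
  qed (simp add: e_def)
  ultimately show ?thesis by (metis lookup_single when_def of_bool_def)
qed

lemma psi_red_basis_eq: "psi_red (basis m) = psi_mono m + basis (m, 0) + basis (0, m)"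
  by (simp add: psi_red_eq tensor_1_right tensor_1_left)

lemma psi_red_basis_FT: "psi_red (basis m) \<in> FT (int (weight m))"
  unfolding psi_red_basis_eq
  by (intro wfilt_add psi_mono_FT) (simp_all add: wfilt_basis weight2_def)

lemma psi_red_keys_nonzero:
  assumes "m \<noteq> 0" "(a, b) \<in> Poly_Mapping.keys (psi_red (basis m))"
  shows "a \<noteq> 0" "b \<noteq> 0"
  using assms
  by (auto simp: in_keys_iff psi_red_basis_eq lookup_add lookup_psi_mono_left lookup_psi_mono_right
      lookup_single when_def split: if_splits)

lemma psi_red_xij:
  assumes "i < j"
  shows "psi_red (xij i j) = (\<Sum>m\<in>{i<..<j}. tensor (xij m j) (xij i m))"
proof -
  have "{i..j} = insert i (insert j {i<..<j})" using assms by auto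
  then show ?thesis using assms by (simp add: psi_red_eq psi_xij add_ac)
qed

text \<open>Two letters of total length \<open>j - i\<close> weigh one unit less than a single one.
  This drop makes the differential lower the filtration on words of letters.\<close>

lemma psi_red_xij_FT:
  assumes "i < j"
  shows "psi_red (xij i j) \<in> FT (2 * (int j - int i) - 2)"
  unfolding psi_red_xij[OF assms]
proof (rule wfilt_sum)
  fix m assume "m \<in> {i<..<j}"
  then show "tensor (xij m j) (xij i m) \<in> FT (2 * (int j - int i) - 2)"
    using wfilt_mono[OF FT_tensor[OF xij_FA[of m j] xij_FA[of i m]]] by simp
qed

section \<open>The cobar complex\<close>

text \<open>Left multiplication in the tensor algebra. Recursion on the first letter replaces the
  sum over positions in \<open>cobar_d_word\<close>.\<close>

definition prepend :: "steenrod \<Rightarrow> cobar \<Rightarrow> cobar" where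
  "prepend c y = lin (\<lambda>a. lin (\<lambda>l. basis (a # l)) y) c"

definition prepend2 :: "steenrod2 \<Rightarrow> cobar \<Rightarrow> cobar" where
  "prepend2 c y = lin (\<lambda>(a, b). lin (\<lambda>l. basis (a # b # l)) y) c"

definition prepend3 :: "((mono \<times> mono \<times> mono) \<Rightarrow>\<^sub>0 bit) \<Rightarrow> cobar \<Rightarrow> cobar" where
  "prepend3 c y = lin (\<lambda>(a, b, d). lin (\<lambda>l. basis (a # b # d # l)) y) c"

lemma prepend_add: "prepend (c + d) y = prepend c y + prepend d y" "prepend c (y + z) = prepend c y + prepend c z"
  by (simp_all add: prepend_def lin_add lin_fun_add)

lemma prepend_0 [simp]: "prepend 0 y = 0" "prepend c 0 = 0"
  by (simp_all add: prepend_def)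

lemma prepend_sum: "prepend (sum f A) y = (\<Sum>a\<in>A. prepend (f a) y)" "prepend c (sum g A) = (\<Sum>a\<in>A. prepend c (g a))"
  by (induction A rule: infinite_finite_induct) (simp_all add: prepend_add)

lemma prepend_basis: "prepend (basis a) (basis l) = basis (a # l)"
  by (simp add: prepend_def)

lemma prepend2_add: "prepend2 (c + d) y = prepend2 c y + prepend2 d y" "prepend2 c (y + z) = prepend2 c y + prepend2 c z"
  by (simp_all add: prepend2_def lin_add lin_fun_add case_prod_unfold)

lemma prepend2_0 [simp]: "prepend2 0 y = 0" "prepend2 c 0 = 0"
  by (simp_all add: prepend2_def case_prod_unfold)

lemma prepend2_sum: "prepend2 (sum f A) y = (\<Sum>a\<in>A. prepend2 (f a) y)"
  by (induction A rule: infinite_finite_induct) (simp_all add: prepend2_add)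

lemma prepend2_basis: "prepend2 (basis (a, b)) y = prepend (basis a) (prepend (basis b) y)"
  by (simp add: prepend_def prepend2_def lin_lin)

lemma prepend2_tensor: "prepend2 (tensor c d) y = prepend c (prepend d y)"
  by (simp add: prepend_def prepend2_def tensor_eq_lin lin_lin)

lemma prepend3_add: "prepend3 (c + d) y = prepend3 c y + prepend3 d y" "prepend3 c (y + z) = prepend3 c y + prepend3 c z"
  by (simp_all add: prepend3_def lin_add lin_fun_add case_prod_unfold)

lemma prepend3_0 [simp]: "prepend3 0 y = 0"
  by (simp add: prepend3_def)

lemma prepend3_in12: "prepend3 (in12 c * basis (0, 0, b)) y = prepend2 c (prepend (basis b) y)"
proof (induction c rule: pm_bit_induct)
  case (add k c)
  then show ?case
    by (cases k) (simp add: in_add distrib_right prepend3_add prepend2_add prepend2_basis in12_def lin_add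
        mult_single, simp add: prepend3_def prepend_def lin_lin)
qed (simp add: in12_def)

lemma prepend3_in23: "prepend3 (basis (a, 0, 0) * in23 c) y = prepend (basis a) (prepend2 c y)"
proof (induction c rule: pm_bit_induct)
  case (add k c)
  then show ?case
    by (cases k) (simp add: in_add distrib_left prepend3_add prepend2_add prepend_add prepend2_basis in23_def lin_add
        mult_single, simp add: prepend3_def prepend_def lin_lin)
qed (simp add: in23_def)

lemma cobar_d_eq_lin: "cobar_d y = lin cobar_d_word y"
  by (simp add: cobar_d_def lin_def)

lemma cobar_d_add: "cobar_d (y + z) = cobar_d y + cobar_d z"
  by (simp add: cobar_d_eq_lin lin_add)

lemma cobar_d_0 [simp]: "cobar_d 0 = 0"
  by (simp add: cobar_d_eq_lin)

lemma cobar_d_sum: "cobar_d (sum f A) = (\<Sum>a\<in>A. cobar_d (f a))"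
  by (simp add: cobar_d_eq_lin lin_sum)

lemma cobar_d_word_eq_lin:
  "cobar_d_word l = (\<Sum>i<length l. lin (\<lambda>(a, b). basis (take i l @ [a, b] @ drop (Suc i) l))
     (psi_red (basis (l ! i))))"
  unfolding cobar_d_word_def Let_def lin_def
  by (intro sum.cong refl) (auto simp: lookup_bit_keys)

lemma cobar_d_word_Nil [simp]: "cobar_d_word [] = 0"
  by (simp add: cobar_d_word_def)

lemma cobar_d_word_Cons:
  "cobar_d_word (m # l) = prepend2 (psi_red (basis m)) (basis l) + prepend (basis m) (cobar_d_word l)"
  unfolding cobar_d_word_eq_lin list.size add_Suc_right add_0_right sum.lessThan_Suc_shift
  by (simp add: prepend2_def prepend_sum) (simp add: prepend_def lin_lin case_prod_unfold)

lemma cobar_d_prepend: "cobar_d (prepend c y) = prepend2 (psi_red c) y + prepend c (cobar_d y)"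
proof (induction c rule: pm_bit_induct)
  case (add m c)
  have "cobar_d (prepend (basis m) y) = prepend2 (psi_red (basis m)) y + prepend (basis m) (cobar_d y)"
    by (induction y rule: pm_bit_induct)
      (simp_all add: prepend_add prepend2_add cobar_d_add prepend_basis cobar_d_eq_lin lin_add cobar_d_word_Cons add_ac)
  then show ?case using add by (simp add: prepend_add prepend2_add cobar_d_add psi_red_add add_ac)
qed simp

text \<open>For \<open>c\<close> a reduced coproduct the \<open>prepend3\<close> term vanishes by
  \<open>coassoc_red\<close>; this is the whole content of the square of the differential being
  zero.\<close>

lemma cobar_d_prepend2:
  "cobar_d (prepend2 c y) = prepend3 (psi_red_left c + psi_red_right c) y + prepend2 c (cobar_d y)"
proof (induction c rule: pm_bit_induct)
  case (add k c)
  have "cobar_d (prepend2 (basis k) y) =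
      prepend3 (psi_red_left (basis k) + psi_red_right (basis k)) y + prepend2 (basis k) (cobar_d y)"
    by (cases k) (simp add: prepend2_basis cobar_d_prepend psi_red_left_def psi_red_right_def prepend3_add
        prepend3_in12 prepend3_in23 prepend_add add_ac)
  then show ?case using add
    by (simp add: prepend2_add cobar_d_add psi_red_left_def psi_red_right_def prepend3_add lin_add add_ac)
qed (simp add: psi_red_left_def psi_red_right_def)

lemma cobar_d_d: "cobar_d (cobar_d y) = 0"
proof (induction y rule: pm_bit_induct)
  case (add l y)
  have "cobar_d (cobar_d (basis l)) = 0"
  proof (induction l)
    case (Cons m l)
    have "cobar_d (cobar_d (basis (m # l))) = cobar_d (cobar_d (prepend (basis m) (basis l)))"
      by (simp add: prepend_basis)
    also have "\<dots> = 0"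
      by (simp only: cobar_d_prepend cobar_d_add cobar_d_prepend2 coassoc_red Cons) simp
    finally show ?case .
  qed (simp add: cobar_d_eq_lin)
  then show ?case using add by (simp add: cobar_d_add)
qed simp

section \<open>Augmentation ideal and weight filtration on words\<close>

definition reduced :: "steenrod \<Rightarrow> bool" where
  "reduced a \<longleftrightarrow> 0 \<notin> Poly_Mapping.keys a"

definition reduced2 :: "steenrod2 \<Rightarrow> bool" where
  "reduced2 c \<longleftrightarrow> (\<forall>(a, b)\<in>Poly_Mapping.keys c. a \<noteq> 0 \<and> b \<noteq> 0)"

lemma reduced2_add: "reduced2 c \<Longrightarrow> reduced2 d \<Longrightarrow> reduced2 (c + d)"
  using keys_add[of c d] by (auto simp: reduced2_def)

lemma reduced2_0 [simp]: "reduced2 0"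
  by (simp add: reduced2_def)

lemma reduced2_sum: "(\<And>a. a \<in> A \<Longrightarrow> reduced2 (f a)) \<Longrightarrow> reduced2 (sum f A)"
  by (induction A rule: infinite_finite_induct) (auto simp: reduced2_add)

lemma reduced_xij: "i < j \<Longrightarrow> reduced (xij i j)"
  using letter_nonzero by (simp add: reduced_def xij_less)

lemma reduced2_psi_red: "reduced c \<Longrightarrow> reduced2 (psi_red c)"
  unfolding psi_red_eq_lin[of c] lin_def
proof (rule reduced2_sum)
  fix k assume "reduced c" "k \<in> Poly_Mapping.keys c"
  then have "k \<noteq> 0" by (auto simp: reduced_def)
  then show "reduced2 (psi_red (basis k))"
    using psi_red_keys_nonzero[of k] unfolding reduced2_def by blast
qed

lemma psi_red_FT: "c \<in> FA p \<Longrightarrow> psi_red c \<in> FT p"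
  unfolding psi_red_eq_lin[of c] lin_def
  by (rule wfilt_sum) (force simp: wfilt_def[of weight] intro: wfilt_mono[OF psi_red_basis_FT])

lemma cobar_F_0 [simp]: "0 \<in> cobar_F p"
  by (simp add: cobar_F_def)

lemma cobar_F_add: "y \<in> cobar_F p \<Longrightarrow> z \<in> cobar_F p \<Longrightarrow> y + z \<in> cobar_F p"
  using keys_add[of y z] by (auto simp: cobar_F_def)

lemma cobar_F_sum: "(\<And>a. a \<in> A \<Longrightarrow> f a \<in> cobar_F p) \<Longrightarrow> sum f A \<in> cobar_F p"
  by (induction A rule: infinite_finite_induct) (simp_all add: cobar_F_add)

lemma cobar_F_mono: "y \<in> cobar_F p \<Longrightarrow> p \<le> q \<Longrightarrow> y \<in> cobar_F q"
  by (force simp: cobar_F_def)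

lemma cobar_F_basis: "basis l \<in> cobar_F p \<longleftrightarrow> 0 \<notin> set l \<and> int (word_weight l) \<le> p"
  by (simp add: cobar_F_def)

lemma word_weight_Cons [simp]: "word_weight (m # l) = weight m + word_weight l"
  by (simp add: word_weight_def)

lemma word_weight_Nil [simp]: "word_weight [] = 0"
  by (simp add: word_weight_def)

lemma prepend_F:
  assumes "reduced c" "c \<in> FA p" "y \<in> cobar_F q"
  shows "prepend c y \<in> cobar_F (p + q)"
  unfolding prepend_def lin_def using assms
  by (intro cobar_F_sum) (force simp: cobar_F_basis reduced_def wfilt_def cobar_F_def)

lemma prepend2_F:
  assumes "reduced2 c" "c \<in> FT p" "y \<in> cobar_F q"
  shows "prepend2 c y \<in> cobar_F (p + q)"
  unfolding prepend2_def lin_def case_prod_unfold using assms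
  by (intro cobar_F_sum) (force simp: cobar_F_basis reduced2_def wfilt_def cobar_F_def weight2_def)

lemma cobar_d_F: "y \<in> cobar_F p \<Longrightarrow> cobar_d y \<in> cobar_F p"
proof -
  have *: "cobar_d_word l \<in> cobar_F (int (word_weight l))" if "0 \<notin> set l" for l
    using that
  proof (induction l)
    case (Cons m l)
    have 1: "reduced (basis m)" "basis m \<in> FA (int (weight m))"
      using Cons(2) by (auto simp: reduced_def wfilt_basis)
    have "prepend2 (psi_red (basis m)) (basis l) \<in> cobar_F (int (weight m) + int (word_weight l))"
      using Cons(2) by (intro prepend2_F reduced2_psi_red psi_red_FT 1) (auto simp: cobar_F_basis)
    moreover have "prepend (basis m) (cobar_d_word l) \<in> cobar_F (int (weight m) + int (word_weight l))"
      using Cons by (intro prepend_F 1) auto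
    ultimately show ?case by (simp add: cobar_d_word_Cons cobar_F_add)
  qed simp
  assume "y \<in> cobar_F p"
  then have "cobar_d_word k \<in> cobar_F p" if "k \<in> Poly_Mapping.keys y" for k
    using that by (intro cobar_F_mono[OF *]) (auto simp: cobar_F_def)
  then show ?thesis unfolding cobar_d_eq_lin lin_def by (rule cobar_F_sum)
qed

definition B1 :: "int \<Rightarrow> cobar set" where
  "B1 p = {u + cobar_d v | u v. u \<in> cobar_F (p - 1) \<and> v \<in> cobar_F p}"

text \<open>The differential preserves the filtration, so \<open>ss_Z\<close> with
  \<open>r = 0\<close> is the whole filtration step.\<close>

lemma ss_B_1: "ss_B cobar_d cobar_F 1 p = B1 p"
  using cobar_d_F by (auto simp: ss_B_def B1_def ss_Z_def)

lemma B1_0 [simp]: "0 \<in> B1 p"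
  unfolding B1_def by (rule CollectI) (metis add_0 cobar_F_0 cobar_d_0)

lemma B1_add: "y \<in> B1 p \<Longrightarrow> z \<in> B1 p \<Longrightarrow> y + z \<in> B1 p"
proof -
  assume "y \<in> B1 p" "z \<in> B1 p"
  then obtain u v u' v' where "y = u + cobar_d v" "z = u' + cobar_d v'"
    "u \<in> cobar_F (p - 1)" "u' \<in> cobar_F (p - 1)" "v \<in> cobar_F p" "v' \<in> cobar_F p"
    by (auto simp: B1_def)
  then show ?thesis unfolding B1_def
    by (intro CollectI exI[of _ "u + u'"] exI[of _ "v + v'"]) (simp add: cobar_F_add cobar_d_add add_ac)
qed

lemma F_B1: "y \<in> cobar_F (p - 1) \<Longrightarrow> y \<in> B1 p"
  unfolding B1_def by (rule CollectI) (metis add_0_right cobar_F_0 cobar_d_0)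

lemma d_B1: "v \<in> cobar_F p \<Longrightarrow> cobar_d v \<in> B1 p"
  unfolding B1_def by (rule CollectI) (metis add_0_left cobar_F_0)

lemma B1_F: "y \<in> B1 p \<Longrightarrow> y \<in> cobar_F p"
  using cobar_d_F by (auto simp: B1_def intro!: cobar_F_add intro: cobar_F_mono)

abbreviation R_weight :: "nat \<Rightarrow> nat \<Rightarrow> int" where
  "R_weight i j \<equiv> 2 * (int j - int i) - 1"

text \<open>By the Leibniz rule, multiplication by a letter commutes with the differential up to the
  reduced coproduct of the letter, which has lower weight.\<close>

lemma prepend_B1:
  assumes "i < j" "y \<in> B1 p"
  shows "prepend (xij i j) y \<in> B1 (R_weight i j + p)"
proof -
  obtain u v where *: "y = u + cobar_d v" "u \<in> cobar_F (p - 1)" "v \<in> cobar_F p"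
    using assms(2) by (auto simp: B1_def)
  have "prepend (xij i j) y = (prepend (xij i j) u + prepend2 (psi_red (xij i j)) v) + cobar_d (prepend (xij i j) v)"
    by (simp add: *(1) prepend_add cobar_d_prepend add_ac)
  moreover have "prepend (xij i j) u \<in> cobar_F (R_weight i j + p - 1)"
    using prepend_F[OF reduced_xij xij_FA *(2)] assms(1) by (simp add: algebra_simps)
  moreover have "prepend2 (psi_red (xij i j)) v \<in> cobar_F (R_weight i j + p - 1)"
    using prepend2_F[OF reduced2_psi_red[OF reduced_xij] psi_red_xij_FT *(3)] assms(1) by (simp add: algebra_simps)
  moreover have "prepend (xij i j) v \<in> cobar_F (R_weight i j + p)"
    using prepend_F[OF reduced_xij xij_FA *(3)] assms(1) by simp
  ultimately show ?thesis by (metis B1_add F_B1 d_B1 cobar_F_add)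
qed

section \<open>Commutativity of letters modulo boundaries and lower weight\<close>

definition letter_word :: "(nat \<times> nat) list \<Rightarrow> cobar" where
  "letter_word vs = basis (map letter vs)"

definition letters_weight :: "(nat \<times> nat) list \<Rightarrow> nat" where
  "letters_weight vs = (\<Sum>v\<leftarrow>vs. 2 * snd v + 1)"

lemma letters_weight_simps [simp]: "letters_weight [] = 0" "letters_weight (v # vs) = 2 * snd v + 1 + letters_weight vs"
  by (simp_all add: letters_weight_def)

lemma word_weight_map_letter: "word_weight (map letter vs) = letters_weight vs"
  by (induction vs) (auto simp: weight_letter case_prod_unfold split: prod.splits)

lemma basis_letter: "basis (letter v) = xij (fst v) (fst v + snd v + 1)"
  by (simp add: xij_less)

lemma letter_word_Cons: "letter_word (v # vs) = prepend (xij (fst v) (fst v + snd v + 1)) (letter_word vs)"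
  by (simp only: letter_word_def basis_letter[symmetric] prepend_basis list.map)

lemma letter_word_F: "letter_word vs \<in> cobar_F (int (letters_weight vs))"
  using letter_nonzero by (auto simp: letter_word_def cobar_F_basis word_weight_map_letter)

lemma d_letter_word_F: "cobar_d (letter_word vs) \<in> cobar_F (int (letters_weight vs) - 1)"
proof (induction vs)
  case (Cons v vs)
  let ?x = "xij (fst v) (fst v + snd v + 1)"
  have "prepend2 (psi_red ?x) (letter_word vs) \<in> cobar_F (int (letters_weight (v # vs)) - 1)"
    using prepend2_F[OF reduced2_psi_red[OF reduced_xij] psi_red_xij_FT letter_word_F, of "fst v" "fst v + snd v + 1" vs]
    by (simp add: algebra_simps)
  moreover have "prepend ?x (cobar_d (letter_word vs)) \<in> cobar_F (int (letters_weight (v # vs)) - 1)"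
    using prepend_F[OF reduced_xij xij_FA Cons, of "fst v" "fst v + snd v + 1"]
    by (simp add: algebra_simps)
  ultimately show ?case by (simp add: letter_word_Cons cobar_d_prepend cobar_F_add)
qed (simp add: letter_word_def cobar_d_eq_lin)

lemma letter_word_cong_Cons:
  assumes "letter_word vs + letter_word us \<in> B1 p"
  shows "letter_word (v # vs) + letter_word (v # us) \<in> B1 (int (2 * snd v + 1) + p)"
  using prepend_B1[OF _ assms, of "fst v" "fst v + snd v + 1"] by (simp add: letter_word_Cons prepend_add)

text \<open>
  The word \<open>[ab]\<close> bounds \<open>[a|b] + [b|a]\<close> up to lower weight.
\<close>

lemma letter_word_swap: "letter_word (v # u # r) + letter_word (u # v # r) \<in> B1 (int (letters_weight (v # u # r)))"
proof -
  define a b where "a = basis (letter v)" and "b = basis (letter u)"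
  define p q where "p = int (2 * snd v + 1)" and "q = int (2 * snd u + 1)"
  have a: "a = xij (fst v) (fst v + snd v + 1)" and b: "b = xij (fst u) (fst u + snd u + 1)"
    by (simp_all add: a_def b_def basis_letter)
  have FA: "a \<in> FA p" "b \<in> FA q"
    unfolding a b using xij_FA[of "fst v" "fst v + snd v + 1"] xij_FA[of "fst u" "fst u + snd u + 1"]
    by (simp_all add: p_def q_def)
  have FT: "psi_red a \<in> FT (p - 1)" "psi_red b \<in> FT (q - 1)"
    unfolding a b using psi_red_xij_FT[of "fst v" "fst v + snd v + 1"] psi_red_xij_FT[of "fst u" "fst u + snd u + 1"]
    by (simp_all add: p_def q_def)
  define L where "L = psi_red (a * b) + tensor a b + tensor b a"
  have ab: "a * b = basis (letter v + letter u)"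
    by (simp add: a_def b_def mult_single)
  have nz: "letter v + letter u \<noteq> 0"
    using letter_nonzero[of v] by (auto simp: poly_mapping_eq_iff fun_eq_iff lookup_add)
  then have red1: "reduced (a * b)" by (simp add: ab reduced_def)
  have "reduced2 (tensor a b)" "reduced2 (tensor b a)"
    using letter_nonzero by (simp_all add: a_def b_def tensor_basis reduced2_def)
  then have red2: "reduced2 L"
    unfolding L_def by (intro reduced2_add reduced2_psi_red red1)
  \<comment> \<open>Expanding \<open>psi a * psi b\<close>, the products of primitive parts are
    exactly the terms removed in \<open>L\<close>. Every remaining product has a factor
    \<open>psi_red a\<close> or \<open>psi_red b\<close>, which is one unit lighter than its
    letter.\<close>
  have "L = psi_red a * (tensor b 1 + tensor 1 b + psi_red b) + (tensor a 1 + tensor 1 a) * psi_red b"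
    by (simp add: L_def psi_red_eq psi_mult distrib_left distrib_right tensor_mult add_ac mult_ac)
  also have "\<dots> \<in> FT (p + q - 1)"
  proof (intro wfilt_add)
    have "tensor b 1 \<in> FT q" "tensor 1 b \<in> FT q" "tensor a 1 \<in> FT p" "tensor 1 a \<in> FT p"
      using FT_tensor[OF FA(2) one_FA[of 0]] FT_tensor[OF FA(1) one_FA[of 0]]
        FT_tensor[OF one_FA[of 0] FA(2)] FT_tensor[OF one_FA[of 0] FA(1)] by simp_all
    moreover have "psi_red b \<in> FT q" using FT(2) by (rule wfilt_mono) simp
    ultimately have 1: "tensor b 1 + tensor 1 b + psi_red b \<in> FT q" and 2: "tensor a 1 + tensor 1 a \<in> FT p"
      by (simp_all add: wfilt_add)
    show "psi_red a * (tensor b 1 + tensor 1 b + psi_red b) \<in> FT (p + q - 1)"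
      using FT_mult[OF FT(1) 1] by (simp add: algebra_simps)
    show "(tensor a 1 + tensor 1 a) * psi_red b \<in> FT (p + q - 1)"
      using FT_mult[OF 2 FT(2)] by (simp add: algebra_simps)
  qed
  finally have L: "L \<in> FT (p + q - 1)" .
  have "cobar_d (prepend (a * b) (letter_word r)) =
      prepend a (prepend b (letter_word r)) + prepend b (prepend a (letter_word r)) + (prepend2 L (letter_word r) + prepend (a * b) (cobar_d (letter_word r)))"
    by (simp add: cobar_d_prepend L_def prepend2_add prepend2_tensor add_ac)
  then have "letter_word (v # u # r) + letter_word (u # v # r) =
      (prepend2 L (letter_word r) + prepend (a * b) (cobar_d (letter_word r))) + cobar_d (prepend (a * b) (letter_word r))"
    by (simp add: letter_word_Cons a b add_ac)
  moreover have "prepend2 L (letter_word r) \<in> cobar_F (int (letters_weight (v # u # r)) - 1)"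
    using prepend2_F[OF red2 L letter_word_F] by (simp add: p_def q_def algebra_simps)
  moreover have "prepend (a * b) (cobar_d (letter_word r)) \<in> cobar_F (int (letters_weight (v # u # r)) - 1)"
    using prepend_F[OF red1 FA_mult[OF FA] d_letter_word_F] by (simp add: p_def q_def algebra_simps)
  moreover have "prepend (a * b) (letter_word r) \<in> cobar_F (int (letters_weight (v # u # r)))"
    using prepend_F[OF red1 FA_mult[OF FA] letter_word_F] by (simp add: p_def q_def algebra_simps)
  ultimately show ?thesis by (metis B1_add F_B1 d_B1 cobar_F_add)
qed

lemma letter_word_move: "letter_word (vs @ v # us) + letter_word (v # vs @ us) \<in> B1 (int (letters_weight (v # vs @ us)))"
proof (induction vs)
  case (Cons u vs)
  have 1: "letter_word (u # vs @ v # us) + letter_word (u # v # vs @ us) \<in> B1 (int (letters_weight (v # (u # vs) @ us)))"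
    using letter_word_cong_Cons[OF Cons, of u] by (simp add: algebra_simps)
  have 2: "letter_word (u # v # vs @ us) + letter_word (v # u # vs @ us) \<in> B1 (int (letters_weight (v # (u # vs) @ us)))"
    using letter_word_swap[of u v "vs @ us"] by (simp add: algebra_simps)
  show ?case using B1_add[OF 1 2] by (simp add: add.assoc)
qed simp

lemma letters_weight_mset: "mset vs = mset us \<Longrightarrow> letters_weight vs = letters_weight us"
proof -
  have "letters_weight vs = sum_mset (image_mset (\<lambda>v. 2 * snd v + 1) (mset vs))" for vs
    by (induction vs) simp_all
  then show "mset vs = mset us \<Longrightarrow> letters_weight vs = letters_weight us" by presburger
qed

text \<open>Adjacent exchanges generate all permutations. This makes the arbitrary order chosen by
  \<open>factors\<close> harmless.\<close>

lemma letter_word_mset: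
  assumes "mset vs = mset us"
  shows "letter_word vs + letter_word us \<in> B1 (int (letters_weight vs))"
  using assms
proof (induction vs arbitrary: us)
  case (Cons v vs)
  then have "v \<in> set us" by (metis list.set_intros(1) set_mset_mset)
  then obtain as bs where us: "us = as @ v # bs" by (meson split_list)
  have m: "mset vs = mset (as @ bs)" using Cons(2) us by simp
  have 1: "letter_word (v # vs) + letter_word (v # as @ bs) \<in> B1 (int (letters_weight (v # vs)))"
    using letter_word_cong_Cons[OF Cons(1)[OF m], of v] by (simp add: algebra_simps)
  have 2: "letter_word (v # as @ bs) + letter_word (as @ v # bs) \<in> B1 (int (letters_weight (v # vs)))"
    using letter_word_move[of as v bs] letters_weight_mset[OF m] by (simp add: add.commute)
  show ?case using B1_add[OF 1 2] us by (simp add: add.assoc)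
qed simp

section \<open>Representing elements of \<open>X\<close> by cochains\<close>

definition xmon :: "(nat \<times> nat) list \<Rightarrow> xmono" where
  "xmon vs = (\<Sum>v\<leftarrow>vs. Poly_Mapping.single v 1)"

lemma xmon_simps [simp]: "xmon [] = 0" "xmon (v # vs) = Poly_Mapping.single v 1 + xmon vs"
  by (simp_all add: xmon_def)

lemma lookup_mon: "Poly_Mapping.lookup (xmon vs) v = count_list vs v"
  by (induction vs) (auto simp: lookup_add lookup_single when_def)

lemma lookup_factors: "count_list (factors m) v = Poly_Mapping.lookup m v"
proof -
  have "\<exists>vs. \<forall>v. count_list vs v = Poly_Mapping.lookup m v"
  proof (induction m rule: update_induct)
    case (update m a b)
    then obtain vs where vs: "\<forall>v. count_list vs v = Poly_Mapping.lookup m v" by blast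
    have "count_list (replicate n a) v = (if v = a then n else 0)" for n v
      by (induction n) auto
    then show ?case using update(1) vs
      by (intro exI[of _ "replicate b a @ vs"]) (auto simp: lookup_update in_keys_iff)
  qed (auto intro: exI[of _ "[]"])
  then show ?thesis unfolding factors_def by (rule someI2_ex) blast
qed

lemma mon_factors: "xmon (factors m) = m"
  by (intro poly_mapping_eqI) (simp add: lookup_mon lookup_factors)

lemma mset_factors_mon: "mset (factors (xmon vs)) = mset vs"
proof (rule multiset_eqI)
  have *: "count (mset us) v = count_list us v" for us and v :: "nat \<times> nat"
    by (induction us) auto
  show "count (mset (factors (xmon vs))) v = count (mset vs) v" for v
    by (simp add: * lookup_mon lookup_factors)
qed

definition xmono_weight :: "xmono \<Rightarrow> int" where
  "xmono_weight m = int (word_weight (word m))"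

lemma xmono_weight_mon: "xmono_weight (xmon vs) = int (letters_weight vs)"
  using letters_weight_mset[OF mset_factors_mon[of vs]] by (simp add: xmono_weight_def word_def word_weight_map_letter)

lemma xmono_weight_add_single: "xmono_weight (Poly_Mapping.single v 1 + m) = int (2 * snd v + 1) + xmono_weight m"
  using xmono_weight_mon[of "v # factors m"] xmono_weight_mon[of "factors m"] by (simp add: mon_factors)

lemma X_to_cobar_lin: "X_to_cobar p z = lin (\<lambda>m. if xmono_weight m = p then letter_word (factors m) else 0) z"
  unfolding X_to_cobar_def lin_def xmono_weight_def[symmetric]
  by (subst sum.inter_filter) (auto intro!: sum.cong simp: letter_word_def word_def lookup_bit_keys)

lemma X_to_cobar_add: "X_to_cobar p (y + z) = X_to_cobar p y + X_to_cobar p z"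
  by (simp add: X_to_cobar_lin lin_add)

lemma X_to_cobar_0 [simp]: "X_to_cobar p 0 = 0"
  by (simp add: X_to_cobar_lin)

lemma X_to_cobar_F: "X_to_cobar p z \<in> cobar_F p"
proof -
  have "letter_word (factors m) \<in> cobar_F p" if "xmono_weight m = p" for m
    using that letter_word_F[of "factors m"] xmono_weight_mon[of "factors m"] by (simp add: mon_factors)
  then show ?thesis unfolding X_to_cobar_lin lin_def by (intro cobar_F_sum) simp
qed

text \<open>The class of \<open>y\<close> in filtration \<open>p\<close> of the first page is the
  image of the weight \<open>p\<close> component of \<open>z\<close>; other components of
  \<open>z\<close> are ignored.\<close>

definition represents :: "int \<Rightarrow> cobar \<Rightarrow> X \<Rightarrow> bool" where
  "represents p y z \<longleftrightarrow> y + X_to_cobar p z \<in> B1 p"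

lemma represents_add:
  assumes "represents p y z" "represents p y' z'"
  shows "represents p (y + y') (z + z')"
  using B1_add[OF assms[unfolded represents_def]] by (simp add: represents_def X_to_cobar_add add_ac)

lemma represents_0 [simp]: "represents p 0 0"
  by (simp add: represents_def)

lemma represents_sum: "(\<And>a. a \<in> A \<Longrightarrow> represents p (f a) (g a)) \<Longrightarrow> represents p (sum f A) (sum g A)"
  by (induction A rule: infinite_finite_induct) (simp_all add: represents_add)

lemma represents_low: "y \<in> cobar_F (p - 1) \<Longrightarrow> represents p y 0"
  by (simp add: represents_def F_B1)

lemma represents_F: "represents p y z \<Longrightarrow> y \<in> cobar_F p"
  using cobar_F_add[OF B1_F X_to_cobar_F, of "y + X_to_cobar p z" p z] by (simp add: represents_def add.assoc)

lemma represents_letter_word: "represents (int (letters_weight vs)) (letter_word vs) (basis (xmon vs))"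
  using letter_word_mset[of vs "factors (xmon vs)"]
  by (simp add: represents_def X_to_cobar_lin xmono_weight_mon mset_factors_mon)

lemma R_basis: "i < j \<Longrightarrow> R i j = basis (Poly_Mapping.single (i, j - i - 1) 1)"
  by (simp add: R_def)

text \<open>Putting a letter in front of a word lists the factors of the larger monomial, though
  perhaps not in the order of \<open>factors\<close>; \<open>letter_word_mset\<close> repairs
  this.\<close>

lemma represents_prepend:
  assumes "i < j" "represents p y z"
  shows "represents (R_weight i j + p) (prepend (xij i j) y) (R i j * z)"
proof -
  let ?v = "(i, j - i - 1)"
  have v: "xij i j = xij (fst ?v) (fst ?v + snd ?v + 1)" "R_weight i j = int (2 * snd ?v + 1)"
    using assms(1) by simp_all
  have "prepend (xij i j) (X_to_cobar p z) + X_to_cobar (R_weight i j + p) (R i j * z) \<in> B1 (R_weight i j + p)"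
  proof (induction z rule: pm_bit_induct)
    case (add m z)
    have "prepend (xij i j) (X_to_cobar p (basis m)) + X_to_cobar (R_weight i j + p) (R i j * basis m) \<in> B1 (R_weight i j + p)"
    proof (cases "xmono_weight m = p")
      case True
      let ?m = "Poly_Mapping.single ?v 1 + m"
      have "mset (?v # factors m) = mset (factors ?m)"
        using mset_factors_mon[of "?v # factors m"] by (simp add: mon_factors)
      from letter_word_mset[OF this] have "letter_word (?v # factors m) + letter_word (factors ?m) \<in> B1 (R_weight i j + p)"
        using True xmono_weight_mon[of "factors m"] assms(1) by (simp add: mon_factors algebra_simps)
      moreover have "xmono_weight ?m = R_weight i j + p"
        using xmono_weight_add_single[of ?v m] True assms(1) by simp
      ultimately show ?thesis using True assms(1)
        by (simp add: X_to_cobar_lin R_basis mult_single letter_word_Cons)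
    next
      case False
      then have "xmono_weight (Poly_Mapping.single ?v 1 + m) \<noteq> R_weight i j + p"
        using xmono_weight_add_single[of ?v m] assms(1) by simp
      with False show ?thesis using assms(1)
        by (simp add: X_to_cobar_lin R_basis mult_single)
    qed
    from B1_add[OF this add(2)] show ?case
      by (simp add: X_to_cobar_add prepend_add distrib_left add_ac)
  qed simp
  from B1_add[OF this prepend_B1[OF assms(1) assms(2)[unfolded represents_def]]]
  show ?thesis by (simp add: represents_def prepend_add add_ac)
qed

lemma dX_sum: "dX (sum f A) = (\<Sum>a\<in>A. dX (f a))"
  by (induction A rule: infinite_finite_induct) (simp_all add: dX_add)

lemma dX_1 [simp]: "dX 1 = 0"
  using dX_mult[of 1 1] by simp

lemma dX_R: "dX (R i j) = (\<Sum>k\<in>{i<..<j}. R i k * R k j)"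
proof (cases "i < j")
  case True
  then show ?thesis
    by (simp add: R_basis dX_single dX_mono_def dX_var_def Let_def)
qed (simp add: R_def)

text \<open>By the Leibniz rule the first letter contributes the words beginning with
  \<open>xij k j\<close>, \<open>xij i k\<close>, which is the formula for \<open>dX (R i j)\<close>
  since order does not matter. Here the map from \<open>X\<close> is seen to commute with
  differentials.\<close>

lemma represents_d_letter_word: "represents (int (letters_weight vs) - 1) (cobar_d (letter_word vs)) (dX (basis (xmon vs)))"
proof (induction vs)
  case (Cons v vs)
  let ?i = "fst v" and ?j = "fst v + snd v + 1"
  have R: "basis (xmon (v # vs)) = R ?i ?j * basis (xmon vs)"
    by (simp add: R_basis mult_single)
  have "represents (R_weight ?i ?j + (int (letters_weight vs) - 1)) (prepend (xij ?i ?j) (cobar_d (letter_word vs))) (R ?i ?j * dX (basis (xmon vs)))"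
    using represents_prepend[OF _ Cons, of ?i ?j] by simp
  then have 1: "represents (int (letters_weight (v # vs)) - 1) (prepend (xij ?i ?j) (cobar_d (letter_word vs))) (R ?i ?j * dX (basis (xmon vs)))"
    by (simp add: algebra_simps)
  have "represents (int (letters_weight (v # vs)) - 1) (\<Sum>k\<in>{?i<..<?j}. prepend (xij k ?j) (prepend (xij ?i k) (letter_word vs)))
      (\<Sum>k\<in>{?i<..<?j}. R k ?j * (R ?i k * basis (xmon vs)))"
  proof (rule represents_sum)
    fix k assume "k \<in> {?i<..<?j}"
    then show "represents (int (letters_weight (v # vs)) - 1) (prepend (xij k ?j) (prepend (xij ?i k) (letter_word vs)))
      (R k ?j * (R ?i k * basis (xmon vs)))"
      using represents_prepend[OF _ represents_prepend[OF _ represents_letter_word], of k ?j ?i k vs] by (simp add: algebra_simps)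
  qed
  from represents_add[OF this 1] show ?case
    unfolding letter_word_Cons cobar_d_prepend R dX_mult dX_R
    by (simp add: psi_red_xij prepend2_sum prepend2_tensor sum_distrib_left sum_distrib_right mult_ac)
qed (simp add: letter_word_def cobar_d_eq_lin)

section \<open>Homogeneous elements of \<open>X\<close>\<close>

definition homog :: "int \<Rightarrow> X \<Rightarrow> bool" where
  "homog q z \<longleftrightarrow> (\<forall>m\<in>Poly_Mapping.keys z. xmono_weight m = q)"

lemma homog_0 [simp]: "homog q 0"
  by (simp add: homog_def)

lemma homog_add: "homog q y \<Longrightarrow> homog q z \<Longrightarrow> homog q (y + z)"
  using keys_add[of y z] by (auto simp: homog_def)

lemma homog_sum: "(\<And>a. a \<in> A \<Longrightarrow> homog q (f a)) \<Longrightarrow> homog q (sum f A)"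
  by (induction A rule: infinite_finite_induct) (simp_all add: homog_add)

lemma homog_mon: "homog (int (letters_weight vs)) (basis (xmon vs))"
  by (simp add: homog_def xmono_weight_mon)

lemma homog_1: "homog 0 1"
  using homog_mon[of "[]"] by simp

lemma homog_R:
  assumes "homog q z"
  shows "homog (R_weight i j + q) (R i j * z)"
proof (cases "i < j")
  case True
  show ?thesis unfolding homog_def
  proof
    fix m assume "m \<in> Poly_Mapping.keys (R i j * z)"
    then obtain b where b: "m = Poly_Mapping.single (i, j - i - 1) 1 + b" "b \<in> Poly_Mapping.keys z"
      using keys_mult[of "R i j" z] True by (auto simp: R_basis)
    then show "xmono_weight m = R_weight i j + q"
      using assms True xmono_weight_add_single[of "(i, j - i - 1)" b] by (simp add: homog_def)
  qed
qed (simp add: R_def)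

lemma X_to_cobar_homog: "homog q z \<Longrightarrow> p \<noteq> q \<Longrightarrow> X_to_cobar p z = 0"
  unfolding X_to_cobar_lin lin_def homog_def by (intro sum.neutral) auto

text \<open>Splitting a variable into two of the same total length loses exactly one unit of weight.
  So a monomial of weight other than \<open>p + 1\<close> has a boundary without component of weight
  \<open>p\<close>.\<close>

lemma homog_dX_mon: "homog (int (letters_weight vs) - 1) (dX (basis (xmon vs)))"
proof (induction vs)
  case (Cons v vs)
  let ?i = "fst v" and ?j = "fst v + snd v + 1"
  have R: "basis (xmon (v # vs)) = R ?i ?j * basis (xmon vs)"
    by (simp add: R_basis mult_single)
  have "homog (int (letters_weight (v # vs)) - 1) (R ?i ?j * dX (basis (xmon vs)))"
    using homog_R[OF Cons, where i = ?i and j = ?j] by (simp add: algebra_simps)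
  moreover have "homog (int (letters_weight (v # vs)) - 1) (\<Sum>k\<in>{?i<..<?j}. R k ?j * (R ?i k * basis (xmon vs)))"
  proof (rule homog_sum)
    fix k assume "k \<in> {?i<..<?j}"
    then show "homog (int (letters_weight (v # vs)) - 1) (R k ?j * (R ?i k * basis (xmon vs)))"
      using homog_R[OF homog_R[OF homog_mon, where i = ?i and j = k], where i = k and j = ?j]
      by (simp add: algebra_simps)
  qed
  ultimately have "homog (int (letters_weight (v # vs)) - 1)
      ((\<Sum>k\<in>{?i<..<?j}. R k ?j * (R ?i k * basis (xmon vs))) + R ?i ?j * dX (basis (xmon vs)))"
    using homog_add by blast
  then show ?case unfolding R dX_mult dX_R by (simp add: sum_distrib_left sum_distrib_right mult_ac)
qed simp

lemma represents_d_X_to_cobar: "represents p (cobar_d (X_to_cobar (p + 1) u)) (dX u)"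
proof (induction u rule: pm_bit_induct)
  case (add m u)
  have "represents p (cobar_d (X_to_cobar (p + 1) (basis m))) (dX (basis m))"
  proof (cases "xmono_weight m = p + 1")
    case True
    then have p: "p = int (letters_weight (factors m)) - 1"
      using xmono_weight_mon[of "factors m"] by (simp add: mon_factors)
    show ?thesis using represents_d_letter_word[of "factors m"] True
      unfolding p[symmetric] by (simp add: X_to_cobar_lin mon_factors)
  next
    case False
    then have "X_to_cobar p (dX (basis m)) = 0"
      using X_to_cobar_homog[OF homog_dX_mon[of "factors m"], of p] xmono_weight_mon[of "factors m"]
      by (simp add: mon_factors)
    then show ?thesis using False by (simp add: represents_def X_to_cobar_lin)
  qed
  from represents_add[OF this add(2)] show ?case
    by (simp add: X_to_cobar_add cobar_d_add dX_add)
qed simp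

section \<open>Classes on the third page and their differential\<close>

abbreviation "Z r p \<equiv> ss_Z cobar_d cobar_F r p"
abbreviation "B3 p \<equiv> ss_B cobar_d cobar_F 3 p"

lemma Z_add: "y \<in> Z r p \<Longrightarrow> z \<in> Z r p \<Longrightarrow> y + z \<in> Z r p"
  by (simp add: ss_Z_def cobar_F_add cobar_d_add)

lemma Z_0 [simp]: "0 \<in> Z r p"
  by (simp add: ss_Z_def)

lemma B3_eq: "B3 p = {u + cobar_d v | u v. u \<in> Z 2 (p - 1) \<and> v \<in> Z 2 (p + 2)}"
proof -
  have *: "(3::int) - 1 = 2" "p + 3 - 1 = p + 2" by simp_all
  show ?thesis unfolding ss_B_def * ..
qed

lemma B3_add: "y \<in> B3 p \<Longrightarrow> z \<in> B3 p \<Longrightarrow> y + z \<in> B3 p"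
proof -
  assume "y \<in> B3 p" "z \<in> B3 p"
  then obtain u v u' v' where "y = u + cobar_d v" "z = u' + cobar_d v'"
    "u \<in> Z 2 (p - 1)" "u' \<in> Z 2 (p - 1)" "v \<in> Z 2 (p + 2)" "v' \<in> Z 2 (p + 2)"
    unfolding B3_eq by blast
  then show ?thesis unfolding B3_eq
    by (intro CollectI exI[of _ "u + u'"] exI[of _ "v + v'"]) (simp add: Z_add cobar_d_add add_ac)
qed

lemma B3_0 [simp]: "0 \<in> B3 p"
  unfolding B3_eq by (intro CollectI exI[of _ 0]) simp

lemma d_B3: "y \<in> Z 2 (p + 2) \<Longrightarrow> cobar_d y \<in> B3 p"
  unfolding B3_eq by (intro CollectI exI[of _ 0] exI[of _ y]) simp

lemma B3_Z3: "y \<in> B3 p \<Longrightarrow> y \<in> Z 3 p"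
proof -
  assume "y \<in> B3 p"
  then obtain u v where *: "y = u + cobar_d v" "u \<in> Z 2 (p - 1)" "v \<in> Z 2 (p + 2)"
    unfolding B3_eq by blast
  then have "u \<in> cobar_F p" "cobar_d v \<in> cobar_F p" "cobar_d u \<in> cobar_F (p - 3)"
    by (auto simp: ss_Z_def intro: cobar_F_mono)
  then show ?thesis using * by (simp add: ss_Z_def cobar_F_add cobar_d_add cobar_d_d)
qed

lemma coset_eq_iff:
  fixes B :: "('a \<Rightarrow>\<^sub>0 bit) set"
  assumes "0 \<in> B" "\<And>y z. y \<in> B \<Longrightarrow> z \<in> B \<Longrightarrow> y + z \<in> B"
  shows "{y + b | b. b \<in> B} = {z + b | b. b \<in> B} \<longleftrightarrow> y + z \<in> B"
proof
  assume "{y + b | b. b \<in> B} = {z + b | b. b \<in> B}"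
  moreover have "y \<in> {y + b | b. b \<in> B}" using assms(1) by force
  ultimately obtain b where "y = z + b" "b \<in> B" by blast
  then show "y + z \<in> B" by (simp add: add_ac)
next
  assume *: "y + z \<in> B"
  have "y + b = z + ((y + z) + b)" "z + b = y + ((y + z) + b)" for b
    by (simp_all add: add_ac)
  then show "{y + b | b. b \<in> B} = {z + b | b. b \<in> B}"
    using * assms(2) by blast
qed

lemma class3_eq_iff: "ss_class cobar_d cobar_F 3 p y = ss_class cobar_d cobar_F 3 p z \<longleftrightarrow> y + z \<in> B3 p"
  unfolding ss_class_def by (rule coset_eq_iff) (simp_all add: B3_add)

lemma class1_eq_iff: "ss_class cobar_d cobar_F 1 p y = X_to_E1 z p \<longleftrightarrow> represents p y z"
  unfolding ss_class_def X_to_E1_def represents_def ss_B_1 by (rule coset_eq_iff) (simp_all add: B1_add)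

lemma mem_class3: "z \<in> ss_class cobar_d cobar_F 3 p y \<longleftrightarrow> y + z \<in> B3 p"
proof -
  have "z = y + (y + z)" by simp
  moreover have "y + (y + b) = b" for b by simp
  ultimately show ?thesis unfolding ss_class_def mem_Collect_eq by metis
qed

lemma HX_class_eq:
  assumes "dX y = 0" "dX z = 0" "HX_class y = HX_class z"
  obtains u where "y = z + dX u"
proof -
  have "homologous y y" "homologous z z"
    using assms by (auto simp: homologous_def intro: exI[of _ 0])
  then have "homologous y z"
    using assms(3) Quotient_rel[OF Quotient_HX, of y z] by blast
  then show ?thesis using that by (metis homologousE)
qed

text \<open>Existence is witnessed by \<open>y\<close>. For uniqueness, a representative
  \<open>x\<close> of a homologous cycle differs from \<open>y\<close> by an element of filtration
  \<open>p - 1\<close> plus a coboundary. The first has its own coboundary in \<open>p - 3\<close>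
  because \<open>y + x\<close> does, and the second comes from filtration \<open>p + 1\<close> with
  value in filtration \<open>p\<close>; so both lie in \<open>B3 p\<close>.\<close>

lemma HX_to_E3_class:
  assumes "dX z = 0" "y \<in> Z 3 p" "represents p y z"
  shows "HX_to_E3 (HX_class z) p = ss_class cobar_d cobar_F 3 p y"
  unfolding HX_to_E3_def class1_eq_iff
proof (rule the_equality)
  show "ss_class cobar_d cobar_F 3 p y \<in> ss_E cobar_d cobar_F 3 p \<and>
    (\<exists>z'. dX z' = 0 \<and> HX_class z' = HX_class z \<and> (\<exists>x\<in>ss_class cobar_d cobar_F 3 p y. represents p x z'))"
    using assms mem_class3[of y p y] unfolding ss_E_def by auto
next
  fix e
  assume "e \<in> ss_E cobar_d cobar_F 3 p \<and>
    (\<exists>z'. dX z' = 0 \<and> HX_class z' = HX_class z \<and> (\<exists>x\<in>e. represents p x z'))"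
  then obtain y' z' x where y': "y' \<in> Z 3 p" "e = ss_class cobar_d cobar_F 3 p y'"
    and z': "dX z' = 0" "HX_class z' = HX_class z" and x: "x \<in> e" "represents p x z'"
    unfolding ss_E_def by blast
  obtain u where u: "z' = z + dX u" using HX_class_eq[OF z'(1) assms(1) z'(2)] .
  have y'x: "y' + x \<in> B3 p" using x(1) y'(2) mem_class3 by blast
  then have "x \<in> Z 3 p" using Z_add[OF y'(1) B3_Z3[OF y'x]] by simp
  then have yx: "y + x \<in> Z 3 p" using assms(2) Z_add by blast
  \<comment> \<open>A lift of the homology \<open>u\<close> between the two cycles; it sits one
    filtration step higher since \<open>dX\<close> lowers weight by one.\<close>
  define v where "v = X_to_cobar (p + 1) u"
  have "y + x + cobar_d v \<in> B1 p"
  proof -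
    have "represents p (y + x + cobar_d v) (z + z' + dX u)"
      unfolding v_def by (intro represents_add assms(3) x(2) represents_d_X_to_cobar)
    then show ?thesis by (simp add: u represents_def add.assoc)
  qed
  then obtain a b where ab: "y + x + cobar_d v = a + cobar_d b" "a \<in> cobar_F (p - 1)" "b \<in> cobar_F p"
    unfolding B1_def by blast
  have a: "a = y + x + cobar_d (v + b)"
  proof -
    have "a = (y + x + cobar_d v) + cobar_d b" unfolding ab(1) by (simp add: add.assoc)
    then show ?thesis by (simp add: cobar_d_add add.assoc)
  qed
  have "v + b \<in> cobar_F (p + 1)"
    using X_to_cobar_F[of "p + 1" u] cobar_F_mono[OF ab(3), of "p + 1"] by (simp add: v_def cobar_F_add)
  moreover have dvb: "cobar_d (v + b) = a + (y + x)" by (simp add: a add_ac)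
  then have "cobar_d (v + b) \<in> cobar_F p"
    using cobar_F_mono[OF ab(2), of p] yx by (simp add: cobar_F_add ss_Z_def)
  ultimately have "v + b \<in> Z 2 (p + 2)"
    using cobar_F_mono[of "v + b" "p + 1" "p + 2"] by (simp add: ss_Z_def)
  moreover have "cobar_d a = cobar_d (y + x)"
    unfolding a cobar_d_add[of "y + x"] cobar_d_d by simp
  then have "a \<in> Z 2 (p - 1)" using yx ab(2) by (simp add: ss_Z_def)
  ultimately have "a + cobar_d (v + b) \<in> B3 p" unfolding B3_eq by blast
  then have "y + x \<in> B3 p" by (simp add: a add.assoc)
  from B3_add[OF this y'x] have "y + y' \<in> B3 p" by (simp add: add_ac)
  then show "e = ss_class cobar_d cobar_F 3 p y"
    using y'(2) class3_eq_iff by (simp add: add.commute)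
qed

text \<open>Two elements of a coset differ by \<open>u + cobar_d v\<close>; the coboundary of that
  is \<open>cobar_d u\<close> with \<open>u\<close> in \<open>Z 2 (p + 2)\<close>, a relation on the
  third page.\<close>

lemma d3_class:
  assumes "e (p + 3) = ss_class cobar_d cobar_F 3 (p + 3) y" "y \<in> Z 3 (p + 3)"
  shows "d3 e p = ss_class cobar_d cobar_F 3 p (cobar_d y)"
proof -
  have "ss_class cobar_d cobar_F 3 p (cobar_d x) = ss_class cobar_d cobar_F 3 p (cobar_d y)"
    if "x \<in> e (p + 3)" for x
  proof -
    have "y + x \<in> B3 (p + 3)" using that assms(1) mem_class3 by blast
    then obtain u v where *: "y + x = u + cobar_d v" "u \<in> Z 2 (p + 3 - 1)"
      unfolding B3_eq by blast
    then have "cobar_d (y + x) = cobar_d u" by (simp add: cobar_d_add cobar_d_d)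
    then show ?thesis using d_B3[of u p] *(2) unfolding class3_eq_iff
      by (simp add: cobar_d_add add.commute)
  qed
  moreover have "y \<in> e (p + 3)" using assms(1) mem_class3 by simp
  ultimately show ?thesis unfolding d3_def ss_d_def by blast
qed

section \<open>The coaction on symmetric powers\<close>

text \<open>
  \<open>coef J L\<close> is the coefficient of \<open>e\<^sub>L\<close> in \<open>\<Prod>\<^sub>j\<^sub>\<in>\<^sub>J \<Sum>\<^sub>i x\<^sub>j\<^sub>i e\<^sub>i\<close>, where the
  commuting variables \<open>e\<^sub>i\<close> are indexed by natural numbers and monomials by multisets.
\<close>

definition coef_step :: "nat \<Rightarrow> (nat multiset \<Rightarrow> steenrod) \<Rightarrow> nat multiset \<Rightarrow> steenrod" where
  "coef_step j g L = (\<Sum>i\<in>set_mset L. xij j i * g (L - {#i#}))"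

definition coef :: "nat multiset \<Rightarrow> nat multiset \<Rightarrow> steenrod" where
  "coef J = fold_mset coef_step (\<lambda>L. if L = {#} then 1 else 0) J"

lemma mset_pair_swap: "i \<in># L \<and> l \<in># L - {#i#} \<longleftrightarrow> l \<in># L \<and> i \<in># L - {#l#}"
  by (cases "i = l") (auto simp: in_diff_count)

text \<open>A product of linear forms does not depend on the order of its factors; this is what
  \<open>fold_mset\<close> requires.\<close>

interpretation coef_step: comp_fun_commute coef_step
proof
  fix k j
  show "coef_step k \<circ> coef_step j = coef_step j \<circ> coef_step k"
  proof (intro ext, unfold o_apply)
    fix g L
    have "coef_step k (coef_step j g) L =
        (\<Sum>(i, l)\<in>Sigma (set_mset L) (\<lambda>i. set_mset (L - {#i#})). xij k i * (xij j l * g (L - {#i#} - {#l#})))"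
      by (simp add: coef_step_def sum_distrib_left sum.Sigma)
    also have "\<dots> = (\<Sum>(i, l)\<in>Sigma (set_mset L) (\<lambda>i. set_mset (L - {#i#})). xij j i * (xij k l * g (L - {#i#} - {#l#})))"
    proof (rule sum.reindex_bij_witness[of _ prod.swap prod.swap])
      fix p assume "p \<in> Sigma (set_mset L) (\<lambda>i. set_mset (L - {#i#}))"
      then obtain i l where p: "p = (i, l)" "i \<in># L \<and> l \<in># L - {#i#}" by blast
      from p(2) have "l \<in># L \<and> i \<in># L - {#l#}" by (rule mset_pair_swap[THEN iffD1])
      then show "prod.swap p \<in> Sigma (set_mset L) (\<lambda>i. set_mset (L - {#i#}))"
        "prod.swap p \<in> Sigma (set_mset L) (\<lambda>i. set_mset (L - {#i#}))"
        by (simp_all add: p)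
      have "L - {#l#} - {#i#} = L - {#i#} - {#l#}" by (rule diff_right_commute)
      then show "(case prod.swap p of (i, l) \<Rightarrow> xij j i * (xij k l * g (L - {#i#} - {#l#}))) =
          (case p of (i, l) \<Rightarrow> xij k i * (xij j l * g (L - {#i#} - {#l#})))"
        by (simp add: p mult.left_commute)
    qed simp_all
    also have "\<dots> = coef_step j (coef_step k g) L"
      by (simp add: coef_step_def sum_distrib_left sum.Sigma)
    finally show "coef_step k (coef_step j g) L = coef_step j (coef_step k g) L" .
  qed
qed

lemma coef_empty: "coef {#} L = (if L = {#} then 1 else 0)"
  by (simp add: coef_def)

lemma coef_add: "coef (add_mset j J) L = (\<Sum>i\<in>set_mset L. xij j i * coef J (L - {#i#}))"
  by (simp add: coef_def) (simp add: coef_step_def)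

lemma coef_size: "size J \<noteq> size L \<Longrightarrow> coef J L = 0"
proof (induction J arbitrary: L)
  case (add j J)
  have "coef J (L - {#i#}) = 0" if "i \<in># L" for i
    using size_Suc_Diff1[OF that] add(2) by (intro add(1)) auto
  then show ?case by (simp add: coef_add)
qed (auto simp: coef_empty)

lemma sum_mset_diff_single: "i \<in># (L :: nat multiset) \<Longrightarrow> \<Sum>\<^sub># L = i + \<Sum>\<^sub># (L - {#i#})"
  by (metis insert_DiffM sum_mset.add_mset)

text \<open>The matrix \<open>xij\<close> is unitriangular: indices move only upwards, and the index
  sum stays the same only if none moves.\<close>

lemma coef_ge: "\<Sum>\<^sub># L \<le> \<Sum>\<^sub># J \<Longrightarrow> coef J L = (if J = L then 1 else 0)"
proof (induction J arbitrary: L)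
  case (add j J)
  have "xij j i * coef J (L - {#i#}) = (if i = j then if J = L - {#j#} then 1 else 0 else 0)"
    if i: "i \<in># L" for i
  proof (cases i j rule: linorder_cases)
    case equal
    then show ?thesis using add sum_mset_diff_single[OF i] by auto
  next
    case greater
    then have "\<Sum>\<^sub># (L - {#i#}) < \<Sum>\<^sub># J" using add(2) sum_mset_diff_single[OF i] by auto
    then show ?thesis using add(1)[of "L - {#i#}"] greater by auto
  qed simp
  then have "coef (add_mset j J) L = (\<Sum>i\<in>set_mset L. if i = j then if J = L - {#j#} then 1 else 0 else 0)"
    by (simp add: coef_add)
  then show ?case by (auto simp: sum.delta)
qed (auto simp: coef_empty)

lemma coef_refl [simp]: "coef J J = 1"
  by (simp add: coef_ge)

definition msets :: "nat \<Rightarrow> nat \<Rightarrow> nat multiset set" where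
  "msets N n = {M. set_mset M \<subseteq> {..N} \<and> size M = n}"

lemma msets_Suc: "msets N (Suc n) = (\<lambda>(m, M). add_mset m M) ` ({..N} \<times> msets N n)"
proof safe
  fix M assume "M \<in> msets N (Suc n)"
  then obtain m M' where "M = add_mset m M'"
    using size_eq_Suc_imp_eq_union[of M n] by (auto simp: msets_def)
  then show "M \<in> (\<lambda>(m, M). add_mset m M) ` ({..N} \<times> msets N n)"
    using \<open>M \<in> msets N (Suc n)\<close> by (auto simp: msets_def intro!: image_eqI[of _ _ "(m, M')"])
qed (auto simp: msets_def)

lemma msets_0: "msets N 0 = {{#}}"
  by (auto simp: msets_def)

lemma finite_msets [simp]: "finite (msets N n)"
  by (induction n) (auto simp: msets_0 msets_Suc)

text \<open>The coaction on a symmetric power is a comodule structure, and \<open>coef\<close> is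
  its matrix. The bound \<open>N\<close> keeps the set of intermediate monomials finite; indices
  above those of \<open>L\<close> contribute nothing.\<close>

lemma psi_coef:
  assumes "set_mset L \<subseteq> {..N}"
  shows "psi (coef J L) = (\<Sum>M\<in>msets N (size J). tensor (coef M L) (coef J M))"
  using assms
proof (induction J arbitrary: L)
  case empty
  then show ?case by (simp add: coef_empty msets_0)
next
  case (add j J)
  let ?n = "size J"
  have x: "psi (xij j i) = (\<Sum>m\<le>N. tensor (xij m i) (xij j m))" if "i \<in># L" for i
    unfolding psi_xij using that add(2)
    by (intro sum.mono_neutral_left) (auto simp: xij_def)
  have "psi (coef (add_mset j J) L) =
      (\<Sum>i\<in>set_mset L. \<Sum>m\<le>N. \<Sum>M\<in>msets N ?n. tensor (xij m i * coef M (L - {#i#})) (xij j m * coef J M))"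
    unfolding coef_add psi_sum psi_mult
  proof (rule sum.cong[OF refl])
    fix i assume i: "i \<in># L"
    have "set_mset (L - {#i#}) \<subseteq> {..N}" using add(2) by (meson in_diffD subset_iff)
    then show "psi (xij j i) * psi (coef J (L - {#i#})) =
      (\<Sum>m\<le>N. \<Sum>M\<in>msets N ?n. tensor (xij m i * coef M (L - {#i#})) (xij j m * coef J M))"
      by (simp add: add(1) x[OF i] sum_product tensor_mult)
  qed
  also have "\<dots> = (\<Sum>m\<le>N. \<Sum>M\<in>msets N ?n. \<Sum>i\<in>set_mset L. tensor (xij m i * coef M (L - {#i#})) (xij j m * coef J M))"
    by (subst sum.swap, rule sum.cong[OF refl], rule sum.swap)
  also have "\<dots> = (\<Sum>m\<le>N. \<Sum>M\<in>msets N ?n. tensor (coef (add_mset m M) L) (xij j m * coef J M))"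
    by (simp add: coef_add tensor_sum_left)
  also have "\<dots> = (\<Sum>(m, M)\<in>{..N} \<times> msets N ?n. tensor (coef (add_mset m M) L) (xij j m * coef J M))"
    by (simp add: sum.cartesian_product)
  \<comment> \<open>A variable and a monomial of degree \<open>size J\<close> correspond to a
    monomial of degree one more with a distinguished member of its support, as in
    \<open>coef_add\<close>.\<close>
  also have "\<dots> = (\<Sum>(M, m)\<in>Sigma (msets N (Suc ?n)) set_mset. tensor (coef M L) (xij j m * coef J (M - {#m#})))"
    by (rule sum.reindex_bij_witness[of _ "\<lambda>(M, m). (m, M - {#m#})" "\<lambda>(m, M). (add_mset m M, m)"])
      (auto simp: msets_def size_Diff_singleton dest: in_diffD)
  also have "\<dots> = (\<Sum>M\<in>msets N (size (add_mset j J)). tensor (coef M L) (coef (add_mset j J) M))"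
    by (simp add: coef_add tensor_sum_right sum.Sigma)
  finally show ?case .
qed

lemma xij_FA_neq: "i \<noteq> j \<Longrightarrow> xij i j \<in> FA (R_weight i j)"
  using xij_FA by (cases i j rule: linorder_cases) auto

definition isum :: "nat multiset \<Rightarrow> int" where
  "isum M = int (\<Sum>\<^sub># M)"

lemma isum_simps [simp]: "isum {#} = 0" "isum (add_mset i M) = int i + isum M"
  by (simp_all only: isum_def sum_mset.empty sum_mset.add_mset of_nat_0 of_nat_add)

lemma isum_diff_single: "i \<in># L \<Longrightarrow> isum (L - {#i#}) = isum L - int i"
  using isum_simps(2)[of i "L - {#i#}"] by simp

text \<open>Each index that moves uses a letter whose weight is one less than twice the distance,
  and at least \<open>size (J - L)\<close> of the indices must move.\<close>

lemma coef_FA: "coef J L \<in> FA (2 * (isum L - isum J) - int (size (J - L)))"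
proof (induction J arbitrary: L)
  case empty
  then show ?case by (auto simp: coef_empty one_FA)
next
  case (add j J)
  show ?case unfolding coef_add
  proof (rule wfilt_sum)
    fix i assume i: "i \<in># L"
    show "xij j i * coef J (L - {#i#}) \<in> FA (2 * (isum L - isum (add_mset j J)) - int (size (add_mset j J - L)))"
    proof (cases "i = j")
      case True
      have "J - (L - {#j#}) = add_mset j J - L"
        using i True by (intro multiset_eqI) (auto simp: count_eq_zero_iff[symmetric] simp del: count_eq_zero_iff)
      then show ?thesis using wfilt_mono[OF add[of "L - {#i#}"]] True isum_diff_single[OF i] by simp
    next
      case False
      have "add_mset j J - L \<subseteq># add_mset j (J - (L - {#i#}))"
        by (auto simp: subseteq_mset_def)
      then have "size (add_mset j J - L) \<le> Suc (size (J - (L - {#i#})))"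
        using size_mset_mono by fastforce
      then show ?thesis
        using wfilt_mono[OF FA_mult[OF xij_FA_neq add[of "L - {#i#}"]], of j i] False isum_diff_single[OF i]
        by (simp add: algebra_simps)
    qed
  qed
qed

lemma reduced_add: "reduced c \<Longrightarrow> reduced d \<Longrightarrow> reduced (c + d)"
  using keys_add[of c d] by (auto simp: reduced_def)

lemma reduced_0 [simp]: "reduced 0"
  by (simp add: reduced_def)

lemma reduced_sum: "(\<And>a. a \<in> A \<Longrightarrow> reduced (f a)) \<Longrightarrow> reduced (sum f A)"
  by (induction A rule: infinite_finite_induct) (auto simp: reduced_add)

lemma reduced_mult: "reduced c \<Longrightarrow> reduced (c * d)"
proof -
  have z: "a + b = 0 \<Longrightarrow> a = 0" for a b :: mono
    by (auto simp: poly_mapping_eq_iff fun_eq_iff lookup_add)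
  assume "reduced c"
  then show ?thesis using keys_mult[of c d] z unfolding reduced_def by force
qed

lemma reduced_xij_neq: "i \<noteq> j \<Longrightarrow> reduced (xij i j)"
  using reduced_xij by (cases i j rule: linorder_cases) auto

lemma reduced_coef: "J \<noteq> L \<Longrightarrow> reduced (coef J L)"
proof (induction J arbitrary: L)
  case empty
  then show ?case by (auto simp: coef_empty)
next
  case (add j J)
  show ?case unfolding coef_add
  proof (rule reduced_sum)
    fix i assume i: "i \<in># L"
    show "reduced (xij j i * coef J (L - {#i#}))"
    proof (cases "i = j")
      case True
      then have "J \<noteq> L - {#i#}" using add(2) i by auto
      then show ?thesis using add(1) True by simp
    qed (simp add: reduced_mult reduced_xij_neq)
  qed
qed

text \<open>Moving \<open>j\<close> straight to \<open>i\<close> gives \<open>xij j i\<close>. Any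
  other term sends \<open>j\<close> to some \<open>l\<close> in \<open>C\<close>, so a second index
  has to move, which costs one more unit of weight.\<close>

lemma coef_single:
  assumes "j \<notin># C" "i \<noteq> j"
  shows "coef (add_mset j C) (add_mset i C) + xij j i \<in> FA (2 * (int i - int j) - 2)"
proof -
  let ?L = "add_mset i C"
  have "coef (add_mset j C) ?L = xij j i + (\<Sum>l\<in>set_mset ?L - {i}. xij j l * coef C (?L - {#l#}))"
    unfolding coef_add by (subst sum.remove[of _ i]) auto
  then have "coef (add_mset j C) ?L + xij j i = (\<Sum>l\<in>set_mset ?L - {i}. xij j l * coef C (?L - {#l#}))"
    by (simp add: add_ac)
  also have "\<dots> \<in> FA (2 * (int i - int j) - 2)"
  proof (rule wfilt_sum)
    fix l assume "l \<in> set_mset ?L - {i}"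
    then have l: "l \<in># C" "l \<in># ?L" "l \<noteq> i" "l \<noteq> j" using assms by auto
    then have "l \<in># C - (?L - {#l#})" by (simp add: in_diff_count)
    then have "0 < size (C - (?L - {#l#}))" by (auto simp: nonempty_has_size[symmetric])
    then show "xij j l * coef C (?L - {#l#}) \<in> FA (2 * (int i - int j) - 2)"
      using wfilt_mono[OF FA_mult[OF xij_FA_neq coef_FA[of C "?L - {#l#}"]], of j l] l
        isum_diff_single[OF l(2)] by simp
  qed
  finally show ?thesis .
qed

text \<open>In characteristic two the off-diagonal terms cancel in pairs.\<close>

lemma sum_symmetric:
  fixes f :: "nat \<times> nat \<Rightarrow> 'a \<Rightarrow>\<^sub>0 bit"
  assumes "finite P" "\<And>i l. (i, l) \<in> P \<Longrightarrow> (l, i) \<in> P \<and> f (l, i) = f (i, l)"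
  shows "sum f P = (\<Sum>i | (i, i) \<in> P. f (i, i))"
proof -
  let ?A = "{p \<in> P. fst p < snd p}" and ?B = "{p \<in> P. snd p < fst p}" and ?C = "{p \<in> P. fst p = snd p}"
  have "sum f P = sum f (?A \<union> ?B \<union> ?C)"
    by (rule sum.cong) auto
  also have "\<dots> = sum f (?A \<union> ?B) + sum f ?C"
    using assms(1) by (intro sum.union_disjoint) auto
  also have "sum f (?A \<union> ?B) = sum f ?A + sum f ?B"
    using assms(1) by (intro sum.union_disjoint) auto
  also have "sum f ?A = sum f ?B"
    by (rule sum.reindex_bij_witness[of _ prod.swap prod.swap]) (use assms(2) in auto)
  also have "sum f ?C = (\<Sum>i | (i, i) \<in> P. f (i, i))"
    by (rule sum.reindex_bij_witness[of _ "\<lambda>i. (i, i)" fst]) auto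
  finally show ?thesis by simp
qed

text \<open>
  Frobenius: \<open>(\<Sum>\<^sub>l x\<^sub>i\<^sub>l e\<^sub>l)\<^sup>2 = \<Sum>\<^sub>l x\<^sub>i\<^sub>l\<^sup>2 e\<^sub>l\<^sup>2\<close> and \<open>x\<^sub>i\<^sub>l\<^sup>2 = x\<^sub>i\<^sub>+\<^sub>1\<^sub>,\<^sub>l\<^sub>+\<^sub>1\<close>.
\<close>

lemma coef_double:
  "coef (add_mset i (add_mset i J)) L =
    (\<Sum>l | 2 \<le> count L l. xij (Suc i) (Suc l) * coef J (L - {#l, l#}))"
proof -
  let ?P = "Sigma (set_mset L) (\<lambda>l. set_mset (L - {#l#}))"
  let ?f = "\<lambda>(l, k). xij i l * (xij i k * coef J (L - {#l#} - {#k#}))"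
  have sw: "(l, k) \<in> ?P \<Longrightarrow> (k, l) \<in> ?P" for k l
    using mset_pair_swap[of l L k] by simp
  have c: "L - {#l#} - {#k#} = L - {#k#} - {#l#}" for k l by (rule diff_right_commute)
  have "coef (add_mset i (add_mset i J)) L = sum ?f ?P"
    by (simp add: coef_add sum_distrib_left sum.Sigma)
  also have "\<dots> = (\<Sum>l | (l, l) \<in> ?P. ?f (l, l))"
  proof (rule sum_symmetric)
    fix l k assume "(l, k) \<in> ?P"
    then show "(k, l) \<in> ?P \<and> ?f (k, l) = ?f (l, k)"
      using sw[of l k] c[of l k] by (simp add: mult.left_commute)
  qed simp
  also have "{l. (l, l) \<in> ?P} = {l. 2 \<le> count L l}"
  proof (rule Collect_cong)
    show "(l, l) \<in> ?P \<longleftrightarrow> 2 \<le> count L l" for l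
    proof (cases "l \<in># L")
      case True
      then show ?thesis by (simp add: in_diff_count Suc_le_eq numeral_2_eq_2)
    next
      case False
      then show ?thesis by (simp add: not_in_iff)
    qed
  qed
  finally show ?thesis
    by (simp add: xij_square diff_diff_add flip: mult.assoc)
qed

abbreviation mset_of :: "nat set \<Rightarrow> nat multiset" where
  "mset_of \<equiv> mset_set"

lemma count_mset_of: "finite K \<Longrightarrow> count (mset_of K) l = (if l \<in> K then 1 else 0)"
  by simp

lemma coef_double_set:
  assumes "finite K"
  shows "coef (add_mset i (add_mset i J)) (mset_of K) = 0"
  unfolding coef_double by (intro sum.neutral) (auto simp: assms count_mset_of split: if_splits)

text \<open>The only square that can divide \<open>e_m e_K\<close> is \<open>e_m^2\<close>, and it
  does so just when \<open>m\<close> is in \<open>K\<close>.\<close>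

lemma coef_double_add_set:
  assumes "finite K"
  shows "coef (add_mset i (add_mset i J)) (add_mset m (mset_of K)) =
    (if m \<in> K then xij (Suc i) (Suc m) * coef J (mset_of (K - {m})) else 0)"
proof -
  have "{l. 2 \<le> count (add_mset m (mset_of K)) l} = (if m \<in> K then {m} else {})"
    using assms by (auto simp: count_mset_of split: if_splits)
  moreover have "add_mset m (mset_of K) - {#m, m#} = mset_of (K - {m})" if "m \<in> K"
    using assms that by (simp add: mset_set_Diff)
  ultimately show ?thesis by (simp add: coef_double)
qed

text \<open>The image of \<open>e_m\<close> involves \<open>e_m\<close> and higher variables only;
  below \<open>m + 1\<close> it has to stay where it is.\<close>

lemma coef_top:
  assumes "set_mset L \<subseteq> {..m}"
  shows "coef (add_mset m J) (add_mset m L) = coef J L"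
proof -
  have "coef (add_mset m J) (add_mset m L) = (\<Sum>i\<in>{m}. xij m i * coef J (add_mset m L - {#i#}))"
    unfolding coef_add using assms by (intro sum.mono_neutral_right) (auto simp: le_less)
  then show ?thesis by simp
qed

lemma coef_top_0:
  assumes "set_mset L \<subseteq> {..<m}"
  shows "coef (add_mset m J) L = 0"
  unfolding coef_add using assms by (intro sum.neutral) auto

section \<open>A lift of the determinant\<close>

definition nonsqf :: "nat multiset \<Rightarrow> bool" where
  "nonsqf M \<longleftrightarrow> (\<exists>i. 2 \<le> count M i)"

lemma sqf_mset_of: "\<not> nonsqf M \<Longrightarrow> mset_of (set_mset M) = M"
proof (rule multiset_eqI)
  fix i assume "\<not> nonsqf M"
  then have "count M i < 2" by (metis nonsqf_def not_le)
  then consider "count M i = 0" | "count M i = 1" by linarith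
  then show "count (mset_of (set_mset M)) i = count M i"
  proof cases
    case 1
    then have "i \<notin># M" by (simp add: not_in_iff)
    then show ?thesis by (simp add: 1)
  next
    case 2
    then have "i \<in># M" by (intro count_inI) simp
    then show ?thesis by (simp add: 2)
  qed
qed

lemma not_nonsqf_mset_of: "finite J \<Longrightarrow> \<not> nonsqf (mset_of J)"
  by (auto simp: nonsqf_def count_mset_of split: if_splits)

lemma nonsqfE:
  assumes "nonsqf M"
  obtains i M' where "M = add_mset i (add_mset i M')"
proof -
  obtain i where i: "2 \<le> count M i" using assms by (auto simp: nonsqf_def)
  then have "replicate_mset 2 i \<subseteq># M" by (simp add: count_le_replicate_mset_subset_eq)
  then obtain M' where "M = replicate_mset 2 i + M'" by (metis subset_mset.le_iff_add)
  then show ?thesis using that by (simp add: numeral_2_eq_2)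
qed

lemma coef_nonsqf: "nonsqf M \<Longrightarrow> finite K \<Longrightarrow> coef M (mset_of K) = 0"
  by (elim nonsqfE) (simp add: coef_double_set)

text \<open>Intermediate monomials whose contributions do not cancel. Those divisible by
  \<open>e_m\<close> are left out, since they belong to the next stage of the family.\<close>

definition bad :: "nat \<Rightarrow> nat \<Rightarrow> nat multiset set" where
  "bad m n = {M \<in> msets m n. m \<notin># M \<and> nonsqf M}"

lemma finite_bad [simp]: "finite (bad m n)"
  by (simp add: bad_def)

text \<open>
  The family \<open>K \<mapsto> cochain S T m K\<close> is a cochain with values in the span of the square-free
  monomials \<open>e\<^sub>K\<close>, \<open>K \<subseteq> {..<m}\<close>.  It would be a cocycle if squares \<open>e\<^sub>i\<^sup>2\<close> with \<open>i < m\<close> could be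
  ignored; \<open>cochain_err\<close> is the failure.
\<close>

primrec cochain :: "nat set \<Rightarrow> nat set \<Rightarrow> nat \<Rightarrow> nat set \<Rightarrow> cobar" where
  "cochain S T 0 K = (if K = {} then basis [] else 0)"
| "cochain S T (Suc m) K =
    (if m \<in> S then (if m \<in> K then cochain S T m (K - {m}) else 0)
     else if m \<in> T then (\<Sum>J\<in>Pow {..<m}. prepend (coef (mset_of J) (add_mset m (mset_of K))) (cochain S T m J))
     else cochain S T m K)"

primrec cochain_err :: "nat set \<Rightarrow> nat set \<Rightarrow> nat \<Rightarrow> nat set \<Rightarrow> cobar" where
  "cochain_err S T 0 K = 0"
| "cochain_err S T (Suc m) K =
    (if m \<in> S then (if m \<in> K then cochain_err S T m (K - {m}) else 0)
     else if m \<in> T then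
       (\<Sum>J\<in>Pow {..<m}. prepend (coef (mset_of J) (add_mset m (mset_of K))) (cochain_err S T m J)) +
       (\<Sum>M\<in>bad m (Suc (card K)). prepend (coef M (add_mset m (mset_of K)))
         (\<Sum>J\<in>Pow {..<m}. prepend (coef (mset_of J) M) (cochain S T m J)))
     else cochain_err S T m K)"

text \<open>The intermediate monomials \<open>mset_of J\<close> and \<open>L\<close> have a diagonal
  coefficient 1, hence give precisely the two primitive terms that the reduced coproduct
  omits.\<close>

lemma psi_red_coef:
  assumes "J \<subseteq> {..<m}" "K \<subseteq> {..m}"
  defines "L \<equiv> add_mset m (mset_of K)" and "n \<equiv> Suc (card K)"
  shows "psi_red (coef (mset_of J) L) = (\<Sum>M\<in>msets m n - {mset_of J, L}. tensor (coef M L) (coef (mset_of J) M))"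
proof -
  have fin: "finite J" "finite K" using assms(1,2) finite_subset by blast+
  have L: "set_mset L \<subseteq> {..m}" "L \<in> msets m n" using assms(2) fin by (auto simp: L_def n_def msets_def)
  have neq: "mset_of J \<noteq> L"
  proof
    assume "mset_of J = L"
    then have "m \<in># mset_of J" by (simp add: L_def)
    then show False using assms(1) fin by auto
  qed
  show ?thesis
  proof (cases "card J = n")
    case True
    then have J: "mset_of J \<in> msets m n" using assms(1) fin by (auto simp: msets_def)
    have "psi (coef (mset_of J) L) = (\<Sum>M\<in>msets m n. tensor (coef M L) (coef (mset_of J) M))"
      using psi_coef[OF L(1), of "mset_of J"] True by simp
    also have "\<dots> = tensor (coef (mset_of J) L) 1 + (tensor 1 (coef (mset_of J) L)
        + (\<Sum>M\<in>msets m n - {mset_of J} - {L}. tensor (coef M L) (coef (mset_of J) M)))"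
      using J L(2) neq by (simp add: sum.remove[of _ "mset_of J"] sum.remove[of _ L])
    finally show ?thesis by (simp add: psi_red_eq add_ac Diff_insert2[symmetric] insert_commute)
  next
    \<comment> \<open>In unequal degrees every coefficient starting from \<open>mset_of J\<close> is
      zero, so both sides vanish.\<close>
    case False
    then have "coef (mset_of J) M = 0" if "M \<in> msets m n" for M
      using that by (intro coef_size) (simp add: msets_def)
    then show ?thesis using L(2) by simp
  qed
qed

text \<open>Square-free monomials without \<open>e_m\<close> are subsets of \<open>{..<m}\<close>.
  Subsets of the wrong size may be included because their terms vanish, which gets rid of the degree
  condition.\<close>

lemma sum_sqf:
  assumes "\<And>J. J \<subseteq> {..<m} \<Longrightarrow> card J \<noteq> n \<Longrightarrow> g (mset_of J) = 0" "J \<subseteq> {..<m}"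
  shows "(\<Sum>M\<in>{M \<in> msets m n. m \<notin># M \<and> \<not> nonsqf M} - {mset_of J}. g M) = (\<Sum>J'\<in>Pow {..<m} - {J}. g (mset_of J'))"
proof -
  let ?A = "{M \<in> msets m n. m \<notin># M \<and> \<not> nonsqf M} - {mset_of J}"
  have fin: "finite J'" if "J' \<in> Pow {..<m}" for J' :: "nat set"
    using that finite_subset by blast
  have inj: "inj_on mset_of (Pow {..<m})"
    by (rule inj_onI) (use fin finite_set_mset_mset_set in metis)
  have "(\<Sum>J'\<in>Pow {..<m} - {J}. g (mset_of J')) = (\<Sum>M\<in>mset_of ` (Pow {..<m} - {J}). g M)"
    using inj_on_subset[OF inj] by (subst sum.reindex) auto
  also have "\<dots> = (\<Sum>M\<in>?A. g M)"
  proof (rule sum.mono_neutral_cong)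
    fix M assume M: "M \<in> ?A - mset_of ` (Pow {..<m} - {J})"
    then have "mset_of (set_mset M) = M" by (intro sqf_mset_of) simp
    moreover have "set_mset M \<subseteq> {..<m}" using M by (auto simp: msets_def less_le)
    ultimately have "M \<in> mset_of ` (Pow {..<m} - {J})"
      using M by (intro image_eqI[of _ _ "set_mset M"]) auto
    then show "g M = 0" using M by simp
  next
    fix M assume M: "M \<in> mset_of ` (Pow {..<m} - {J}) - ?A"
    then obtain J' where J': "M = mset_of J'" "J' \<subseteq> {..<m}" "J' \<noteq> J" by blast
    have f: "finite J'" using J'(2) finite_subset by blast
    have "card J' \<noteq> n"
    proof
      assume "card J' = n"
      then have "M \<in> msets m n" "m \<notin># M" "\<not> nonsqf M"
        using J' f by (auto simp: msets_def not_nonsqf_mset_of)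
      then have "mset_of J' = mset_of J" using M J'(1) by auto
      then show False using inj_onD[OF inj] J' assms(2) by blast
    qed
    then show "g M = 0" using assms J' by simp
  qed simp_all
  finally show ?thesis by simp
qed

text \<open>Monomials divisible by \<open>e_m\<close> are \<open>e_m e_Q\<close>, where
  \<open>Q\<close> may itself contain \<open>m\<close>; cofactors with a square give
  nothing.\<close>

lemma sum_top:
  assumes "\<And>Q. Q \<subseteq> {..m} \<Longrightarrow> card Q \<noteq> n \<Longrightarrow> g (add_mset m (mset_of Q)) = 0"
    and "\<And>M. nonsqf M \<Longrightarrow> g (add_mset m M) = 0" "K \<subseteq> {..m}"
  shows "(\<Sum>M\<in>{M \<in> msets m (Suc n). m \<in># M} - {add_mset m (mset_of K)}. g M) =
    (\<Sum>Q\<in>Pow {..m} - {K}. g (add_mset m (mset_of Q)))"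
proof -
  let ?A = "{M \<in> msets m (Suc n). m \<in># M} - {add_mset m (mset_of K)}"
  let ?h = "\<lambda>Q. add_mset m (mset_of Q)"
  have fin: "finite Q" if "Q \<in> Pow {..m}" for Q
    using that finite_subset by blast
  have inj: "inj_on ?h (Pow {..m})"
    by (rule inj_onI) (metis add_mset_add_mset_same_iff fin finite_set_mset_mset_set)
  have "(\<Sum>Q\<in>Pow {..m} - {K}. g (?h Q)) = (\<Sum>M\<in>?h ` (Pow {..m} - {K}). g M)"
    using inj_on_subset[OF inj] by (subst sum.reindex) auto
  also have "\<dots> = (\<Sum>M\<in>?A. g M)"
  proof (rule sum.mono_neutral_cong)
    fix M assume M: "M \<in> ?A - ?h ` (Pow {..m} - {K})"
    then obtain M' where M': "M = add_mset m M'" by (auto dest: multi_member_split)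
    show "g M = 0"
    proof (cases "nonsqf M'")
      case False
      then have "mset_of (set_mset M') = M'" by (rule sqf_mset_of)
      moreover have "set_mset M' \<subseteq> {..m}" using M M' by (auto simp: msets_def)
      ultimately have "M \<in> ?h ` (Pow {..m} - {K})"
        using M M' by (intro image_eqI[of _ _ "set_mset M'"]) auto
      then show "g M = 0" using M by simp
    qed (simp add: M' assms(2))
  next
    fix M assume M: "M \<in> ?h ` (Pow {..m} - {K}) - ?A"
    then obtain Q where Q: "M = ?h Q" "Q \<subseteq> {..m}" "Q \<noteq> K" by blast
    have f: "finite Q" using Q(2) finite_subset by blast
    have "card Q \<noteq> n"
    proof
      assume "card Q = n"
      then have "M \<in> msets m (Suc n)" "m \<in># M" using Q f by (auto simp: msets_def)
      then have "?h Q = ?h K" using M Q(1) by auto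
      then show False using inj_onD[OF inj] Q assms(3) by blast
    qed
    then show "g M = 0" using assms Q by simp
  qed simp_all
  finally show ?thesis by simp
qed

text \<open>These conditions survive the exchange of \<open>s\<close> in \<open>S\<close> with
  \<open>s + 1\<close> in \<open>T\<close>, so the results below also apply to the pairs on the
  right hand side of the theorem.\<close>

locale split_interval =
  fixes S T :: "nat set" and a b :: nat
  assumes disjoint: "S \<inter> T = {}" and union: "S \<union> T = {a..<b}"
begin

lemma cochain_below: "m \<le> a \<Longrightarrow> cochain S T m K = (if K = {} then basis [] else 0)"
proof (induction m)
  case (Suc m)
  then have "m \<notin> S \<union> T" unfolding union by simp
  then show ?case using Suc by simp
qed simp

lemma cochain_err_below: "m \<le> a \<Longrightarrow> cochain_err S T m K = 0"
proof (induction m)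
  case (Suc m)
  then have "m \<notin> S \<union> T" unfolding union by simp
  then show ?case using Suc by simp
qed simp

text \<open>A twisted cocycle condition up to \<open>cochain_err\<close>. An index in
  \<open>S\<close> preserves it because \<open>e_m\<close> can only go to itself below
  \<open>m + 1\<close>. For an index in \<open>T\<close> the coproduct of a coefficient is sorted by
  its intermediate monomial.\<close>

lemma cobar_d_cochain:
  assumes "a \<le> m" "m \<le> b" "K \<subseteq> {..<m}"
  shows "cobar_d (cochain S T m K) =
    (\<Sum>J\<in>Pow {..<m} - {K}. prepend (coef (mset_of J) (mset_of K)) (cochain S T m J)) + cochain_err S T m K"
  using assms
proof (induction m arbitrary: K rule: nat_induct_at_least)
  case base
  have "prepend (coef (mset_of J) (mset_of K)) (cochain S T a J) = 0" if "J \<in> Pow {..<a} - {K}" for J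
  proof (cases "J = {}")
    case True
    then have "K \<noteq> {}" using that by auto
    moreover have "finite K" using base(2) finite_subset by blast
    ultimately have "coef (mset_of J) (mset_of K) = 0" using True by (intro coef_size) auto
    then show ?thesis by simp
  qed (simp add: cochain_below)
  then show ?case by (simp add: cochain_below cochain_err_below cobar_d_eq_lin)
next
  case (Suc m)
  have fin: "finite K" using Suc(4) finite_subset by blast
  have Km: "K \<subseteq> {..m}" using Suc(4) by auto
  have IH: "cobar_d (cochain S T m K) =
    (\<Sum>J\<in>Pow {..<m} - {K}. prepend (coef (mset_of J) (mset_of K)) (cochain S T m J)) + cochain_err S T m K"
    if "K \<subseteq> {..<m}" for K
    using Suc that by simp
  have "m \<in> S \<union> T" unfolding union using Suc by simp
  then consider "m \<in> S" "m \<notin> T" | "m \<notin> S" "m \<in> T" using disjoint by blast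
  then show ?case
  proof cases
    case 1
    have inj: "inj_on (insert m) (Pow {..<m} - {K - {m}})"
      by (rule inj_onI) auto
    have "(\<Sum>J\<in>Pow {..<Suc m} - {K}. prepend (coef (mset_of J) (mset_of K)) (cochain S T (Suc m) J)) =
      (if m \<in> K then \<Sum>J\<in>Pow {..<m} - {K - {m}}. prepend (coef (mset_of J) (mset_of (K - {m}))) (cochain S T m J) else 0)"
    proof (cases "m \<in> K")
      case True
      have "(\<Sum>J\<in>Pow {..<Suc m} - {K}. prepend (coef (mset_of J) (mset_of K)) (cochain S T (Suc m) J)) =
        (\<Sum>J\<in>insert m ` (Pow {..<m} - {K - {m}}). prepend (coef (mset_of J) (mset_of K)) (cochain S T (Suc m) J))"
      proof (rule sum.mono_neutral_right)
        show "insert m ` (Pow {..<m} - {K - {m}}) \<subseteq> Pow {..<Suc m} - {K}"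
          using True by (auto simp: less_Suc_eq)
        show "\<forall>J\<in>Pow {..<Suc m} - {K} - insert m ` (Pow {..<m} - {K - {m}}).
            prepend (coef (mset_of J) (mset_of K)) (cochain S T (Suc m) J) = 0"
        proof
          fix J assume J: "J \<in> Pow {..<Suc m} - {K} - insert m ` (Pow {..<m} - {K - {m}})"
          have "m \<notin> J"
          proof
            assume m: "m \<in> J"
            have "J \<subseteq> {..<Suc m}" "J \<noteq> K" using J by blast+
            then have "J - {m} \<subseteq> {..<m}" "J - {m} \<noteq> K - {m}"
              using m True insert_Diff[of m J] insert_Diff[of m K] by (auto simp: less_Suc_eq)
            then have "insert m (J - {m}) \<in> insert m ` (Pow {..<m} - {K - {m}})" by blast
            then show False using J insert_Diff[OF m] by simp
          qed
          then show "prepend (coef (mset_of J) (mset_of K)) (cochain S T (Suc m) J) = 0" using 1 by simp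
        qed
      qed simp
      also have "\<dots> = (\<Sum>J\<in>Pow {..<m} - {K - {m}}. prepend (coef (mset_of J) (mset_of (K - {m}))) (cochain S T m J))"
        unfolding sum.reindex[OF inj] o_def
      proof (rule sum.cong[OF refl])
        fix J assume "J \<in> Pow {..<m} - {K - {m}}"
        then have J: "J \<subseteq> {..<m}" "finite J" "m \<notin> J" using finite_subset by auto
        have "mset_of K = add_mset m (mset_of (K - {m}))" using True fin by (simp add: mset_set.remove)
        moreover have "set_mset (mset_of (K - {m})) \<subseteq> {..m}" using Km fin by auto
        ultimately show "prepend (coef (mset_of (insert m J)) (mset_of K)) (cochain S T (Suc m) (insert m J)) =
            prepend (coef (mset_of J) (mset_of (K - {m}))) (cochain S T m J)"
          using 1 J by (simp add: coef_top)
      qed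
      finally show ?thesis using True by simp
    next
      case False
      then have K: "set_mset (mset_of K) \<subseteq> {..<m}" using Km fin by (auto simp: less_le)
      have "prepend (coef (mset_of J) (mset_of K)) (cochain S T (Suc m) J) = 0" if "J \<in> Pow {..<Suc m} - {K}" for J
      proof (cases "m \<in> J")
        case True
        have "finite J" using that finite_subset by blast
        then have "mset_of J = add_mset m (mset_of (J - {m}))" using True by (simp add: mset_set.remove)
        then show ?thesis using coef_top_0[OF K] by simp
      qed (use 1 in simp)
      then show ?thesis using False by simp
    qed
    moreover have "K - {m} \<subseteq> {..<m}" using Km by (auto simp: le_less)
    ultimately show ?thesis using 1 IH[of "K - {m}"] by simp
  next
    case 2
    let ?L = "add_mset m (mset_of K)" and ?n = "Suc (card K)" and ?f = "cochain S T m"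
    let ?P = "\<lambda>M J. prepend (coef M ?L) (prepend (coef (mset_of J) M) (?f J))"
    have sz: "coef (mset_of J) ?L = 0" if "J \<subseteq> {..<m}" "card J \<noteq> ?n" for J
      using that finite_subset[of J "{..<m}"] fin by (intro coef_size) simp
    \<comment> \<open>The sums come from square-free intermediate monomials without
      \<open>e_m\<close>, from those divisible by \<open>e_m\<close>, from those in
      \<open>bad\<close>, from the coboundary of the earlier family, and from its failure.\<close>
    have each: "cobar_d (prepend (coef (mset_of J) ?L) (?f J)) =
        (\<Sum>J'\<in>Pow {..<m} - {J}. ?P (mset_of J') J)
        + (\<Sum>Q\<in>Pow {..m} - {K}. prepend (coef (mset_of Q) (mset_of K)) (prepend (coef (mset_of J) (add_mset m (mset_of Q))) (?f J)))
        + (\<Sum>M\<in>bad m ?n. ?P M J)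
        + (\<Sum>J'\<in>Pow {..<m} - {J}. prepend (coef (mset_of J) ?L) (prepend (coef (mset_of J') (mset_of J)) (?f J')))
        + prepend (coef (mset_of J) ?L) (cochain_err S T m J)" if J: "J \<subseteq> {..<m}" for J
    proof -
      let ?A = "{M \<in> msets m ?n. m \<notin># M \<and> \<not> nonsqf M} - {mset_of J}"
      let ?B = "{M \<in> msets m ?n. m \<in># M} - {?L}"
      have fJ: "finite J" using J finite_subset by blast
      have mJ: "m \<notin># mset_of J" using J fJ by auto
      have split: "msets m ?n - {mset_of J, ?L} = ?A \<union> ?B \<union> bad m ?n"
        using mJ not_nonsqf_mset_of[OF fJ] by (auto simp: bad_def)
      have "prepend2 (psi_red (coef (mset_of J) ?L)) (?f J) = (\<Sum>M\<in>msets m ?n - {mset_of J, ?L}. ?P M J)"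
        unfolding psi_red_coef[OF J Km] by (simp add: prepend2_sum prepend2_tensor)
      also have "\<dots> = (\<Sum>M\<in>?A. ?P M J) + (\<Sum>M\<in>?B. ?P M J) + (\<Sum>M\<in>bad m ?n. ?P M J)"
        unfolding split by (subst sum.union_disjoint; (subst sum.union_disjoint)?)
          (auto simp: bad_def)
      also have "(\<Sum>M\<in>?A. ?P M J) = (\<Sum>J'\<in>Pow {..<m} - {J}. ?P (mset_of J') J)"
        using sz J by (intro sum_sqf) simp_all
      also have "(\<Sum>M\<in>?B. ?P M J) = (\<Sum>Q\<in>Pow {..m} - {K}. ?P (add_mset m (mset_of Q)) J)"
      proof (rule sum_top[OF _ _ Km])
        show "?P (add_mset m (mset_of Q)) J = 0" if "Q \<subseteq> {..m}" "card Q \<noteq> card K" for Q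
        proof -
          have "coef (add_mset m (mset_of Q)) ?L = 0"
            using that finite_subset[of Q "{..m}"] fin by (intro coef_size) simp
          then show ?thesis by simp
        qed
        show "?P (add_mset m M) J = 0" if "nonsqf M" for M
          using coef_nonsqf[OF that fin] Km fin by (simp add: coef_top)
      qed
      also have "\<dots> = (\<Sum>Q\<in>Pow {..m} - {K}. prepend (coef (mset_of Q) (mset_of K)) (prepend (coef (mset_of J) (add_mset m (mset_of Q))) (?f J)))"
        using Km fin by (simp add: coef_top)
      finally show ?thesis
        by (simp add: cobar_d_prepend IH[OF J] prepend_add prepend_sum add_ac)
    qed
    have "cobar_d (cochain S T (Suc m) K) = (\<Sum>J\<in>Pow {..<m}. cobar_d (prepend (coef (mset_of J) ?L) (?f J)))"
      using 2 by (simp add: cobar_d_sum)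
    also have "\<dots> = (\<Sum>J\<in>Pow {..<m}. \<Sum>J'\<in>Pow {..<m} - {J}. ?P (mset_of J') J)
        + (\<Sum>J\<in>Pow {..<m}. \<Sum>Q\<in>Pow {..m} - {K}. prepend (coef (mset_of Q) (mset_of K)) (prepend (coef (mset_of J) (add_mset m (mset_of Q))) (?f J)))
        + (\<Sum>J\<in>Pow {..<m}. \<Sum>M\<in>bad m ?n. ?P M J)
        + (\<Sum>J\<in>Pow {..<m}. \<Sum>J'\<in>Pow {..<m} - {J}. prepend (coef (mset_of J) ?L) (prepend (coef (mset_of J') (mset_of J)) (?f J')))
        + (\<Sum>J\<in>Pow {..<m}. prepend (coef (mset_of J) ?L) (cochain_err S T m J))"
      by (simp add: each sum.distrib)
    \<comment> \<open>With \<open>J\<close> and \<open>J'\<close> renamed this equals the fourth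
      sum, so the two cancel; this is where coassociativity pays off.\<close>
    also have "(\<Sum>J\<in>Pow {..<m}. \<Sum>J'\<in>Pow {..<m} - {J}. ?P (mset_of J') J) =
        (\<Sum>J\<in>Pow {..<m}. \<Sum>J'\<in>Pow {..<m} - {J}. prepend (coef (mset_of J) ?L) (prepend (coef (mset_of J') (mset_of J)) (?f J')))"
      by (subst (1 2) sum.Sigma)
        (auto intro!: sum.reindex_bij_witness[of _ "\<lambda>(x, y). (y, x)" "\<lambda>(x, y). (y, x)"] finite_subset)
    also have "(\<Sum>J\<in>Pow {..<m}. \<Sum>Q\<in>Pow {..m} - {K}. prepend (coef (mset_of Q) (mset_of K)) (prepend (coef (mset_of J) (add_mset m (mset_of Q))) (?f J)))
        = (\<Sum>Q\<in>Pow {..<Suc m} - {K}. prepend (coef (mset_of Q) (mset_of K)) (cochain S T (Suc m) Q))"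
      using 2 by (subst sum.swap) (simp add: prepend_sum lessThan_Suc_atMost)
    also have "(\<Sum>J\<in>Pow {..<m}. \<Sum>M\<in>bad m ?n. ?P M J) = (\<Sum>M\<in>bad m ?n. prepend (coef M ?L) (\<Sum>J\<in>Pow {..<m}. prepend (coef (mset_of J) M) (?f J)))"
      by (subst sum.swap) (simp add: prepend_sum)
    finally show ?thesis using 2 by (simp add: add_ac)
  qed
qed

end

section \<open>Leading terms\<close>

text \<open>
  The linear part of \<open>coef J M\<close> in the variables \<open>R\<^sub>i\<^sub>j\<close>.  On a singleton, \<open>\<Sum>\<^sub>#\<close> returns its element.
\<close>

definition lead_coef :: "nat multiset \<Rightarrow> nat multiset \<Rightarrow> X" where
  "lead_coef J M = (if size (J - M) = 1 \<and> size (M - J) = 1 then R (\<Sum>\<^sub># (J - M)) (\<Sum>\<^sub># (M - J)) else 0)"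

lemma lead_coef_add: "i \<noteq> j \<Longrightarrow> lead_coef (add_mset j C) (add_mset i C) = R j i"
proof -
  assume "i \<noteq> j"
  then have "add_mset j C - add_mset i C = {#j#}" "add_mset i C - add_mset j C = {#i#}"
    by (auto intro!: multiset_eqI)
  then show ?thesis by (simp add: lead_coef_def)
qed

text \<open>Cancelling the common part leaves monomials \<open>A\<close> and \<open>B\<close>.
  Unequal degrees give zero, one differing index gives the second case, and two or more cost a
  second unit of weight.\<close>

lemma coef_lead_coef_cases:
  assumes "finite J" "mset_of J \<noteq> M"
  obtains "lead_coef (mset_of J) M = 0" "coef (mset_of J) M \<in> FA (2 * (isum M - isum (mset_of J)) - 2)"
  | C j i where "mset_of J = add_mset j C" "M = add_mset i C" "i \<noteq> j" "j \<notin># C"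
proof -
  define C A B where "C = mset_of J \<inter># M" and "A = mset_of J - M" and "B = M - mset_of J"
  have JM: "mset_of J = A + C" "M = B + C"
    by (auto simp: A_def B_def C_def intro!: multiset_eqI)
  have lead_coef: "lead_coef (mset_of J) M = (if size A = 1 \<and> size B = 1 then R (\<Sum>\<^sub># A) (\<Sum>\<^sub># B) else 0)"
    by (simp add: lead_coef_def A_def B_def)
  show ?thesis
  proof (cases "size (mset_of J) = size M")
    case False
    then have "coef (mset_of J) M = 0" by (rule coef_size)
    moreover have "size A \<noteq> size B" using False JM by (metis size_union)
    then have "lead_coef (mset_of J) M = 0" unfolding lead_coef by auto
    ultimately show ?thesis using that(1) by simp
  next
    case True
    then have sz: "size A = size B" using JM by (metis add_right_cancel size_union)
    have "A \<noteq> {#}"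
    proof
      assume "A = {#}"
      then show False using sz JM assms(2) by simp
    qed
    then consider "size A = 1" | "2 \<le> size A"
      by (metis One_nat_def Suc_leI le_neq_implies_less nonempty_has_size numeral_2_eq_2)
    then show ?thesis
    proof cases
      case 1
      then obtain j i where ji: "A = {#j#}" "B = {#i#}" using sz by (metis size_1_singleton_mset)
      have "i \<noteq> j" using ji JM assms(2) by auto
      moreover have "j \<notin># C"
      proof
        assume "j \<in># C"
        then have "2 \<le> count (mset_of J) j" using JM(1) ji by (simp add: Suc_le_eq)
        then show False using not_nonsqf_mset_of[OF assms(1)] by (auto simp: nonsqf_def)
      qed
      ultimately show ?thesis using that(2)[of j C i] JM ji by simp
    next
      case 2
      then have "lead_coef (mset_of J) M = 0" by (simp add: lead_coef)
      moreover have "coef (mset_of J) M \<in> FA (2 * (isum M - isum (mset_of J)) - 2)"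
        using wfilt_mono[OF coef_FA[of "mset_of J" M]] 2 by (simp add: A_def)
      ultimately show ?thesis using that(1) by simp
    qed
  qed
qed

text \<open>Only the linear part of a coefficient reaches the top weight, which is one less than
  twice the growth of the index sum. If the index would have to move downwards,
  \<open>xij j i\<close> and \<open>R j i\<close> are both zero.\<close>

lemma represents_coef:
  assumes "represents p y z" "finite J" "mset_of J \<noteq> M"
  shows "represents (p + 2 * (isum M - isum (mset_of J)) - 1) (prepend (coef (mset_of J) M) y) (lead_coef (mset_of J) M * z)"
  using assms(2,3)
proof (cases rule: coef_lead_coef_cases)
  case 1
  have "prepend (coef (mset_of J) M) y \<in> cobar_F (p + 2 * (isum M - isum (mset_of J)) - 1 - 1)"
    using prepend_F[OF reduced_coef[OF assms(3)] 1(2) represents_F[OF assms(1)]] by (simp add: algebra_simps)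
  from represents_low[OF this] show ?thesis by (simp add: 1(1))
next
  case (2 C j i)
  let ?q = "p + 2 * (isum M - isum (mset_of J)) - 1"
  define low where "low = coef (mset_of J) M + xij j i"
  have "low \<in> FA (2 * (int i - int j) - 2)"
    unfolding low_def 2(1,2) using 2(3,4) by (intro coef_single)
  moreover have "reduced low"
    unfolding low_def using reduced_coef[OF assms(3)] reduced_xij_neq 2(3) by (intro reduced_add) auto
  ultimately have "prepend low y \<in> cobar_F (2 * (int i - int j) - 2 + p)"
    using represents_F[OF assms(1)] by (intro prepend_F)
  then have "prepend low y \<in> cobar_F (?q - 1)" using 2(1,2) by (simp add: algebra_simps)
  then have "represents ?q (prepend low y) 0" by (rule represents_low)
  moreover have "represents ?q (prepend (xij j i) y) (R j i * z)"
  proof (cases "j < i")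
    case True
    then show ?thesis using represents_prepend[OF True assms(1)] 2(1,2) by (simp add: algebra_simps)
  next
    case False
    then show ?thesis using 2(3) by (simp add: R_def)
  qed
  moreover have "coef (mset_of J) M = low + xij j i" by (simp add: low_def add.assoc)
  moreover have "lead_coef (mset_of J) M = R j i" using 2 by (simp add: lead_coef_add)
  ultimately show ?thesis using represents_add[of ?q "prepend low y" 0] by (simp add: prepend_add)
qed

text \<open>A square-free monomial differs from one containing a cube in at least two
  places.\<close>

lemma lead_coef_triple:
  assumes "finite J" "3 \<le> count M i"
  shows "lead_coef (mset_of J) M = 0"
proof -
  have "count (mset_of J) i \<le> 1" using assms(1) by (simp add: count_mset_of)
  then have "2 \<le> count (M - mset_of J) i" using assms(2) by simp
  then have "2 \<le> size (M - mset_of J)" using count_le_size[of "M - mset_of J" i] by linarith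
  then show ?thesis by (simp add: lead_coef_def)
qed

text \<open>With one index to move, \<open>J\<close> must contain all of \<open>C\<close>, and its
  remaining element \<open>j\<close> goes to \<open>i\<close>. The case \<open>i = m\<close> is an
  ordinary step of the construction; the case of \<open>i\<close> in \<open>C\<close> treats the
  monomials with a square.\<close>

lemma lead_coef_sum:
  assumes "i \<in> C \<or> m \<le> i" "finite C"
  shows "(\<Sum>J\<in>Pow {..<m}. lead_coef (mset_of J) (add_mset i (mset_of C)) * g J) =
    (if C \<subseteq> {..<m} then \<Sum>j\<in>{..<m} - C. R j i * g (insert j C) else 0)"
proof -
  let ?M = "add_mset i (mset_of C)"
  have ins: "C \<subseteq> {..<m} \<and> (\<exists>j\<in>{..<m} - C. J = insert j C)"
    if J: "J \<subseteq> {..<m}" and nz: "lead_coef (mset_of J) ?M \<noteq> 0" for J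
  proof -
    have fJ: "finite J" using J finite_subset by blast
    have sz: "size (mset_of J - ?M) = 1" "size (?M - mset_of J) = 1"
      using nz by (auto simp: lead_coef_def split: if_splits)
    obtain j where j: "mset_of J - ?M = {#j#}" using sz(1) by (metis size_1_singleton_mset)
    have "count (mset_of J) i < count ?M i"
      using assms J fJ by (cases "i \<in> C") (auto simp: count_mset_of)
    then have "i \<in># ?M - mset_of J" by (simp add: in_diff_count)
    then have B: "?M - mset_of J = {#i#}" using sz(2) by (metis size_1_singleton_mset set_mset_single singletonD)
    have C: "c \<in> J" if "c \<in> C" for c
    proof (rule ccontr)
      assume "c \<notin> J"
      then have "count (?M - mset_of J) c = (if c = i then 2 else 1)" using that assms(2) fJ by (cases "c = i") (simp_all add: count_mset_of)
      then show False unfolding B by (auto split: if_splits)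
    qed
    have X: "x = j" if "x \<in> J" "x \<notin> C" for x
    proof -
      have "x \<noteq> i" using that J assms(1) by auto
      then have "count (mset_of J - ?M) x = 1" using that assms(2) fJ by (simp add: count_mset_of)
      then show ?thesis unfolding j by (auto split: if_splits)
    qed
    have "j \<in># mset_of J - ?M" using j by simp
    then have "count ?M j < count (mset_of J) j" by (simp only: in_diff_count)
    then have jJ: "j \<in> J" "j \<notin> C"
      using fJ assms(2) by (auto simp: count_mset_of split: if_splits)
    have "J = insert j C" using C X jJ by blast
    then show ?thesis using J jJ by blast
  qed
  show ?thesis
  proof (cases "C \<subseteq> {..<m}")
    case False
    then have "lead_coef (mset_of J) ?M = 0" if "J \<in> Pow {..<m}" for J using ins[of J] that by blast
    then show ?thesis using False by simp
  next
    case True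
    have inj: "inj_on (\<lambda>j. insert j C) ({..<m} - C)" by (rule inj_onI) blast
    have "(\<Sum>J\<in>Pow {..<m}. lead_coef (mset_of J) ?M * g J) = (\<Sum>J\<in>(\<lambda>j. insert j C) ` ({..<m} - C). lead_coef (mset_of J) ?M * g J)"
    proof (rule sum.mono_neutral_right)
      show "\<forall>J\<in>Pow {..<m} - (\<lambda>j. insert j C) ` ({..<m} - C). lead_coef (mset_of J) ?M * g J = 0"
      proof
        fix J assume J: "J \<in> Pow {..<m} - (\<lambda>j. insert j C) ` ({..<m} - C)"
        then have "lead_coef (mset_of J) ?M = 0" using ins[of J] by blast
        then show "lead_coef (mset_of J) ?M * g J = 0" by simp
      qed
    qed (use True in auto)
    also have "\<dots> = (\<Sum>j\<in>{..<m} - C. R j i * g (insert j C))"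
      unfolding sum.reindex[OF inj] o_def
    proof (rule sum.cong[OF refl])
      fix j assume j: "j \<in> {..<m} - C"
      then have "i \<noteq> j" using assms(1) by auto
      then show "lead_coef (mset_of (insert j C)) ?M * g (insert j C) = R j i * g (insert j C)"
        using j assms(2) by (simp add: lead_coef_add)
    qed
    finally show ?thesis using True by simp
  qed
qed

text \<open>
  \<open>minor S T m K\<close> is the determinant of \<open>R\<close> with rows \<open>S \<inter> {..<m} - K\<close> and columns
  \<open>T \<inter> {..<m}\<close>, and \<open>0\<close> if this matrix is not square or \<open>K\<close> is not contained in \<open>S \<inter> {..<m}\<close>.
\<close>

primrec minor :: "nat set \<Rightarrow> nat set \<Rightarrow> nat \<Rightarrow> nat set \<Rightarrow> X" where
  "minor S T 0 K = (if K = {} then 1 else 0)"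
| "minor S T (Suc m) K =
    (if m \<in> S then (if m \<in> K then minor S T m (K - {m}) else 0)
     else if m \<in> T then (if K \<subseteq> {..<m} then \<Sum>j\<in>{..<m} - K. R j m * minor S T m (insert j K) else 0)
     else minor S T m K)"

text \<open>
  The last summand comes from the monomial \<open>e\<^sub>m\<^sub>-\<^sub>1\<^sup>2 e\<^sub>K\<^sub>-\<^sub>{\<^sub>m\<^sub>}\<close>, the only one with a square that contributes in
  filtration exactly three below the top.
\<close>

primrec minor_err :: "nat set \<Rightarrow> nat set \<Rightarrow> nat \<Rightarrow> nat set \<Rightarrow> X" where
  "minor_err S T 0 K = 0"
| "minor_err S T (Suc m) K =
    (if m \<in> S then (if m \<in> K then minor_err S T m (K - {m}) else 0)
     else if m \<in> T then
       (if K \<subseteq> {..<m} then \<Sum>j\<in>{..<m} - K. R j m * minor_err S T m (insert j K) else 0) +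
       (if m \<in> K \<and> 0 < m \<and> m - 1 \<notin> K then R m (m + 1) *
         (\<Sum>j\<in>{..<m} - insert (m - 1) (K - {m}).
            R j (m - 1) * minor S T m (insert j (insert (m - 1) (K - {m})))) else 0)
     else minor_err S T m K)"

text \<open>The weight of \<open>minor S T m K\<close>: each entry \<open>R s t\<close> weighs
  \<open>2 * (t - s) - 1\<close>, and the rows in \<open>K\<close> are missing.\<close>

definition mweight :: "nat set \<Rightarrow> nat set \<Rightarrow> nat \<Rightarrow> nat set \<Rightarrow> int" where
  "mweight S T m K = 2 * (isum (mset_of K) + isum (mset_of (T \<inter> {..<m})) - isum (mset_of (S \<inter> {..<m})))
     - int (card (T \<inter> {..<m}))"

lemma isum_mset_of_remove: "finite K \<Longrightarrow> m \<in> K \<Longrightarrow> isum (mset_of K) = int m + isum (mset_of (K - {m}))"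
  by (simp add: mset_set.remove[of K m])

lemma Int_lessThan_Suc: "A \<inter> {..<Suc m} = (if m \<in> A then insert m (A \<inter> {..<m}) else A \<inter> {..<m})"
  by (auto simp: less_Suc_eq)

lemma mweight_S:
  assumes "m \<in> S" "m \<notin> T" "m \<in> K" "finite K"
  shows "mweight S T (Suc m) K = mweight S T m (K - {m})"
  using assms by (simp add: mweight_def Int_lessThan_Suc isum_mset_of_remove[of K m])

lemma mweight_T:
  assumes "m \<notin> S" "m \<in> T" "finite J"
  shows "mweight S T (Suc m) K = mweight S T m J + 2 * (isum (add_mset m (mset_of K)) - isum (mset_of J)) - 1"
  using assms by (simp add: mweight_def Int_lessThan_Suc)

context split_interval
begin

lemma minor_below: "m \<le> a \<Longrightarrow> minor S T m K = (if K = {} then 1 else 0)"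
proof (induction m)
  case (Suc m)
  then have "m \<notin> S \<union> T" unfolding union by simp
  then show ?case using Suc by simp
qed simp

lemma minor_err_below: "m \<le> a \<Longrightarrow> minor_err S T m K = 0"
proof (induction m)
  case (Suc m)
  then have "m \<notin> S \<union> T" unfolding union by simp
  then show ?case using Suc by simp
qed simp

lemma mweight_a: "mweight S T a {} = 0"
proof -
  have "S \<subseteq> {a..<b}" "T \<subseteq> {a..<b}" using union by blast+
  then have "S \<inter> {..<a} = {}" "T \<inter> {..<a} = {}" by auto
  then show ?thesis by (simp add: mweight_def)
qed

lemma step_cases:
  assumes "a \<le> m" "m < b"
  obtains "m \<in> S" "m \<notin> T" | "m \<notin> S" "m \<in> T"
proof -
  have "m \<in> S \<union> T" using assms unfolding union by simp
  then show ?thesis using that disjoint by blast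
qed

lemma homog_minor:
  assumes "a \<le> m" "m \<le> b" "K \<subseteq> {..<m}"
  shows "homog (mweight S T m K) (minor S T m K)"
  using assms
proof (induction m arbitrary: K rule: nat_induct_at_least)
  case base
  then show ?case using homog_1 mweight_a by (simp add: minor_below)
next
  case (Suc m)
  have fin: "finite K" using Suc(4) finite_subset by blast
  from Suc have "a \<le> m" "m < b" by simp_all
  then show ?case
  proof (cases rule: step_cases)
    case 1
    have "K - {m} \<subseteq> {..<m}" using Suc(4) by (auto simp: less_Suc_eq)
    then show ?thesis using Suc(2)[of "K - {m}"] Suc(3) mweight_S[of m S T K] fin 1 by simp
  next
    case 2
    have "homog (mweight S T (Suc m) K) (R j m * minor S T m (insert j K))" if "j \<in> {..<m} - K" "K \<subseteq> {..<m}" for j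
    proof -
      have "homog (mweight S T m (insert j K)) (minor S T m (insert j K))"
        using that Suc by (intro Suc) auto
      moreover have "mweight S T (Suc m) K = R_weight j m + mweight S T m (insert j K)"
        using mweight_T[OF 2, of "insert j K" K] that(1) fin by simp
      ultimately show ?thesis using homog_R by simp
    qed
    then show ?thesis using 2 by (auto intro!: homog_sum)
  qed
qed

text \<open>\<open>cochain\<close> and \<open>minor\<close> obey the same recursion, once each
  coefficient is replaced by its linear part; \<open>lead_coef_sum\<close> turns the sum over
  \<open>J\<close> into a column expansion.\<close>

lemma represents_cochain:
  assumes "a \<le> m" "m \<le> b" "K \<subseteq> {..<m}"
  shows "represents (mweight S T m K) (cochain S T m K) (minor S T m K)"
  using assms
proof (induction m arbitrary: K rule: nat_induct_at_least)
  case base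
  then show ?case using represents_letter_word[of "[]"] mweight_a by (simp add: minor_below cochain_below letter_word_def)
next
  case (Suc m)
  have fin: "finite K" using Suc(4) finite_subset by blast
  from Suc have "a \<le> m" "m < b" by simp_all
  then show ?case
  proof (cases rule: step_cases)
    case 1
    have "K - {m} \<subseteq> {..<m}" using Suc(4) by (auto simp: less_Suc_eq)
    then show ?thesis using Suc(2)[of "K - {m}"] Suc(3) mweight_S[of m S T K] fin 1 by simp
  next
    case 2
    let ?L = "add_mset m (mset_of K)"
    have "represents (mweight S T (Suc m) K) (prepend (coef (mset_of J) ?L) (cochain S T m J)) (lead_coef (mset_of J) ?L * minor S T m J)"
      if "J \<in> Pow {..<m}" for J
    proof -
      have fJ: "finite J" using that finite_subset by blast
      have "m \<notin># mset_of J" using that fJ by auto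
      then have "mset_of J \<noteq> ?L" by auto
      moreover have "represents (mweight S T m J) (cochain S T m J) (minor S T m J)"
        using that Suc by simp
      ultimately show ?thesis
        unfolding mweight_T[OF 2 fJ, of K] by (intro represents_coef fJ)
    qed
    then have "represents (mweight S T (Suc m) K) (\<Sum>J\<in>Pow {..<m}. prepend (coef (mset_of J) ?L) (cochain S T m J))
        (\<Sum>J\<in>Pow {..<m}. lead_coef (mset_of J) ?L * minor S T m J)"
      by (rule represents_sum)
    then show ?thesis using 2 lead_coef_sum[of m K m] fin by simp
  qed
qed

text \<open>Let \<open>e_i^2\<close> divide \<open>M\<close> with cofactor \<open>M'\<close>. The
  coefficient is zero unless \<open>m\<close> is in \<open>K\<close>, and then it is
  \<open>xij (Suc i) (Suc m)\<close> times the coefficient from \<open>M'\<close> to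
  \<open>K - {m}\<close>. The loss against the top weight is at least 2(m - i) + 1 plus the number
  of indices moved in \<open>M'\<close>, so a loss of three requires \<open>i = m - 1\<close> and
  \<open>M' = mset_of (K - {m})\<close>.\<close>

lemma represents_bad:
  assumes "m \<in> T" "m \<notin> S" "K \<subseteq> {..m}" "M \<in> bad m (Suc (card K))"
    and y: "represents (2 * (isum M + isum (mset_of (T \<inter> {..<m})) - isum (mset_of (S \<inter> {..<m}))) - int (card (T \<inter> {..<m})) - 1) y z"
  shows "represents (mweight S T (Suc m) K - 3) (prepend (coef M (add_mset m (mset_of K))) y)
    (if m \<in> K \<and> 0 < m \<and> M = add_mset (m - 1) (add_mset (m - 1) (mset_of (K - {m}))) then R m (m + 1) * z else 0)"
proof -
  have fin: "finite K" using assms(3) finite_subset by blast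
  have M: "nonsqf M" "m \<notin># M" "set_mset M \<subseteq> {..m}" "size M = Suc (card K)"
    using assms(4) by (auto simp: bad_def msets_def)
  obtain i M' where i: "M = add_mset i (add_mset i M')" using M(1) by (rule nonsqfE)
  have im: "i < m" using M(2,3) i by (auto simp: less_le)
  let ?q = "2 * (isum M + isum (mset_of (T \<inter> {..<m})) - isum (mset_of (S \<inter> {..<m}))) - int (card (T \<inter> {..<m})) - 1"
  show ?thesis
  proof (cases "m \<in> K")
    case False
    then show ?thesis using coef_double_add_set[OF fin, of i M' m] by (simp add: i)
  next
    case True
    let ?Q = "mset_of (K - {m})"
    have c: "coef M (add_mset m (mset_of K)) = xij (Suc i) (Suc m) * coef M' ?Q"
      using coef_double_add_set[OF fin, of i M' m] True by (simp add: i)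
    have e: "card K = Suc (card (K - {m}))" by (rule card.remove[OF fin True])
    have sz: "size M' = size ?Q" using M(4) fin unfolding i e by (simp del: card_Diff_singleton)
    have weight_eq: "mweight S T (Suc m) K = ?q + 2 * (isum ?Q + int m - isum M') - 4 * int i + 2 * int m"
      using assms(1,2) fin True
      by (simp add: mweight_def Int_lessThan_Suc isum_mset_of_remove[of K m] i)
    show ?thesis
    proof (cases "M' = ?Q")
      case True': True
      show ?thesis
      proof (cases "i = m - 1")
        case True'': True
        have r: "represents (R_weight m (m + 1) + ?q) (prepend (xij m (m + 1)) y) (R m (m + 1) * z)"
          by (rule represents_prepend[OF _ y]) simp
        have w: "mweight S T (Suc m) K - 3 = R_weight m (m + 1) + ?q"
          using weight_eq True'' im by (simp add: True' of_nat_diff)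
        have "Suc (m - 1) = m" using im by simp
        then have c': "coef M (add_mset m (mset_of K)) = xij m (m + 1)"
          unfolding c by (simp add: True' True'')
        have "m \<in> K \<and> 0 < m \<and> M = add_mset (m - 1) (add_mset (m - 1) ?Q)"
          using True im unfolding i True' True'' by simp
        then show ?thesis unfolding w c' using r by presburger
      next
        case False
        have neq: "M \<noteq> add_mset (m - 1) (add_mset (m - 1) ?Q)"
        proof
          assume "M = add_mset (m - 1) (add_mset (m - 1) ?Q)"
          then have "{#i, i#} = {#m - 1, m - 1#}" by (simp add: i True')
          then have "set_mset {#i, i#} = set_mset {#m - 1, m - 1#}" by simp
          then show False using False by simp
        qed
        have "prepend (xij (Suc i) (Suc m)) y \<in> cobar_F (R_weight (Suc i) (Suc m) + ?q)"
          using im by (intro prepend_F represents_F[OF y] reduced_xij xij_FA) simp_all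
        then have "prepend (xij (Suc i) (Suc m)) y \<in> cobar_F (mweight S T (Suc m) K - 3 - 1)"
          by (rule cobar_F_mono) (use weight_eq im False in \<open>simp add: True'\<close>)
        from represents_low[OF this] show ?thesis using c neq by (simp add: True')
      qed
    next
      case False
      then have neq: "M \<noteq> add_mset (m - 1) (add_mset (m - 1) ?Q)"
      proof -
        \<comment> \<open>Since \<open>K - {m}\<close> is a set, its monomial times the square of
          variable \<open>m - 1\<close> has multiplicity two or more only at
          \<open>m - 1\<close>.\<close>
        have "i = m - 1 \<or> M \<noteq> add_mset (m - 1) (add_mset (m - 1) ?Q)"
        proof (rule disjCI)
          assume "\<not> M \<noteq> add_mset (m - 1) (add_mset (m - 1) ?Q)"
          moreover have "count ?Q i \<le> 1" unfolding count_mset_of[OF finite_Diff[OF fin]] by simp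
          moreover have "2 \<le> count M i" by (simp add: i)
          ultimately show "i = m - 1" by (auto split: if_splits)
        qed
        then show ?thesis using False by (auto simp: i)
      qed
      have "0 < size (M' - ?Q)"
      proof (rule ccontr)
        assume "\<not> 0 < size (M' - ?Q)"
        then have "M' \<subseteq># ?Q" by (simp add: Diff_eq_empty_iff_mset)
        then show False using sz False by (metis mset_subset_size nless_le subset_mset.nless_le)
      qed
      then have "coef M' ?Q \<in> FA (2 * (isum ?Q - isum M') - 1)"
        by (intro wfilt_mono[OF coef_FA]) simp
      then have "coef M (add_mset m (mset_of K)) \<in> FA (R_weight (Suc i) (Suc m) + (2 * (isum ?Q - isum M') - 1))"
        unfolding c using im by (intro FA_mult xij_FA) simp_all
      moreover have "reduced (coef M (add_mset m (mset_of K)))"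
        unfolding c using im by (intro reduced_mult reduced_xij) simp
      ultimately have "prepend (coef M (add_mset m (mset_of K))) y \<in>
          cobar_F (R_weight (Suc i) (Suc m) + (2 * (isum ?Q - isum M') - 1) + ?q)"
        by (intro prepend_F represents_F[OF y])
      then have "prepend (coef M (add_mset m (mset_of K))) y \<in> cobar_F (mweight S T (Suc m) K - 3 - 1)"
        by (rule cobar_F_mono) (use weight_eq im in simp)
      from represents_low[OF this] show ?thesis using neq by simp
    qed
  qed
qed

lemma represents_cochain_err:
  assumes "a \<le> m" "m \<le> b" "K \<subseteq> {..<m}"
  shows "represents (mweight S T m K - 3) (cochain_err S T m K) (minor_err S T m K)"
  using assms
proof (induction m arbitrary: K rule: nat_induct_at_least)
  case base
  then show ?case by (simp add: minor_err_below cochain_err_below)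
next
  case (Suc m)
  have fin: "finite K" using Suc(4) finite_subset by blast
  from Suc have am: "a \<le> m" "m < b" by simp_all
  then show ?case
  proof (cases rule: step_cases)
    case 1
    have "K - {m} \<subseteq> {..<m}" using Suc(4) by (auto simp: less_Suc_eq)
    then show ?thesis using Suc(2)[of "K - {m}"] Suc(3) mweight_S[of m S T K] fin 1 by simp
  next
    case 2
    let ?L = "add_mset m (mset_of K)" and ?C = "insert (m - 1) (K - {m})"
    let ?M = "add_mset (m - 1) (add_mset (m - 1) (mset_of (K - {m})))"
    let ?y = "\<lambda>M. \<Sum>J\<in>Pow {..<m}. prepend (coef (mset_of J) M) (cochain S T m J)"
    let ?z = "\<lambda>M. \<Sum>J\<in>Pow {..<m}. lead_coef (mset_of J) M * minor S T m J"
    have Km: "K \<subseteq> {..m}" using Suc(4) by auto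
    have fJ: "finite J" if "J \<in> Pow {..<m}" for J using that finite_subset by blast
    have "represents (mweight S T (Suc m) K - 3) (prepend (coef (mset_of J) ?L) (cochain_err S T m J)) (lead_coef (mset_of J) ?L * minor_err S T m J)"
      if J: "J \<in> Pow {..<m}" for J
    proof -
      have "m \<notin># mset_of J" using J fJ by auto
      then have neq: "mset_of J \<noteq> ?L" by auto
      have r: "represents (mweight S T m J - 3) (cochain_err S T m J) (minor_err S T m J)"
        using J Suc by simp
      have w: "mweight S T (Suc m) K - 3 = (mweight S T m J - 3) + 2 * (isum ?L - isum (mset_of J)) - 1"
        using mweight_T[OF 2 fJ[OF J], of K] by simp
      show ?thesis unfolding w by (rule represents_coef[OF r fJ[OF J] neq])
    qed
    then have 3: "represents (mweight S T (Suc m) K - 3) (\<Sum>J\<in>Pow {..<m}. prepend (coef (mset_of J) ?L) (cochain_err S T m J))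
        (\<Sum>J\<in>Pow {..<m}. lead_coef (mset_of J) ?L * minor_err S T m J)"
      by (rule represents_sum)
    have "represents (mweight S T (Suc m) K - 3) (prepend (coef M ?L) (?y M))
        (if m \<in> K \<and> 0 < m \<and> M = ?M then R m (m + 1) * ?z M else 0)"
      if M: "M \<in> bad m (Suc (card K))" for M
    proof (rule represents_bad[OF 2(2,1) Km M])
      show "represents (2 * (isum M + isum (mset_of (T \<inter> {..<m})) - isum (mset_of (S \<inter> {..<m}))) - int (card (T \<inter> {..<m})) - 1)
          (?y M) (?z M)"
      proof (rule represents_sum)
        fix J assume J: "J \<in> Pow {..<m}"
        have neq: "mset_of J \<noteq> M" using M not_nonsqf_mset_of[OF fJ[OF J]] by (auto simp: bad_def)
        have w: "2 * (isum M + isum (mset_of (T \<inter> {..<m})) - isum (mset_of (S \<inter> {..<m}))) - int (card (T \<inter> {..<m})) - 1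
          = mweight S T m J + 2 * (isum M - isum (mset_of J)) - 1"
          by (simp add: mweight_def)
        show "represents (2 * (isum M + isum (mset_of (T \<inter> {..<m})) - isum (mset_of (S \<inter> {..<m}))) - int (card (T \<inter> {..<m})) - 1)
          (prepend (coef (mset_of J) M) (cochain S T m J)) (lead_coef (mset_of J) M * minor S T m J)"
          unfolding w using J am by (intro represents_coef represents_cochain fJ neq) auto
      qed
    qed
    then have r: "represents (mweight S T (Suc m) K - 3) (\<Sum>M\<in>bad m (Suc (card K)). prepend (coef M ?L) (?y M))
        (\<Sum>M\<in>bad m (Suc (card K)). if m \<in> K \<and> 0 < m \<and> M = ?M then R m (m + 1) * ?z M else 0)"
      by (rule represents_sum)
    \<comment> \<open>Among all monomials with a square the sum retains the single one
      \<open>?M\<close>, which has the right degree to lie in \<open>bad\<close>.\<close>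
    have e1: "(\<Sum>M\<in>bad m (Suc (card K)). if m \<in> K \<and> 0 < m \<and> M = ?M then R m (m + 1) * ?z M else 0) =
        (if m \<in> K \<and> 0 < m then R m (m + 1) * ?z ?M else 0)"
    proof (cases "m \<in> K \<and> 0 < m")
      case True
      have e: "card K = Suc (card (K - {m}))" using card.remove[OF fin] True by blast
      have "2 \<le> count ?M (m - 1)" by simp
      then have "nonsqf ?M" unfolding nonsqf_def by blast
      then have "?M \<in> bad m (Suc (card K))"
        using True Km fin unfolding bad_def msets_def e by (auto simp del: card_Diff_singleton)
      then show ?thesis using True by (simp add: sum.delta')
    qed auto
    \<comment> \<open>If \<open>m - 1\<close> is in \<open>K\<close>, then \<open>?M\<close>
      contains a cube and its linear coefficients vanish. Otherwise \<open>?M\<close> is the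
      variable \<open>m - 1\<close> times the square-free monomial of \<open>?C\<close>.\<close>
    have e2: "(if m \<in> K \<and> 0 < m then R m (m + 1) * ?z ?M else 0) =
        (if m \<in> K \<and> 0 < m \<and> m - 1 \<notin> K then R m (m + 1) *
         (\<Sum>j\<in>{..<m} - ?C. R j (m - 1) * minor S T m (insert j ?C)) else 0)"
    proof (cases "m \<in> K \<and> 0 < m")
      case True
      show ?thesis
      proof (cases "m - 1 \<in> K")
        case True': True
        have "m - 1 \<in> K - {m}" using True True' by auto
        then have "3 \<le> count ?M (m - 1)" using fin by (simp add: count_mset_of)
        then have "?z ?M = 0" using fJ lead_coef_triple by (intro sum.neutral) (metis mult_zero_left)
        then show ?thesis using True' by simp
      next
        case False
        have "?M = add_mset (m - 1) (mset_of ?C)" using False fin by simp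
        moreover have "?C \<subseteq> {..<m}" using Km True by (auto simp: le_less)
        ultimately show ?thesis using lead_coef_sum[of "m - 1" ?C m "minor S T m"] True False fin by simp
      qed
    qed auto
    have 4: "represents (mweight S T (Suc m) K - 3) (\<Sum>M\<in>bad m (Suc (card K)). prepend (coef M ?L) (?y M))
        (if m \<in> K \<and> 0 < m \<and> m - 1 \<notin> K then R m (m + 1) *
         (\<Sum>j\<in>{..<m} - ?C. R j (m - 1) * minor S T m (insert j ?C)) else 0)"
      using r unfolding e1 e2 .
    show ?thesis using 2 represents_add[OF 3 4] lead_coef_sum[of m K m "minor_err S T m"] fin by simp
  qed
qed

end

section \<open>Minors\<close>

text \<open>Needed for the exchange at \<open>s\<close>, which does not affect the stages up to
  \<open>s\<close>.\<close>

lemma minor_cong: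
  assumes "S \<inter> {..<m} = S' \<inter> {..<m}" "T \<inter> {..<m} = T' \<inter> {..<m}"
  shows "minor S T m K = minor S' T' m K"
  using assms
proof (induction m arbitrary: K)
  case (Suc m)
  have IH: "minor S T m K = minor S' T' m K" for K
    using Suc by (intro Suc(1)) (auto simp: set_eq_iff less_Suc_eq)
  have "m \<in> S \<longleftrightarrow> m \<in> S'" "m \<in> T \<longleftrightarrow> m \<in> T'"
    using Suc(2,3) by (auto simp: set_eq_iff)
  then show ?case by (simp add: IH)
qed simp

lemma minor_not_subset: "\<not> K \<subseteq> S \<inter> {..<m} \<Longrightarrow> S \<inter> T = {} \<Longrightarrow> minor S T m K = 0"
proof (induction m arbitrary: K)
  case (Suc m)
  consider "m \<in> S" "m \<in> K" | "m \<in> S" "m \<notin> K" | "m \<notin> S" "m \<in> T" | "m \<notin> S" "m \<notin> T" by blast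
  then show ?case
  proof cases
    case 1
    then have "\<not> K - {m} \<subseteq> S \<inter> {..<m}" using Suc(2) by (auto simp: less_Suc_eq)
    then show ?thesis using 1 Suc by simp
  next
    case 2
    then show ?thesis by simp
  next
    case 3
    have "minor S T m (insert j K) = 0" if "K \<subseteq> {..<m}" for j
      using that Suc 3 by (intro Suc(1)) auto
    then show ?thesis using 3 by simp
  next
    case 4
    then have "\<not> K \<subseteq> S \<inter> {..<m}" using Suc(2) by (auto simp: less_Suc_eq)
    then show ?thesis using 4 Suc by simp
  qed
qed auto

section \<open>The effect of exchanging a row index with the next column index\<close>

abbreviation (input) swapS :: "nat set \<Rightarrow> nat \<Rightarrow> nat set" where
  "swapS S s \<equiv> S - {s} \<union> {s + 1}"
abbreviation (input) swapT :: "nat set \<Rightarrow> nat \<Rightarrow> nat set" where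
  "swapT T s \<equiv> T - {s + 1} \<union> {s}"

context split_interval
begin

text \<open>Both sides expand a column of index \<open>m0\<close> over the same minors below
  \<open>m0\<close>. After the exchange the column is a genuine one and row \<open>m0 + 1\<close> is
  struck out; before it, row \<open>m0\<close> is struck out and the column comes from the
  square.\<close>

lemma minor_swap_step:
  assumes "m0 \<in> S" "Suc m0 \<in> T" "K \<subseteq> {..Suc m0}"
  shows "minor (swapS S m0) (swapT T m0) (Suc (Suc m0)) K =
    (if Suc m0 \<in> K \<and> m0 \<notin> K then
      \<Sum>j\<in>{..<Suc m0} - insert m0 (K - {Suc m0}).
        R j m0 * minor S T (Suc m0) (insert j (insert m0 (K - {Suc m0})))
     else 0)"
proof -
  let ?Q = "K - {Suc m0}"
  have eq: "minor (swapS S m0) (swapT T m0) m0 J = minor S T m0 J" for J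
    by (rule minor_cong) auto
  show ?thesis
  proof (cases "Suc m0 \<in> K \<and> m0 \<notin> K")
    case True
    have Q: "?Q \<subseteq> {..<m0}"
    proof
      fix q assume q: "q \<in> ?Q"
      then have "q \<le> Suc m0" "q \<noteq> Suc m0" "q \<noteq> m0" using assms(3) True by auto
      then show "q \<in> {..<m0}" by simp
    qed
    have "minor (swapS S m0) (swapT T m0) (Suc (Suc m0)) K =
        (\<Sum>j\<in>{..<m0} - ?Q. R j m0 * minor S T m0 (insert j ?Q))"
      using True Q assms(1,2) by (simp add: eq[simplified])
    also have "\<dots> = (\<Sum>j\<in>{..<Suc m0} - insert m0 ?Q. R j m0 * minor S T (Suc m0) (insert j (insert m0 ?Q)))"
    proof (rule sum.cong)
      show "{..<m0} - ?Q = {..<Suc m0} - insert m0 ?Q" by auto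
      fix j assume "j \<in> {..<Suc m0} - insert m0 ?Q"
      then have "insert j (insert m0 ?Q) - {m0} = insert j ?Q" using True by auto
      then show "R j m0 * minor S T m0 (insert j ?Q) = R j m0 * minor S T (Suc m0) (insert j (insert m0 ?Q))"
        using assms(1) by simp
    qed
    finally show ?thesis using True by simp
  next
    case False
    then have "Suc m0 \<notin> K \<or> \<not> ?Q \<subseteq> {..<m0}" by auto
    then have "minor (swapS S m0) (swapT T m0) (Suc (Suc m0)) K = 0" by auto
    then show ?thesis unfolding if_not_P[OF False] .
  qed
qed

text \<open>Both sides follow the same linear recursion, and the term that enters at a column
  \<open>m\<close> is the summand \<open>s = m - 1\<close>.\<close>

lemma minor_err_eq:
  assumes "a \<le> m" "m \<le> b" "K \<subseteq> {..<m}"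
  shows "minor_err S T m K = (\<Sum>s | s \<in> S \<and> s + 1 \<in> T \<and> s + 1 < m.
    R (s + 1) (s + 2) * minor (swapS S s) (swapT T s) m K)"
  using assms
proof (induction m arbitrary: K rule: nat_induct_at_least)
  case base
  have "S \<subseteq> {a..<b}" using union by blast
  then have "{s. s \<in> S \<and> s + 1 \<in> T \<and> s + 1 < a} = {}" by auto
  then show ?case by (simp only: minor_err_below order_refl sum.empty)
next
  case (Suc m)
  let ?I = "{s. s \<in> S \<and> s + 1 \<in> T \<and> s + 1 < m}"
  let ?G = "\<lambda>m K s. R (s + 1) (s + 2) * minor (swapS S s) (swapT T s) m K"
  have fin: "finite ?I" by (rule finite_subset[of _ "{..<m}"]) auto
  from Suc have am: "a \<le> m" "m < b" by simp_all
  then show ?case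
  proof (cases rule: step_cases)
    case 1
    have I: "{s. s \<in> S \<and> s + 1 \<in> T \<and> s + 1 < Suc m} = ?I" using 1 by (auto simp: less_Suc_eq)
    have "?G (Suc m) K s = (if m \<in> K then ?G m (K - {m}) s else 0)" if "s \<in> ?I" for s
      using that 1 by auto
    then have "sum (?G (Suc m) K) ?I = (if m \<in> K then sum (?G m (K - {m})) ?I else 0)" by simp
    moreover have "K - {m} \<subseteq> {..<m}" using Suc(4) by (auto simp: less_Suc_eq)
    ultimately show ?thesis unfolding I using 1 Suc(2)[of "K - {m}"] am by simp
  next
    case 2
    let ?C = "insert (m - 1) (K - {m})"
    have "?G (Suc m) K s = (if K \<subseteq> {..<m} then \<Sum>j\<in>{..<m} - K. R j m * ?G m (insert j K) s else 0)" if "s \<in> ?I" for s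
      using that 2 by (auto simp: sum_distrib_left mult.left_commute)
    then have "sum (?G (Suc m) K) ?I = (if K \<subseteq> {..<m} then \<Sum>s\<in>?I. \<Sum>j\<in>{..<m} - K. R j m * ?G m (insert j K) s else 0)"
      by simp
    also have "\<dots> = (if K \<subseteq> {..<m} then \<Sum>j\<in>{..<m} - K. R j m * minor_err S T m (insert j K) else 0)"
    proof (cases "K \<subseteq> {..<m}")
      case True
      have "minor_err S T m (insert j K) = sum (?G m (insert j K)) ?I" if "j \<in> {..<m} - K" for j
        using that True am Suc(2)[of "insert j K"] by simp
      then show ?thesis using True by (subst sum.swap) (simp add: sum_distrib_left)
    qed simp
    finally have old: "sum (?G (Suc m) K) ?I =
      (if K \<subseteq> {..<m} then \<Sum>j\<in>{..<m} - K. R j m * minor_err S T m (insert j K) else 0)" .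
    have new: "(if m \<in> K \<and> 0 < m \<and> m - 1 \<notin> K then R m (m + 1) *
         (\<Sum>j\<in>{..<m} - ?C. R j (m - 1) * minor S T m (insert j ?C)) else 0) =
        (if 0 < m \<and> m - 1 \<in> S then ?G (Suc m) K (m - 1) else 0)"
    proof (cases "0 < m \<and> m - 1 \<in> S")
      case True
      then obtain m0 where m0: "m = Suc m0" "m0 \<in> S" using gr0_conv_Suc by auto
      have "K \<subseteq> {..Suc m0}" using Suc(4) m0 by auto
      from minor_swap_step[OF m0(2) _ this] show ?thesis
        using m0 2 by (simp del: minor.simps)
    next
      case False
      have "minor S T m (insert j ?C) = 0" if "0 < m" for j
        using False that disjoint by (intro minor_not_subset) auto
      then show ?thesis using False by auto
    qed
    have "{s. s \<in> S \<and> s + 1 \<in> T \<and> s + 1 < Suc m} = (if 0 < m \<and> m - 1 \<in> S then insert (m - 1) ?I else ?I)"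
      using 2 by (auto simp: less_Suc_eq)
    moreover have "m - 1 \<notin> ?I" by auto
    ultimately have "sum (?G (Suc m) K) {s. s \<in> S \<and> s + 1 \<in> T \<and> s + 1 < Suc m} =
        (if 0 < m \<and> m - 1 \<in> S then ?G (Suc m) K (m - 1) else 0) + sum (?G (Suc m) K) ?I"
      using fin by (simp del: minor.simps)
    then show ?thesis unfolding old new[symmetric] using 2 by (simp add: add.commute)
  qed
qed

text \<open>The counterpart of \<open>cobar_d_cochain\<close> for leading terms: the differential of
  a minor exchanges an omitted row \<open>l\<close> for a smaller one. With no row omitted the sum
  is empty, so the full determinant is a cycle.\<close>

lemma dX_minor:
  assumes "a \<le> m" "m \<le> b" "K \<subseteq> {..<m}"
  shows "dX (minor S T m K) = (\<Sum>l\<in>K. \<Sum>i\<in>{..<l} - K. R i l * minor S T m (insert i (K - {l})))"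
  using assms
proof (induction m arbitrary: K rule: nat_induct_at_least)
  case base
  then show ?case by (simp add: minor_below)
next
  case (Suc m)
  have fin: "finite K" using Suc(4) finite_subset by blast
  from Suc have am: "a \<le> m" "m < b" by simp_all
  have IH: "dX (minor S T m K) = (\<Sum>l\<in>K. \<Sum>i\<in>{..<l} - K. R i l * minor S T m (insert i (K - {l})))"
    if "K \<subseteq> {..<m}" for K
    using that Suc(2) am by simp
  let ?D = "minor S T m" and ?D' = "minor S T (Suc m)"
  from am show ?case
  proof (cases rule: step_cases)
    case 1
    show ?thesis
    proof (cases "m \<in> K")
      case True
      have Q: "K - {m} \<subseteq> {..<m}" using Suc(4) by (auto simp: less_Suc_eq)
      have "(\<Sum>l\<in>K. \<Sum>i\<in>{..<l} - K. R i l * ?D' (insert i (K - {l}))) =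
          (\<Sum>l\<in>K - {m}. \<Sum>i\<in>{..<l} - K. R i l * ?D' (insert i (K - {l})))"
        using True fin 1 by (subst sum.remove[of K m]) (auto intro!: sum.neutral)
      also have "\<dots> = (\<Sum>l\<in>K - {m}. \<Sum>i\<in>{..<l} - (K - {m}). R i l * ?D (insert i (K - {m} - {l})))"
      proof (intro sum.cong refl)
        fix l assume l: "l \<in> K - {m}"
        then show "{..<l} - K = {..<l} - (K - {m})" using Q by auto
        fix i assume i: "i \<in> {..<l} - (K - {m})"
        have "i < m" using i l Q by auto
        then have "insert i (K - {l}) - {m} = insert i (K - {m} - {l})" by auto
        then show "R i l * ?D' (insert i (K - {l})) = R i l * ?D (insert i (K - {m} - {l}))"
          using 1 True l by simp
      qed
      finally show ?thesis using 1 True IH[OF Q] by simp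
    next
      case False
      have "?D' (insert i (K - {l})) = 0" if "l \<in> K" "i \<in> {..<l} - K" for l i
        using that False 1 Suc(4) by (auto simp: less_Suc_eq)
      then show ?thesis using 1 False by simp
    qed
  next
    case 2
    show ?thesis
    proof (cases "m \<in> K")
      case True
      let ?Q = "K - {m}"
      have Q: "?Q \<subseteq> {..<m}" using Suc(4) by (auto simp: less_Suc_eq)
      let ?P = "Sigma ({..<m} - ?Q) (\<lambda>i. {..<m} - insert i ?Q)"
      let ?h = "\<lambda>(i, j). R i m * (R j m * ?D (insert j (insert i ?Q)))"
      have "(\<Sum>l\<in>K. \<Sum>i\<in>{..<l} - K. R i l * ?D' (insert i (K - {l}))) =
          (\<Sum>i\<in>{..<m} - K. R i m * ?D' (insert i ?Q))"
        using True fin 2 by (subst sum.remove[of K m]) (auto intro!: sum.neutral)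
      also have "\<dots> = (\<Sum>i\<in>{..<m} - ?Q. \<Sum>j\<in>{..<m} - insert i ?Q. ?h (i, j))"
        using 2 Q by (intro sum.cong) (auto simp: sum_distrib_left)
      also have "\<dots> = sum ?h ?P"
        by (subst sum.Sigma) (auto intro!: sum.cong)
      \<comment> \<open>This is an expansion along two equal columns \<open>m\<close>: it is
        symmetric in \<open>i\<close> and \<open>j\<close>, and \<open>i = j\<close> is
        excluded.\<close>
      also have "\<dots> = (\<Sum>i | (i, i) \<in> ?P. ?h (i, i))"
        by (rule sum_symmetric) (auto simp: insert_commute mult.left_commute)
      also have "\<dots> = 0" by (intro sum.neutral) auto
      finally have "(\<Sum>l\<in>K. \<Sum>i\<in>{..<l} - K. R i l * ?D' (insert i (K - {l}))) = 0" .
      moreover have "?D' K = 0" using 2 True by auto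
      ultimately show ?thesis by (simp only: dX_0)
    next
      case False
      have K: "K \<subseteq> {..<m}" using False Suc(4) by (auto simp: less_Suc_eq)
      let ?U = "{..<m} - K"
      have finU: "finite ?U" by simp
      \<comment> \<open>The differential of \<open>R j m\<close> passes through an index that is
        either omitted already (\<open>A\<close>) or not (\<open>C\<close>). Differentiating the
        smaller minors gives \<open>C\<close> again, when the newly omitted row is exchanged, and
        otherwise \<open>B\<close>.\<close>
      define A where "A = (\<Sum>l\<in>K. \<Sum>i\<in>{..<l} - K. R i l * (R l m * ?D (insert i K)))"
      define B where "B = (\<Sum>l\<in>K. \<Sum>i\<in>{..<l} - K. \<Sum>j\<in>?U - {i}. R i l * (R j m * ?D (insert j (insert i (K - {l})))))"
      define C where "C = (\<Sum>j\<in>?U. \<Sum>k\<in>?U \<inter> {j<..}. R j k * (R k m * ?D (insert j K)))"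
      have "(\<Sum>l\<in>K. \<Sum>i\<in>{..<l} - K. R i l * ?D' (insert i (K - {l}))) =
          (\<Sum>l\<in>K. \<Sum>i\<in>{..<l} - K. R i l * (R l m * ?D (insert i K))
             + (\<Sum>j\<in>?U - {i}. R i l * (R j m * ?D (insert j (insert i (K - {l}))))))"
      proof (intro sum.cong refl)
        fix l i assume l: "l \<in> K" and i: "i \<in> {..<l} - K"
        have sub: "insert i (K - {l}) \<subseteq> {..<m}" using l i K by auto
        have U: "{..<m} - insert i (K - {l}) = insert l (?U - {i})" using l i K by auto
        have e: "insert l (insert i (K - {l})) = insert i K" using l by auto
        have "?D' (insert i (K - {l})) = (\<Sum>j\<in>{..<m} - insert i (K - {l}). R j m * ?D (insert j (insert i (K - {l}))))"
          using 2 sub by simp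
        also have "\<dots> = R l m * ?D (insert i K) + (\<Sum>j\<in>?U - {i}. R j m * ?D (insert j (insert i (K - {l}))))"
          unfolding U using l e by (subst sum.insert) auto
        finally show "R i l * ?D' (insert i (K - {l})) = R i l * (R l m * ?D (insert i K))
             + (\<Sum>j\<in>?U - {i}. R i l * (R j m * ?D (insert j (insert i (K - {l})))))"
          by (simp only: distrib_left sum_distrib_left)
      qed
      also have "\<dots> = A + B" by (simp only: A_def B_def sum.distrib)
      finally have rhs: "(\<Sum>l\<in>K. \<Sum>i\<in>{..<l} - K. R i l * ?D' (insert i (K - {l}))) = A + B" .
      have "dX (?D' K) = (\<Sum>j\<in>?U. dX (R j m) * ?D (insert j K)) + (\<Sum>j\<in>?U. R j m * dX (?D (insert j K)))"
        using 2 K by (simp add: dX_sum dX_mult sum.distrib)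
      also have "(\<Sum>j\<in>?U. dX (R j m) * ?D (insert j K)) = A + C"
      proof -
        have "(\<Sum>j\<in>?U. dX (R j m) * ?D (insert j K)) =
            (\<Sum>j\<in>?U. (\<Sum>k\<in>K \<inter> {j<..}. R j k * (R k m * ?D (insert j K))) + (\<Sum>k\<in>?U \<inter> {j<..}. R j k * (R k m * ?D (insert j K))))"
        proof (rule sum.cong[OF refl])
          fix j assume "j \<in> ?U"
          have e: "{j<..<m} = (K \<inter> {j<..}) \<union> (?U \<inter> {j<..})" using K by auto
          show "dX (R j m) * ?D (insert j K) = (\<Sum>k\<in>K \<inter> {j<..}. R j k * (R k m * ?D (insert j K))) + (\<Sum>k\<in>?U \<inter> {j<..}. R j k * (R k m * ?D (insert j K)))"
            unfolding dX_R e sum_distrib_right mult.assoc using fin by (intro sum.union_disjoint) auto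
        qed
        also have "\<dots> = (\<Sum>j\<in>?U. (\<Sum>k\<in>K \<inter> {j<..}. R j k * (R k m * ?D (insert j K)))) + C"
          by (simp only: sum.distrib C_def)
        also have "(\<Sum>j\<in>?U. (\<Sum>k\<in>K \<inter> {j<..}. R j k * (R k m * ?D (insert j K)))) = A"
          unfolding A_def using fin K
          by (subst (1 2) sum.Sigma)
            (auto intro!: sum.reindex_bij_witness[of _ "\<lambda>(x, y). (y, x)" "\<lambda>(x, y). (y, x)"])
        finally show ?thesis .
      qed
      also have "(\<Sum>j\<in>?U. R j m * dX (?D (insert j K))) = C + B"
      proof -
        have "(\<Sum>j\<in>?U. R j m * dX (?D (insert j K))) =
          (\<Sum>j\<in>?U. (\<Sum>i\<in>?U \<inter> {..<j}. R j m * (R i j * ?D (insert i K))) +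
            (\<Sum>l\<in>K. \<Sum>i\<in>{..<l} - insert j K. R j m * (R i l * ?D (insert i (insert j K - {l})))))"
        proof (rule sum.cong[OF refl])
          fix j assume j: "j \<in> ?U"
          have e: "{..<j} - insert j K = ?U \<inter> {..<j}" using j by auto
          have "dX (?D (insert j K)) = (\<Sum>l\<in>insert j K. \<Sum>i\<in>{..<l} - insert j K. R i l * ?D (insert i (insert j K - {l})))"
            using j K by (intro IH) auto
          also have "\<dots> = (\<Sum>i\<in>?U \<inter> {..<j}. R i j * ?D (insert i K)) +
              (\<Sum>l\<in>K. \<Sum>i\<in>{..<l} - insert j K. R i l * ?D (insert i (insert j K - {l})))"
            using j fin by (subst sum.insert) (auto simp: e)
          finally show "R j m * dX (?D (insert j K)) = (\<Sum>i\<in>?U \<inter> {..<j}. R j m * (R i j * ?D (insert i K))) +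
            (\<Sum>l\<in>K. \<Sum>i\<in>{..<l} - insert j K. R j m * (R i l * ?D (insert i (insert j K - {l}))))"
            by (simp only: distrib_left sum_distrib_left)
        qed
        also have "\<dots> = (\<Sum>j\<in>?U. \<Sum>i\<in>?U \<inter> {..<j}. R j m * (R i j * ?D (insert i K))) +
            (\<Sum>j\<in>?U. \<Sum>l\<in>K. \<Sum>i\<in>{..<l} - insert j K. R j m * (R i l * ?D (insert i (insert j K - {l}))))"
          by (simp only: sum.distrib)
        also have "(\<Sum>j\<in>?U. \<Sum>i\<in>?U \<inter> {..<j}. R j m * (R i j * ?D (insert i K))) = C"
          unfolding C_def
          by (subst (1 2) sum.Sigma)
            (auto intro!: sum.reindex_bij_witness[of _ "\<lambda>(x, y). (y, x)" "\<lambda>(x, y). (y, x)"] simp: mult.left_commute)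
        also have "(\<Sum>j\<in>?U. \<Sum>l\<in>K. \<Sum>i\<in>{..<l} - insert j K. R j m * (R i l * ?D (insert i (insert j K - {l})))) = B"
        proof -
          have "(\<Sum>j\<in>?U. \<Sum>i\<in>{..<l} - insert j K. R j m * (R i l * ?D (insert i (insert j K - {l})))) =
              (\<Sum>i\<in>{..<l} - K. \<Sum>j\<in>?U - {i}. R i l * (R j m * ?D (insert j (insert i (K - {l})))))" if l: "l \<in> K" for l
          proof -
            have s: "insert i (insert j K - {l}) = insert j (insert i (K - {l}))" if "j \<in> ?U" for i j
              using that l by auto
            show ?thesis using l K
              by (subst (1 2) sum.Sigma)
                (auto intro!: sum.reindex_bij_witness[of _ "\<lambda>(x, y). (y, x)" "\<lambda>(x, y). (y, x)"] simp: s mult.left_commute)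
          qed
          then show ?thesis unfolding B_def by (subst sum.swap) simp
        qed
        finally show ?thesis .
      qed
      finally have "dX (?D' K) = A + B" by (simp add: add_ac)
      then show ?thesis unfolding rhs .
    qed
  qed
qed

end

section \<open>The determinant and its differential\<close>

lemma sorted_list_of_set_Int_lessThan_Suc:
  assumes "m \<in> T"
  shows "sorted_list_of_set (T \<inter> {..<Suc m}) = sorted_list_of_set (T \<inter> {..<m}) @ [m]"
  by (rule sorted_distinct_set_unique)
    (use assms in \<open>auto simp: sorted_append less_Suc_eq\<close>)

lemma det_zero_row:
  fixes A :: "X mat"
  assumes "A \<in> carrier_mat n n" "i < n" "\<And>j. j < n \<Longrightarrow> A $$ (i, j) = 0"
  shows "det A = 0"
  using laplace_expansion_row[OF assms(1,2)] assms(3) by simp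

text \<open>Laplace expansion; the signs disappear in characteristic two.\<close>

lemma det_last_column:
  fixes f :: "nat \<Rightarrow> nat \<Rightarrow> X"
  assumes "length ss = Suc n" "length ts = n"
  shows "det (mat (Suc n) (Suc n) (\<lambda>(i, j). f (ss ! i) ((ts @ [t]) ! j))) =
    (\<Sum>i<Suc n. f (ss ! i) t * det (mat n n (\<lambda>(k, j). f ((take i ss @ drop (Suc i) ss) ! k) (ts ! j))))"
proof -
  let ?A = "mat (Suc n) (Suc n) (\<lambda>(i, j). f (ss ! i) ((ts @ [t]) ! j))"
  have "det ?A = (\<Sum>i<Suc n. ?A $$ (i, n) * cofactor ?A i n)"
    by (rule laplace_expansion_column) simp_all
  also have "\<dots> = (\<Sum>i<Suc n. f (ss ! i) t * det (mat n n (\<lambda>(k, j). f ((take i ss @ drop (Suc i) ss) ! k) (ts ! j))))"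
  proof (rule sum.cong[OF refl])
    fix i assume i: "i \<in> {..<Suc n}"
    have del: "mat_delete ?A i n = mat n n (\<lambda>(k, j). f ((take i ss @ drop (Suc i) ss) ! k) (ts ! j))"
      using assms i by (intro eq_matI) (auto simp: mat_delete_def nth_append)
    have "?A $$ (i, n) = f (ss ! i) t" using assms i by (simp add: nth_append)
    then show "?A $$ (i, n) * cofactor ?A i n =
        f (ss ! i) t * det (mat n n (\<lambda>(k, j). f ((take i ss @ drop (Suc i) ss) ! k) (ts ! j)))"
      unfolding cofactor_def del by simp
  qed
  finally show ?thesis .
qed

text \<open>The rows are given by a list of distinct indices, so that striking out one of them stays
  within the induction.\<close>

lemma minor_det:
  assumes "S \<inter> T = {}" "distinct ss" "set ss = S \<inter> {..<m} - K" "K \<subseteq> S \<inter> {..<m}"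
    "length ss = card (T \<inter> {..<m})"
  shows "minor S T m K =
    det (mat (length ss) (length ss) (\<lambda>(i, j). R (ss ! i) (sorted_list_of_set (T \<inter> {..<m}) ! j)))"
  using assms(2-)
proof (induction m arbitrary: K ss)
  case 0
  then show ?case by simp
next
  case (Suc m)
  let ?ts = "sorted_list_of_set (T \<inter> {..<m})"
  have len_ts: "length ?ts = card (T \<inter> {..<m})" by simp
  consider "m \<in> S" "m \<in> K" | "m \<in> S" "m \<notin> K" | "m \<notin> S" "m \<in> T" | "m \<notin> S" "m \<notin> T" by blast
  then show ?case
  proof cases
    case 1
    then have "m \<notin> T" using assms(1) by blast
    then have T: "T \<inter> {..<Suc m} = T \<inter> {..<m}" by (simp add: Int_lessThan_Suc)
    have "minor S T m (K - {m}) = det (mat (length ss) (length ss) (\<lambda>(i, j). R (ss ! i) (?ts ! j)))"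
    proof (rule Suc(1)[OF Suc(2)])
      have s: "S \<inter> {..<Suc m} = insert m (S \<inter> {..<m})" using 1 by (simp add: Int_lessThan_Suc)
      show "set ss = S \<inter> {..<m} - (K - {m})" using Suc(3) 1(2) unfolding s by auto
      show "K - {m} \<subseteq> S \<inter> {..<m}" using Suc(4) unfolding s by blast
      show "length ss = card (T \<inter> {..<m})" using Suc(5) unfolding T .
    qed
    then show ?thesis using 1 unfolding T by simp
  next
    case 2
    then have "m \<notin> T" using assms(1) by blast
    then have T: "T \<inter> {..<Suc m} = T \<inter> {..<m}" by (simp add: Int_lessThan_Suc)
    have "m \<in> set ss" using 2 Suc(3) by simp
    then obtain i where i: "i < length ss" "ss ! i = m" by (meson in_set_conv_nth)
    \<comment> \<open>Row \<open>m\<close> consists of zeros: all columns present have an index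
      below \<open>m\<close>.\<close>
    have "det (mat (length ss) (length ss) (\<lambda>(i, j). R (ss ! i) (?ts ! j))) = 0"
    proof (rule det_zero_row[OF _ i(1)])
      fix j assume j: "j < length ss"
      then have "?ts ! j \<in> set ?ts" using Suc(5) len_ts unfolding T by (intro nth_mem) simp
      then have "?ts ! j < m" by simp
      then show "mat (length ss) (length ss) (\<lambda>(i, j). R (ss ! i) (?ts ! j)) $$ (i, j) = 0"
        using i j by (simp add: R_def)
    qed simp
    then show ?thesis using 2 unfolding T by simp
  next
    case 3
    have K: "K \<subseteq> S \<inter> {..<m}" using Suc(4) 3 by (simp add: Int_lessThan_Suc)
    have ss: "set ss = S \<inter> {..<m} - K" using Suc(3) 3 by (simp add: Int_lessThan_Suc)
    have "length ss = Suc (length ?ts)" using Suc(5) 3 by (simp add: Int_lessThan_Suc)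
    then obtain n where n: "length ss = Suc n" "length ?ts = n" by simp
    have "minor S T (Suc m) K = (\<Sum>j\<in>{..<m} - K. R j m * minor S T m (insert j K))"
      using 3 K by auto
    also have "\<dots> = (\<Sum>j\<in>set ss. R j m * minor S T m (insert j K))"
    proof (rule sum.mono_neutral_right)
      show "\<forall>j\<in>{..<m} - K - set ss. R j m * minor S T m (insert j K) = 0"
      proof
        fix j assume "j \<in> {..<m} - K - set ss"
        then have "\<not> insert j K \<subseteq> S \<inter> {..<m}" using ss by auto
        then show "R j m * minor S T m (insert j K) = 0" using minor_not_subset[OF _ assms(1)] by simp
      qed
    qed (use ss in auto)
    also have "\<dots> = (\<Sum>i<Suc n. R (ss ! i) m * minor S T m (insert (ss ! i) K))"
      using sum.reindex_bij_betw[OF bij_betw_nth[OF Suc(2) refl refl], of "\<lambda>j. R j m * minor S T m (insert j K)"]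
      unfolding n by (rule sym)
    also have "\<dots> = (\<Sum>i<Suc n. R (ss ! i) m * det (mat n n (\<lambda>(k, j). R ((take i ss @ drop (Suc i) ss) ! k) (?ts ! j))))"
    proof (rule sum.cong[OF refl])
      fix i assume "i \<in> {..<Suc n}"
      then have i: "i < length ss" using n by simp
      let ?ss = "take i ss @ drop (Suc i) ss"
      have ds: "distinct ss" by (rule Suc(2))
      have split: "ss = take i ss @ ss ! i # drop (Suc i) ss" by (rule id_take_nth_drop[OF i])
      then have "distinct (take i ss @ ss ! i # drop (Suc i) ss)" using ds by simp
      then have d: "distinct ?ss" "ss ! i \<notin> set ?ss" by auto
      have "set ss = insert (ss ! i) (set ?ss)" by (subst split) simp
      then have "set ?ss = S \<inter> {..<m} - insert (ss ! i) K" using d(2) ss by blast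
      moreover have "insert (ss ! i) K \<subseteq> S \<inter> {..<m}" using K ss nth_mem[OF i] by auto
      moreover have "length ?ss = n" using i n by simp
      ultimately have "minor S T m (insert (ss ! i) K) = det (mat n n (\<lambda>(k, j). R (?ss ! k) (?ts ! j)))"
        using Suc(1)[of ?ss "insert (ss ! i) K"] d(1) n len_ts by simp
      then show "R (ss ! i) m * minor S T m (insert (ss ! i) K) =
          R (ss ! i) m * det (mat n n (\<lambda>(k, j). R (?ss ! k) (?ts ! j)))" by simp
    qed
    also have "\<dots> = det (mat (Suc n) (Suc n) (\<lambda>(i, j). R (ss ! i) ((?ts @ [m]) ! j)))"
      by (rule det_last_column[OF n, symmetric])
    finally show ?thesis unfolding sorted_list_of_set_Int_lessThan_Suc[OF 3(2)] n .
  next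
    case 4
    have "minor S T m K = det (mat (length ss) (length ss) (\<lambda>(i, j). R (ss ! i) (?ts ! j)))"
      using Suc(2-) 4 by (intro Suc(1)) (auto simp: Int_lessThan_Suc)
    then show ?thesis using 4 by (simp add: Int_lessThan_Suc)
  qed
qed

lemma (in split_interval) R_det_eq_minor:
  assumes "card S = card T"
  shows "R_det S T = minor S T b {}"
proof -
  have sub: "S \<subseteq> {a..<b}" "T \<subseteq> {a..<b}" using union by blast+
  then have "S \<inter> {..<b} = S" "T \<inter> {..<b} = T" "finite S" by (auto intro: finite_subset)
  then show ?thesis
    using minor_det[OF disjoint, of "sorted_list_of_set S" b "{}"] assms
    by (simp add: R_det_def elt_def)
qed

lemma R_det_single: "R_det {i} {j} = R i j"
proof -
  have "det (mat 1 1 (\<lambda>(k, l). R (elt {i} k) (elt {j} l))) = R i j"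
    using laplace_expansion_row[of "mat 1 1 (\<lambda>(k, l). R (elt {i} k) (elt {j} l))" 1 0]
    by (simp add: cofactor_def elt_def mat_delete_def)
  then show ?thesis by (simp add: R_det_def)
qed

lemma homologous_refl: "dX z = 0 \<Longrightarrow> homologous z z"
  by (intro homologousI[of _ _ 0]) simp_all

lemma HX_class_mult: "dX y = 0 \<Longrightarrow> dX z = 0 \<Longrightarrow> HX_class y * HX_class z = HX_class (y * z)"
  by (intro times_HX.abs_eq homologous_refl)

lemma HX_class_sum:
  assumes "\<And>s. s \<in> I \<Longrightarrow> dX (f s) = 0"
  shows "(\<Sum>s\<in>I. HX_class (f s)) = HX_class (\<Sum>s\<in>I. f s)"
  using assms
proof (induction I rule: infinite_finite_induct)
  case (insert s I)
  then show ?case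
    by (simp add: dX_sum plus_HX.abs_eq homologous_refl)
qed (simp_all add: zero_HX_def)

theorem theorem3p12:
  fixes S T :: "nat set"
  assumes "H_index S T"
  shows "d3 (HX_to_E3 (h S T)) =
    HX_to_E3 (\<Sum>s\<in>{s \<in> S. s + 1 \<in> T}.
      h {s + 1} {s + 2} * h (S - {s} \<union> {s + 1}) (T - {s + 1} \<union> {s}))"
proof
  fix p
  obtain a n where n: "card S = n" "card T = n" "S \<union> T = {a..<a + 2 * n}"
    using assms unfolding H_index_def by blast
  define b where "b = a + 2 * n"
  have fin: "finite S" "finite T" using n(3) by (metis finite_Un finite_atLeastLessThan)+
  have "card (S \<union> T) + card (S \<inter> T) = card S + card T" using card_Un_Int[OF fin] by simp
  then have "S \<inter> T = {}" using n fin by simp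
  then interpret split_interval S T a b using n(3) by unfold_locales (simp_all add: b_def)
  have ab: "a \<le> b" "b \<le> b" by (simp_all add: b_def)
  have sub: "S \<subseteq> {..<b}" "T \<subseteq> {..<b}" using union by auto
  let ?I = "{s \<in> S. s + 1 \<in> T}"
  define z where "z = R_det S T"
  define z' where "z' = (\<Sum>s\<in>?I. R (s + 1) (s + 2) * R_det (swapS S s) (swapT T s))"
  define w where "w = mweight S T b {}"
  have z: "z = minor S T b {}" unfolding z_def using n by (intro R_det_eq_minor) simp
  have dz: "dX z = 0" unfolding z using dX_minor[OF ab, of "{}"] by simp
  \<comment> \<open>Raising a row index and lowering a column index by one each takes 4 off the
    weight. The factor \<open>R (s + 1) (s + 2)\<close> puts 1 back, which leaves
    \<open>w - 3\<close>.\<close>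
  have swap: "split_interval (swapS S s) (swapT T s) a b" "card (swapS S s) = card (swapT T s)"
    "mweight (swapS S s) (swapT T s) b {} = w - 4" if s: "s \<in> ?I" for s
  proof -
    have nin: "s + 1 \<notin> S" "s \<notin> T" using s disjoint by auto
    show "split_interval (swapS S s) (swapT T s) a b"
    proof
      show "swapS S s \<inter> swapT T s = {}" using nin disjoint by auto
      have "swapS S s \<union> swapT T s = S \<union> T" using s by auto
      then show "swapS S s \<union> swapT T s = {a..<b}" using union by simp
    qed
    have sS: "s \<in> S" and sT: "s + 1 \<in> T" using s by simp_all
    have cS: "card (swapS S s) = card S"
      unfolding card.remove[OF fin(1) sS] using nin fin by (simp del: card_Diff_singleton)
    have cT: "card (swapT T s) = card T"
      unfolding card.remove[OF fin(2) sT] using nin fin by (simp del: card_Diff_singleton)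
    show "card (swapS S s) = card (swapT T s)" unfolding cS cT using n by simp
    have "S \<inter> {..<b} = S" "T \<inter> {..<b} = T" "swapS S s \<inter> {..<b} = swapS S s" "swapT T s \<inter> {..<b} = swapT T s"
      using sub s by auto
    moreover have "isum (mset_of (swapS S s)) = isum (mset_of S) + 1"
      using nin fin isum_mset_of_remove[OF fin(1) sS] by simp
    moreover have "isum (mset_of (swapT T s)) = isum (mset_of T) - 1"
      using nin fin isum_mset_of_remove[OF fin(2) sT] by simp
    ultimately show "mweight (swapS S s) (swapT T s) b {} = w - 4"
      using cT by (simp only: w_def mweight_def) simp
  qed
  have minor_swap: "R_det (swapS S s) (swapT T s) = minor (swapS S s) (swapT T s) b {}" if "s \<in> ?I" for s
    using split_interval.R_det_eq_minor[OF swap(1,2)[OF that]] .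
  have d_swap: "dX (R_det (swapS S s) (swapT T s)) = 0" if "s \<in> ?I" for s
    unfolding minor_swap[OF that] using split_interval.dX_minor[OF swap(1)[OF that] ab, of "{}"] by simp
  have d_step: "dX (R (s + 1) (s + 2)) = 0" for s
    unfolding dX_R by (intro sum.neutral) auto
  have rhs: "(\<Sum>s\<in>?I. h {s + 1} {s + 2} * h (swapS S s) (swapT T s)) = HX_class z'"
  proof -
    have "h {s + 1} {s + 2} * h (swapS S s) (swapT T s) = HX_class (R (s + 1) (s + 2) * R_det (swapS S s) (swapT T s))"
      if "s \<in> ?I" for s
      unfolding h_def R_det_single by (rule HX_class_mult[OF d_step d_swap[OF that]])
    then have "(\<Sum>s\<in>?I. h {s + 1} {s + 2} * h (swapS S s) (swapT T s)) =
        (\<Sum>s\<in>?I. HX_class (R (s + 1) (s + 2) * R_det (swapS S s) (swapT T s)))" by (rule sum.cong[OF refl])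
    also have "\<dots> = HX_class z'"
      unfolding z'_def using d_step d_swap by (intro HX_class_sum) (simp add: dX_mult)
    finally show ?thesis .
  qed
  have dz': "dX z' = 0"
    unfolding z'_def dX_sum using d_step d_swap by (intro sum.neutral) (simp add: dX_mult)
  have homog_z': "homog (w - 3) z'"
    unfolding z'_def
  proof (rule homog_sum)
    fix s assume s: "s \<in> ?I"
    have "homog (w - 4) (R_det (swapS S s) (swapT T s))"
      using split_interval.homog_minor[OF swap(1)[OF s] ab, of "{}"]
      unfolding minor_swap[OF s] swap(3)[OF s] by simp
    from homog_R[OF this, where i = "s + 1" and j = "s + 2"]
    show "homog (w - 3) (R (s + 1) (s + 2) * R_det (swapS S s) (swapT T s))" by simp
  qed
  have z': "z' = minor_err S T b {}"
  proof -
    have "{s. s \<in> S \<and> s + 1 \<in> T \<and> s + 1 < b} = ?I" using sub by auto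
    then show ?thesis
      using minor_err_eq[OF ab, of "{}"] minor_swap unfolding z'_def
      by (metis (no_types, lifting) empty_subsetI sum.cong)
  qed
  \<comment> \<open>The class is concentrated in filtration \<open>w\<close>; elsewhere zero
    represents it.\<close>
  define y where "y = (if p + 3 = w then cochain S T b {} else 0)"
  \<comment> \<open>For \<open>K = {}\<close> the coefficient of every nonempty \<open>J\<close>
    vanishes by degree, so only the failure remains.\<close>
  have dy: "cobar_d y = (if p + 3 = w then cochain_err S T b {} else 0)"
  proof -
    have "prepend (coef (mset_of J) (mset_of {})) (cochain S T b J) = 0" if "J \<in> Pow {..<b} - {{}}" for J
    proof -
      have "finite J" using that finite_subset by blast
      then have "coef (mset_of J) (mset_of {}) = 0" using that by (intro coef_size) auto
      then show ?thesis by simp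
    qed
    then show ?thesis using cobar_d_cochain[OF ab, of "{}"] by (simp add: y_def)
  qed
  have represents_y: "represents (p + 3) y z"
  proof (cases "p + 3 = w")
    case True
    then show ?thesis using represents_cochain[OF ab, of "{}"] by (simp add: y_def z w_def)
  next
    case False
    have "homog w z" using homog_minor[OF ab, of "{}"] by (simp add: z w_def)
    then show ?thesis using False by (simp add: y_def represents_def X_to_cobar_homog)
  qed
  \<comment> \<open>Away from filtration \<open>w - 3\<close> both sides are zero, the right one by
    homogeneity of \<open>z'\<close>.\<close>
  have represents_dy: "represents p (cobar_d y) z'"
  proof (cases "p + 3 = w")
    case True
    then have "p = w - 3" by simp
    then show ?thesis using represents_cochain_err[OF ab, of "{}"] True by (simp add: dy z' w_def)
  next
    case False
    then have "p \<noteq> w - 3" by simp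
    then show ?thesis using False X_to_cobar_homog[OF homog_z'] by (simp add: dy represents_def)
  qed
  have y: "y \<in> Z 3 (p + 3)" using represents_F[OF represents_y] represents_F[OF represents_dy] by (simp add: ss_Z_def)
  have dyZ: "cobar_d y \<in> Z 3 p" using represents_F[OF represents_dy] by (simp add: ss_Z_def cobar_d_d)
  have "HX_to_E3 (h S T) (p + 3) = ss_class cobar_d cobar_F 3 (p + 3) y"
    unfolding h_def z_def[symmetric] by (rule HX_to_E3_class[OF dz y represents_y])
  then have "d3 (HX_to_E3 (h S T)) p = ss_class cobar_d cobar_F 3 p (cobar_d y)"
    using y by (rule d3_class)
  also have "\<dots> = HX_to_E3 (HX_class z') p"
    by (rule HX_to_E3_class[OF dz' dyZ represents_dy, symmetric])
  finally show "d3 (HX_to_E3 (h S T)) p = HX_to_E3 (\<Sum>s\<in>{s \<in> S. s + 1 \<in> T}.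
      h {s + 1} {s + 2} * h (S - {s} \<union> {s + 1}) (T - {s + 1} \<union> {s})) p"
    unfolding rhs .
qed

end
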